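(* Let $(\mathsf D,(\bullet,\Phi,\iota),(\circ,\Psi,\upsilon),\xi)$ be a $\mathsf{Lax}^+\mathsf{Oplax}_+$-duoidal category. Then: (1) The category of cosemigroups in the $\mathsf{Lax}^+$-monoidal category $(\mathsf D,\bullet,\Phi,\iota)$ is $\mathsf{Oplax}_+$-monoidal via the structure $(\circ,\Psi,\upsilon)$. (2) The category of semigroups in the $\mathsf{Oplax}_+$-monoidal category $(\mathsf D,\circ,\Psi,\upsilon)$ is $\mathsf{Lax}^+$-monoidal via the structure $(\bullet,\Phi,\iota)$.
   Context: Conventions: $gf$ means first $f$, then $g$ (also for vertical composition of natural transformations); $\cdot$ is composition of functors and Godement (horizontal) product of natural transformations; $1$ denotes any identity; $\mathsf A^n$ is the $n$-fold Cartesian power of a category, and $G^n=G\times\cdots\times G$. A $\mathsf{Lax}^+$-monoidal category $(\mathsf L,\bullet,\Phi,\iota)$ consists of a category $\mathsf L$, functors $\bullet_n:\mathsf L^n\to\mathsf L$ for all $n\ge 1$, natural transformations $\Phi_{k_1,\dots,k_n}:\bullet_n\cdot(\bullet_{k_1}\times\cdots\times\bullet_{k_n})\to\bullet_K$ (where $K=\sum_i k_i$) for all positive integers $n,k_1,\dots,k_n$, and $\iota:1\to\bullet_1$, such that for all positive integers $n$, $m_i$ ($1\le i\le n$), $k_{ij}$ ($1\le j\le m_i$), with $K_i=\sum_j k_{ij}$: $\Phi_{k_{11},\dots,k_{nm_n}}(\Phi_{m_1,\dots,m_n}\cdot 1)=\Phi_{K_1,\dots,K_n}(1\cdot(\Phi_{k_{11},\dots,k_{1m_1}}\times\cdots\times\Phi_{k_{n1},\dots,k_{nm_n}}))$,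 and $\Phi_n(\iota\cdot 1)=1=\Phi_{1,\dots,1}(1\cdot(\iota\times\cdots\times\iota))$ on $\bullet_n$. Write $a_1\bullet\cdots\bullet a_n=\bullet_n(a_1,\dots,a_n)$. An $\mathsf{Oplax}_+$-monoidal category $(\mathsf R,\circ,\Psi,\upsilon)$ is such that $(\mathsf R^{op},\circ^{op},\Psi^{op},\upsilon^{op})$ is $\mathsf{Lax}^+$-monoidal; so $\Psi_{k_1,\dots,k_n}:\circ_K\to\circ_n\cdot(\circ_{k_1}\times\cdots\times\circ_{k_n})$ and $\upsilon:\circ_1\to 1$. A $\mathsf{Lax}^+$-monoidal functor $(G,\Gamma):\mathsf L\to\mathsf L'$ is a functor $G$ with natural transformations $\Gamma_n:G\cdot\bullet_n\to\bullet'_n\cdot G^n$ ($n\ge1$) such that $\Gamma_1(1\cdot\iota)=\iota'\cdot 1$ and $\Gamma_K(1\cdot\Phi_{k_1,\dots,k_n})=(\Phi'_{k_1,\dots,k_n}\cdot1)(1\cdot(\Gamma_{k_1}\times\cdots\times\Gamma_{k_n}))(\Gamma_n\cdot 1)$. A $\mathsf{Lax}^+$-monoidal natural transformation $(G,\Gamma)\to(G',\Gamma')$ is a natural transformation $\omega$ with $\Gamma'_n(\omega\cdot1)=(1\cdot(\omega\times\cdots\times\omega))\Gamma_n$ for all $n\ge 1$. The composite of $(G,\Gamma)$ followed by $(H,\Xi)$ carries the structure $(\Xi_n\cdot1)(1\cdot\Gamma_n)$; Cartesian products of $\mathsf{Lax}^+$-monoidal categories and functors carry the componentwise structure; identity functors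 carry the identity structure. A $\mathsf{Lax}^+\mathsf{Oplax}_+$-duoidal category is a category $\mathsf D$ with a $\mathsf{Lax}^+$-monoidal structure $(\bullet,\Phi,\iota)$, an $\mathsf{Oplax}_+$-monoidal structure $(\circ,\Psi,\upsilon)$, and for all positive $n,p$ morphisms, natural in the objects $a_{ij}$ ($1\le i\le n$, $1\le j\le p$), $\xi^p_n:\circ_{i=1}^n(\bullet_{j=1}^p a_{ij})\to\bullet_{j=1}^p(\circ_{i=1}^n a_{ij})$, where $\bullet_{j=1}^pb_j=\bullet_p(b_1,\dots,b_p)$ and similarly for $\circ$, such that (a) for each $n\ge1$, $(\circ_n,\{\xi_n^p\}_{p\ge1}):\mathsf D^n\to\mathsf D$ is a $\mathsf{Lax}^+$-monoidal functor; (b) all $\Psi_{k_1,\dots,k_p}$ and $\upsilon$ are $\mathsf{Lax}^+$-monoidal natural transformations. A cosemigroup in $(\mathsf L,\bullet,\Phi,\iota)$ is an object $a$ with $\delta:a\to a\bullet a$ such that $\Phi_{2,1}(\delta\bullet\iota_a)\delta=\Phi_{1,2}(\iota_a\bullet\delta)\delta$; a morphism $(a,\delta)\to(a',\delta')$ is $f:a\to a'$ with $\delta'f=(f\bullet f)\delta$. A semigroup in $(\mathsf R,\circ,\Psi,\upsilon)$ is an object $a$ with $\mu:a\circ a\to a$ such that $\mu(\mu\circ\upsilon_a)\Psi_{2,1}=\mu(\upsilon_a\circ\mu)\Psi_{1,2}$; a morphism is $f:a\to a'$ with $f\mu=\mu'(f\circ f)$. Meaning of "via the structure": in (1), for cosemigroups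 $(a_i,\delta_i)$, $1\le i\le n$, the object $\circ_n(a_1,\dots,a_n)$ is a cosemigroup with comultiplication $\xi^2_n\,\circ_n(\delta_1,\dots,\delta_n)$, this together with $\circ_n$ on morphisms gives the $n$-fold product functor, and the components of $\Psi$ and $\upsilon$ at cosemigroups are cosemigroup morphisms and provide the coherence transformations. In (2), for semigroups $(a_i,\mu_i)$ the object $\bullet_n(a_1,\dots,a_n)$ is a semigroup with multiplication $\bullet_n(\mu_1,\dots,\mu_n)\,\xi^n_2$, and similarly the components of $\Phi$ and $\iota$ at semigroups provide the coherence transformations. *)

theory Defs
  imports Main
begin

section \<open>Categories, functors and natural transformations\<close>

text \<open>
  A category has a set of objects and a set of arrows, each arrow carrying its domain and codomain.
  \<open>g \<cdot>\<^bsub>C\<^esub> f\<close> is ``first \<open>f\<close>, then \<open>g\<close>''. The values of all operations outside the stated carriers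
  are irrelevant.
\<close>

record ('o, 'a) cat =
  Obj :: "'o set"
  Arr :: "'a set"
  Dom :: "'a \<Rightarrow> 'o"
  Cod :: "'a \<Rightarrow> 'o"
  Ident :: "'o \<Rightarrow> 'a"
  Comp :: "'a \<Rightarrow> 'a \<Rightarrow> 'a" (infixl "\<cdot>\<index>" 70)

definition hom :: "('o, 'a) cat \<Rightarrow> 'o \<Rightarrow> 'o \<Rightarrow> 'a set" where
  "hom C a b = {f \<in> Arr C. Dom C f = a \<and> Cod C f = b}"

locale category =
  fixes C :: "('o, 'a) cat" (structure)
  assumes Dom_Obj: "f \<in> Arr C \<Longrightarrow> Dom C f \<in> Obj C"
    and Cod_Obj: "f \<in> Arr C \<Longrightarrow> Cod C f \<in> Obj C"
    and Ident_hom: "a \<in> Obj C \<Longrightarrow> Ident C a \<in> hom C a a"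
    and Comp_hom: "f \<in> hom C a b \<Longrightarrow> g \<in> hom C b c \<Longrightarrow> g \<cdot> f \<in> hom C a c"
    and Comp_Ident: "f \<in> hom C a b \<Longrightarrow> f \<cdot> Ident C a = f"
    and Ident_Comp: "f \<in> hom C a b \<Longrightarrow> Ident C b \<cdot> f = f"
    and Comp_assoc: "f \<in> hom C a b \<Longrightarrow> g \<in> hom C b c \<Longrightarrow> h \<in> hom C c d \<Longrightarrow>
      h \<cdot> (g \<cdot> f) = (h \<cdot> g) \<cdot> f"

definition op_cat :: "('o, 'a) cat \<Rightarrow> ('o, 'a) cat" where
  "op_cat C = \<lparr>Obj = Obj C, Arr = Arr C, Dom = Cod C, Cod = Dom C, Ident = Ident C,
     Comp = (\<lambda>g f. f \<cdot>\<^bsub>C\<^esub> g)\<rparr>"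

record ('o, 'a, 'p, 'b) fun_data =
  on_obj :: "'o \<Rightarrow> 'p"
  on_arr :: "'a \<Rightarrow> 'b"

locale cat_functor = A: category A + B: category B
  for A :: "('o, 'a) cat" and B :: "('p, 'b) cat" +
  fixes F :: "('o, 'a, 'p, 'b) fun_data"
  assumes on_obj_Obj: "a \<in> Obj A \<Longrightarrow> on_obj F a \<in> Obj B"
    and on_arr_hom: "f \<in> hom A a b \<Longrightarrow> on_arr F f \<in> hom B (on_obj F a) (on_obj F b)"
    and on_arr_Ident: "a \<in> Obj A \<Longrightarrow> on_arr F (Ident A a) = Ident B (on_obj F a)"
    and on_arr_Comp: "f \<in> hom A a b \<Longrightarrow> g \<in> hom A b c \<Longrightarrow>
      on_arr F (g \<cdot>\<^bsub>A\<^esub> f) = on_arr F g \<cdot>\<^bsub>B\<^esub> on_arr F f"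

locale nat_trans = F: cat_functor A B F + G: cat_functor A B G
  for A :: "('o, 'a) cat" and B :: "('p, 'b) cat"
    and F :: "('o, 'a, 'p, 'b) fun_data" and G :: "('o, 'a, 'p, 'b) fun_data" +
  fixes \<tau> :: "'o \<Rightarrow> 'b"
  assumes component_hom: "a \<in> Obj A \<Longrightarrow> \<tau> a \<in> hom B (on_obj F a) (on_obj G a)"
    and naturality: "f \<in> hom A a b \<Longrightarrow>
      \<tau> b \<cdot>\<^bsub>B\<^esub> on_arr F f = on_arr G f \<cdot>\<^bsub>B\<^esub> \<tau> a"

definition fun_id :: "('o, 'a, 'o, 'a) fun_data" where
  "fun_id = \<lparr>on_obj = (\<lambda>x. x), on_arr = (\<lambda>f. f)\<rparr>"

text \<open>\<open>fun_comp G F\<close> is the composite \<open>G \<cdot> F\<close>: first \<open>F\<close>, then \<open>G\<close>.\<close>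

definition fun_comp ::
  "('p, 'b, 'q, 'c) fun_data \<Rightarrow> ('o, 'a, 'p, 'b) fun_data \<Rightarrow> ('o, 'a, 'q, 'c) fun_data" where
  "fun_comp G F = \<lparr>on_obj = (\<lambda>x. on_obj G (on_obj F x)), on_arr = (\<lambda>f. on_arr G (on_arr F f))\<rparr>"

text \<open>
  Finite products of categories have lists as objects and arrows. The objects of
  \<open>C\<^sup>k\<^sup>1 \<times> \<dots> \<times> C\<^sup>k\<^sup>n\<close> are thus lists of lists, and its canonical identification with the power of
  exponent \<open>k1 + \<dots> + kn\<close> is concatenation; the identification of \<open>C\<close> with its first power is
  \<open>x \<mapsto> [x]\<close>.
\<close>

definition prod_cat :: "('o, 'a) cat list \<Rightarrow> ('o list, 'a list) cat" where
  "prod_cat Cs =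
     \<lparr>Obj = {xs. length xs = length Cs \<and> (\<forall>i < length Cs. xs ! i \<in> Obj (Cs ! i))},
      Arr = {fs. length fs = length Cs \<and> (\<forall>i < length Cs. fs ! i \<in> Arr (Cs ! i))},
      Dom = (\<lambda>fs. map (\<lambda>i. Dom (Cs ! i) (fs ! i)) [0..<length Cs]),
      Cod = (\<lambda>fs. map (\<lambda>i. Cod (Cs ! i) (fs ! i)) [0..<length Cs]),
      Ident = (\<lambda>xs. map (\<lambda>i. Ident (Cs ! i) (xs ! i)) [0..<length Cs]),
      Comp = (\<lambda>gs fs. map (\<lambda>i. gs ! i \<cdot>\<^bsub>Cs ! i\<^esub> fs ! i) [0..<length Cs])\<rparr>"

definition power_cat :: "('o, 'a) cat \<Rightarrow> nat \<Rightarrow> ('o list, 'a list) cat" where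
  "power_cat C n = prod_cat (replicate n C)"

definition fun_prod ::
  "('o, 'a, 'p, 'b) fun_data list \<Rightarrow> ('o list, 'a list, 'p list, 'b list) fun_data" where
  "fun_prod Fs =
     \<lparr>on_obj = (\<lambda>xs. map (\<lambda>i. on_obj (Fs ! i) (xs ! i)) [0..<length Fs]),
      on_arr = (\<lambda>fs. map (\<lambda>i. on_arr (Fs ! i) (fs ! i)) [0..<length Fs])\<rparr>"

definition fun_power ::
  "('o, 'a, 'p, 'b) fun_data \<Rightarrow> nat \<Rightarrow> ('o list, 'a list, 'p list, 'b list) fun_data" where
  "fun_power F n = fun_prod (replicate n F)"

definition fun_concat :: "('o list list, 'a list list, 'o list, 'a list) fun_data" where
  "fun_concat = \<lparr>on_obj = concat, on_arr = concat\<rparr>"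

definition fun_single :: "('o, 'a, 'o list, 'a list) fun_data" where
  "fun_single = \<lparr>on_obj = (\<lambda>x. [x]), on_arr = (\<lambda>f. [f])\<rparr>"


section \<open>Lax and oplax monoidal categories\<close>

text \<open>
  The same record carries the data \<open>(\<bullet>, \<Phi>, \<iota>)\<close> of a lax and the data \<open>(\<circ>, \<Psi>, \<upsilon>)\<close> of an oplax
  monoidal category. \<open>Tensor M n\<close> is the \<open>n\<close>-ary product, \<open>Assoc M [k1, \<dots>, kn]\<close> is the family of
  components of \<open>\<Phi>\<close> (or \<open>\<Psi>\<close>) with these indices, taken at objects of the product of the powers with
  exponents \<open>k1, \<dots>, kn\<close>.
\<close>

record ('o, 'a) moncat =
  Cat :: "('o, 'a) cat"
  Tensor :: "nat \<Rightarrow> ('o list, 'a list, 'o, 'a) fun_data"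
  Assoc :: "nat list \<Rightarrow> 'o list list \<Rightarrow> 'a"
  Unit :: "'o \<Rightarrow> 'a"

definition pos_list :: "nat list \<Rightarrow> bool" where
  "pos_list ks \<longleftrightarrow> ks \<noteq> [] \<and> (\<forall>k \<in> set ks. k \<ge> 1)"

text \<open>Equations between natural transformations are stated componentwise.\<close>

locale lax_monoidal =
  fixes L :: "('o, 'a) moncat"
  assumes Cat_category: "category (Cat L)"
    and Tensor_functor: "n \<ge> 1 \<Longrightarrow> cat_functor (power_cat (Cat L) n) (Cat L) (Tensor L n)"
    and Assoc_nat_trans: "pos_list ks \<Longrightarrow>
      nat_trans (prod_cat (map (power_cat (Cat L)) ks)) (Cat L)
        (fun_comp (Tensor L (length ks)) (fun_prod (map (Tensor L) ks)))
        (fun_comp (Tensor L (sum_list ks)) fun_concat)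
        (Assoc L ks)"
    and Unit_nat_trans:
      "nat_trans (Cat L) (Cat L) fun_id (fun_comp (Tensor L 1) fun_single) (Unit L)"
    and Assoc_Assoc: "kss \<noteq> [] \<Longrightarrow> (\<And>ks. ks \<in> set kss \<Longrightarrow> pos_list ks) \<Longrightarrow>
      xsss \<in> Obj (prod_cat (map (\<lambda>ks. prod_cat (map (power_cat (Cat L)) ks)) kss)) \<Longrightarrow>
      Assoc L (concat kss) (concat xsss)
        \<cdot>\<^bsub>Cat L\<^esub> Assoc L (map length kss)
             (on_obj (fun_prod (map (\<lambda>ks. fun_prod (map (Tensor L) ks)) kss)) xsss)
      = Assoc L (map sum_list kss) (map concat xsss)
        \<cdot>\<^bsub>Cat L\<^esub> on_arr (Tensor L (length kss))
             (map (\<lambda>i. Assoc L (kss ! i) (xsss ! i)) [0..<length kss])"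
    and Assoc_Unit: "n \<ge> 1 \<Longrightarrow> xs \<in> Obj (power_cat (Cat L) n) \<Longrightarrow>
      Assoc L [n] [xs] \<cdot>\<^bsub>Cat L\<^esub> Unit L (on_obj (Tensor L n) xs)
      = Ident (Cat L) (on_obj (Tensor L n) xs)"
    and Assoc_Units: "n \<ge> 1 \<Longrightarrow> xs \<in> Obj (power_cat (Cat L) n) \<Longrightarrow>
      Assoc L (replicate n 1) (map (\<lambda>x. [x]) xs)
        \<cdot>\<^bsub>Cat L\<^esub> on_arr (Tensor L n) (map (Unit L) xs)
      = Ident (Cat L) (on_obj (Tensor L n) xs)"

definition op_moncat :: "('o, 'a) moncat \<Rightarrow> ('o, 'a) moncat" where
  "op_moncat R = R\<lparr>Cat := op_cat (Cat R)\<rparr>"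

definition oplax_monoidal :: "('o, 'a) moncat \<Rightarrow> bool" where
  "oplax_monoidal R \<longleftrightarrow> lax_monoidal (op_moncat R)"


section \<open>Lax monoidal functors and natural transformations\<close>

text \<open>\<open>Lax G n\<close> is the family of components of \<open>\<Gamma>\<^sub>n : G \<cdot> \<bullet>\<^sub>n \<rightarrow> \<bullet>'\<^sub>n \<cdot> G\<^sup>n\<close>.\<close>

record ('o, 'a, 'p, 'b) lax_fun_data =
  Fun :: "('o, 'a, 'p, 'b) fun_data"
  Lax :: "nat \<Rightarrow> 'o list \<Rightarrow> 'b"

locale lax_functor = L: lax_monoidal L + L': lax_monoidal L'
  for L :: "('o, 'a) moncat" and L' :: "('p, 'b) moncat" +
  fixes G :: "('o, 'a, 'p, 'b) lax_fun_data"
  assumes Fun_functor: "cat_functor (Cat L) (Cat L') (Fun G)"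
    and Lax_nat_trans: "n \<ge> 1 \<Longrightarrow>
      nat_trans (power_cat (Cat L) n) (Cat L')
        (fun_comp (Fun G) (Tensor L n))
        (fun_comp (Tensor L' n) (fun_power (Fun G) n))
        (Lax G n)"
    and Lax_Unit: "a \<in> Obj (Cat L) \<Longrightarrow>
      Lax G 1 [a] \<cdot>\<^bsub>Cat L'\<^esub> on_arr (Fun G) (Unit L a) = Unit L' (on_obj (Fun G) a)"
    and Lax_Assoc: "pos_list ks \<Longrightarrow> xss \<in> Obj (prod_cat (map (power_cat (Cat L)) ks)) \<Longrightarrow>
      Lax G (sum_list ks) (concat xss) \<cdot>\<^bsub>Cat L'\<^esub> on_arr (Fun G) (Assoc L ks xss)
      = Assoc L' ks (map (map (on_obj (Fun G))) xss)
        \<cdot>\<^bsub>Cat L'\<^esub> on_arr (Tensor L' (length ks))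
             (map (\<lambda>i. Lax G (ks ! i) (xss ! i)) [0..<length ks])
        \<cdot>\<^bsub>Cat L'\<^esub> Lax G (length ks) (on_obj (fun_prod (map (Tensor L) ks)) xss)"

locale lax_nat_trans = G: lax_functor L L' G + H: lax_functor L L' H
  for L :: "('o, 'a) moncat" and L' :: "('p, 'b) moncat"
    and G :: "('o, 'a, 'p, 'b) lax_fun_data" and H :: "('o, 'a, 'p, 'b) lax_fun_data" +
  fixes \<omega> :: "'o \<Rightarrow> 'b"
  assumes Fun_nat_trans: "nat_trans (Cat L) (Cat L') (Fun G) (Fun H) \<omega>"
    and Lax_component: "n \<ge> 1 \<Longrightarrow> xs \<in> Obj (power_cat (Cat L) n) \<Longrightarrow>
      Lax H n xs \<cdot>\<^bsub>Cat L'\<^esub> \<omega> (on_obj (Tensor L n) xs)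
      = on_arr (Tensor L' n) (map \<omega> xs) \<cdot>\<^bsub>Cat L'\<^esub> Lax G n xs"

text \<open>\<open>lax_comp N H G\<close> is \<open>G\<close> followed by \<open>H\<close>, where \<open>N\<close> is the codomain of \<open>H\<close>.\<close>

definition lax_comp ::
  "('q, 'c) moncat \<Rightarrow> ('p, 'b, 'q, 'c) lax_fun_data \<Rightarrow> ('o, 'a, 'p, 'b) lax_fun_data
   \<Rightarrow> ('o, 'a, 'q, 'c) lax_fun_data" where
  "lax_comp N H G =
     \<lparr>Fun = fun_comp (Fun H) (Fun G),
      Lax = (\<lambda>n xs. Lax H n (map (on_obj (Fun G)) xs) \<cdot>\<^bsub>Cat N\<^esub> on_arr (Fun H) (Lax G n xs))\<rparr>"

text \<open>
  The identity structure on a functor that preserves the \<open>n\<close>-ary products on the nose. It is used for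
  identity functors and for the identifications \<open>fun_concat\<close> and \<open>fun_single\<close>; \<open>N\<close> is the codomain.
\<close>

definition lax_strict ::
  "('p, 'b) moncat \<Rightarrow> ('o, 'a, 'p, 'b) fun_data \<Rightarrow> ('o, 'a, 'p, 'b) lax_fun_data" where
  "lax_strict N F =
     \<lparr>Fun = F, Lax = (\<lambda>n xs. Ident (Cat N) (on_obj (Tensor N n) (map (on_obj F) xs)))\<rparr>"

text \<open>
  Componentwise structure on products. An object of the \<open>p\<close>-th power of a product is a list of \<open>p\<close>
  tuples; mapping \<open>\<lambda>x. x ! i\<close> over it selects the \<open>i\<close>-th coordinate throughout.
\<close>

definition lax_prod :: "('o, 'a) moncat list \<Rightarrow> ('o list, 'a list) moncat" where
  "lax_prod Ls =
     \<lparr>Cat = prod_cat (map Cat Ls),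
      Tensor = (\<lambda>p.
        \<lparr>on_obj = (\<lambda>xss. map (\<lambda>i. on_obj (Tensor (Ls ! i) p) (map (\<lambda>x. x ! i) xss)) [0..<length Ls]),
         on_arr = (\<lambda>fss. map (\<lambda>i. on_arr (Tensor (Ls ! i) p) (map (\<lambda>f. f ! i) fss)) [0..<length Ls])\<rparr>),
      Assoc = (\<lambda>ks xsss.
        map (\<lambda>i. Assoc (Ls ! i) ks (map (map (\<lambda>x. x ! i)) xsss)) [0..<length Ls]),
      Unit = (\<lambda>xs. map (\<lambda>i. Unit (Ls ! i) (xs ! i)) [0..<length Ls])\<rparr>"

definition lax_power :: "('o, 'a) moncat \<Rightarrow> nat \<Rightarrow> ('o list, 'a list) moncat" where
  "lax_power L n = lax_prod (replicate n L)"

definition lax_fun_prod ::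
  "('o, 'a, 'p, 'b) lax_fun_data list \<Rightarrow> ('o list, 'a list, 'p list, 'b list) lax_fun_data" where
  "lax_fun_prod Gs =
     \<lparr>Fun = fun_prod (map Fun Gs),
      Lax = (\<lambda>p xss. map (\<lambda>i. Lax (Gs ! i) p (map (\<lambda>x. x ! i) xss)) [0..<length Gs])\<rparr>"


section \<open>Duoidal categories\<close>

text \<open>
  \<open>xi n p\<close> is the family of components of \<open>\<xi>\<^sup>p\<^sub>n\<close>, taken at objects of the \<open>p\<close>-th power of the \<open>n\<close>-th
  power: the matrix \<open>(a\<^sub>i\<^sub>j)\<close> with \<open>1 \<le> i \<le> n\<close> and \<open>1 \<le> j \<le> p\<close> is encoded as the list of its
  \<open>p\<close> columns \<open>[a\<^sub>1\<^sub>j, \<dots>, a\<^sub>n\<^sub>j]\<close>. The naturality of \<open>\<xi>\<^sup>p\<^sub>n\<close> is part of \<open>circ_lax_functor\<close>.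
\<close>

definition circ_lax ::
  "('o, 'a) moncat \<Rightarrow> (nat \<Rightarrow> nat \<Rightarrow> 'o list list \<Rightarrow> 'a) \<Rightarrow> nat
   \<Rightarrow> ('o list, 'a list, 'o, 'a) lax_fun_data" where
  "circ_lax R xi n = \<lparr>Fun = Tensor R n, Lax = xi n\<rparr>"

locale duoidal =
  fixes L :: "('o, 'a) moncat" and R :: "('o, 'a) moncat"
    and xi :: "nat \<Rightarrow> nat \<Rightarrow> 'o list list \<Rightarrow> 'a"
  assumes same_Cat: "Cat R = Cat L"
    and lax: "lax_monoidal L"
    and oplax: "oplax_monoidal R"
    and circ_lax_functor: "n \<ge> 1 \<Longrightarrow> lax_functor (lax_power L n) L (circ_lax R xi n)"
    and Psi_lax_nat_trans: "pos_list ks \<Longrightarrow>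
      lax_nat_trans (lax_prod (map (lax_power L) ks)) L
        (lax_comp L (circ_lax R xi (sum_list ks))
          (lax_strict (lax_power L (sum_list ks)) fun_concat))
        (lax_comp L (circ_lax R xi (length ks)) (lax_fun_prod (map (circ_lax R xi) ks)))
        (Assoc R ks)"
    and upsilon_lax_nat_trans:
      "lax_nat_trans L L
        (lax_comp L (circ_lax R xi 1) (lax_strict (lax_power L 1) fun_single))
        (lax_strict L fun_id)
        (Unit R)"


section \<open>Cosemigroups and semigroups\<close>

definition cosemigroup :: "('o, 'a) moncat \<Rightarrow> 'o \<Rightarrow> 'a \<Rightarrow> bool" where
  "cosemigroup L a \<delta> \<longleftrightarrow>
     a \<in> Obj (Cat L) \<and> \<delta> \<in> hom (Cat L) a (on_obj (Tensor L 2) [a, a]) \<and>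
     Assoc L [2, 1] [[a, a], [a]] \<cdot>\<^bsub>Cat L\<^esub> on_arr (Tensor L 2) [\<delta>, Unit L a] \<cdot>\<^bsub>Cat L\<^esub> \<delta>
     = Assoc L [1, 2] [[a], [a, a]] \<cdot>\<^bsub>Cat L\<^esub> on_arr (Tensor L 2) [Unit L a, \<delta>] \<cdot>\<^bsub>Cat L\<^esub> \<delta>"

definition semigroup_in :: "('o, 'a) moncat \<Rightarrow> 'o \<Rightarrow> 'a \<Rightarrow> bool" where
  "semigroup_in R a \<mu> \<longleftrightarrow>
     a \<in> Obj (Cat R) \<and> \<mu> \<in> hom (Cat R) (on_obj (Tensor R 2) [a, a]) a \<and>
     \<mu> \<cdot>\<^bsub>Cat R\<^esub> on_arr (Tensor R 2) [\<mu>, Unit R a] \<cdot>\<^bsub>Cat R\<^esub> Assoc R [2, 1] [[a, a], [a]]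
     = \<mu> \<cdot>\<^bsub>Cat R\<^esub> on_arr (Tensor R 2) [Unit R a, \<mu>] \<cdot>\<^bsub>Cat R\<^esub> Assoc R [1, 2] [[a], [a, a]]"

text \<open>
  Objects are pairs \<open>(a, \<delta>)\<close>, respectively \<open>(a, \<mu>)\<close>. Since an arrow has to determine its domain and
  codomain, an arrow \<open>X \<rightarrow> Y\<close> is a triple \<open>(X, Y, f)\<close> with \<open>f\<close> the underlying arrow.
\<close>

type_synonym ('o, 'a) sg_obj = "'o \<times> 'a"
type_synonym ('o, 'a) sg_arr = "('o \<times> 'a) \<times> ('o \<times> 'a) \<times> 'a"

abbreviation sg_dom :: "('o, 'a) sg_arr \<Rightarrow> ('o, 'a) sg_obj" where
  "sg_dom F \<equiv> fst F"

abbreviation sg_cod :: "('o, 'a) sg_arr \<Rightarrow> ('o, 'a) sg_obj" where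
  "sg_cod F \<equiv> fst (snd F)"

abbreviation sg_und :: "('o, 'a) sg_arr \<Rightarrow> 'a" where
  "sg_und F \<equiv> snd (snd F)"

definition cosemigroup_cat :: "('o, 'a) moncat \<Rightarrow> (('o, 'a) sg_obj, ('o, 'a) sg_arr) cat" where
  "cosemigroup_cat L =
     \<lparr>Obj = {(a, \<delta>). cosemigroup L a \<delta>},
      Arr = {((a, \<delta>), (a', \<delta>'), f).
        cosemigroup L a \<delta> \<and> cosemigroup L a' \<delta>' \<and> f \<in> hom (Cat L) a a' \<and>
        \<delta>' \<cdot>\<^bsub>Cat L\<^esub> f = on_arr (Tensor L 2) [f, f] \<cdot>\<^bsub>Cat L\<^esub> \<delta>},
      Dom = sg_dom,
      Cod = sg_cod,
      Ident = (\<lambda>X. (X, X, Ident (Cat L) (fst X))),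
      Comp = (\<lambda>G F. (sg_dom F, sg_cod G, sg_und G \<cdot>\<^bsub>Cat L\<^esub> sg_und F))\<rparr>"

definition semigroup_cat :: "('o, 'a) moncat \<Rightarrow> (('o, 'a) sg_obj, ('o, 'a) sg_arr) cat" where
  "semigroup_cat R =
     \<lparr>Obj = {(a, \<mu>). semigroup_in R a \<mu>},
      Arr = {((a, \<mu>), (a', \<mu>'), f).
        semigroup_in R a \<mu> \<and> semigroup_in R a' \<mu>' \<and> f \<in> hom (Cat R) a a' \<and>
        f \<cdot>\<^bsub>Cat R\<^esub> \<mu> = \<mu>' \<cdot>\<^bsub>Cat R\<^esub> on_arr (Tensor R 2) [f, f]},
      Dom = sg_dom,
      Cod = sg_cod,
      Ident = (\<lambda>X. (X, X, Ident (Cat R) (fst X))),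
      Comp = (\<lambda>G F. (sg_dom F, sg_cod G, sg_und G \<cdot>\<^bsub>Cat R\<^esub> sg_und F))\<rparr>"

text \<open>
  The comultiplication of a \<open>\<circ>\<close>-product of cosemigroups uses \<open>\<xi>\<^sup>2\<^sub>n\<close> at the matrix with the two equal
  columns \<open>[a\<^sub>1, \<dots>, a\<^sub>n]\<close>; the multiplication of a \<open>\<bullet>\<close>-product of semigroups uses \<open>\<xi>\<^sup>n\<^sub>2\<close> at the
  matrix with the \<open>n\<close> columns \<open>[a\<^sub>j, a\<^sub>j]\<close>.
\<close>

definition cosemigroup_circ ::
  "('o, 'a) moncat \<Rightarrow> ('o, 'a) moncat \<Rightarrow> (nat \<Rightarrow> nat \<Rightarrow> 'o list list \<Rightarrow> 'a)
   \<Rightarrow> nat \<Rightarrow> ('o, 'a) sg_obj list \<Rightarrow> ('o, 'a) sg_obj" where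
  "cosemigroup_circ L R xi n Xs =
     (on_obj (Tensor R n) (map fst Xs),
      xi n 2 [map fst Xs, map fst Xs] \<cdot>\<^bsub>Cat L\<^esub> on_arr (Tensor R n) (map snd Xs))"

definition semigroup_bullet ::
  "('o, 'a) moncat \<Rightarrow> ('o, 'a) moncat \<Rightarrow> (nat \<Rightarrow> nat \<Rightarrow> 'o list list \<Rightarrow> 'a)
   \<Rightarrow> nat \<Rightarrow> ('o, 'a) sg_obj list \<Rightarrow> ('o, 'a) sg_obj" where
  "semigroup_bullet L R xi n Xs =
     (on_obj (Tensor L n) (map fst Xs),
      on_arr (Tensor L n) (map snd Xs) \<cdot>\<^bsub>Cat L\<^esub> xi 2 n (map (\<lambda>X. [fst X, fst X]) Xs))"

definition cosemigroup_moncat ::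
  "('o, 'a) moncat \<Rightarrow> ('o, 'a) moncat \<Rightarrow> (nat \<Rightarrow> nat \<Rightarrow> 'o list list \<Rightarrow> 'a)
   \<Rightarrow> (('o, 'a) sg_obj, ('o, 'a) sg_arr) moncat" where
  "cosemigroup_moncat L R xi = (let T = cosemigroup_circ L R xi in
     \<lparr>Cat = cosemigroup_cat L,
      Tensor = (\<lambda>n.
        \<lparr>on_obj = T n,
         on_arr = (\<lambda>Fs. (T n (map sg_dom Fs), T n (map sg_cod Fs),
           on_arr (Tensor R n) (map sg_und Fs)))\<rparr>),
      Assoc = (\<lambda>ks Xss.
        (T (sum_list ks) (concat Xss),
         T (length ks) (map (\<lambda>i. T (ks ! i) (Xss ! i)) [0..<length ks]),
         Assoc R ks (map (map fst) Xss))),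
      Unit = (\<lambda>X. (T 1 [X], X, Unit R (fst X)))\<rparr>)"

definition semigroup_moncat ::
  "('o, 'a) moncat \<Rightarrow> ('o, 'a) moncat \<Rightarrow> (nat \<Rightarrow> nat \<Rightarrow> 'o list list \<Rightarrow> 'a)
   \<Rightarrow> (('o, 'a) sg_obj, ('o, 'a) sg_arr) moncat" where
  "semigroup_moncat L R xi = (let T = semigroup_bullet L R xi in
     \<lparr>Cat = semigroup_cat R,
      Tensor = (\<lambda>n.
        \<lparr>on_obj = T n,
         on_arr = (\<lambda>Fs. (T n (map sg_dom Fs), T n (map sg_cod Fs),
           on_arr (Tensor L n) (map sg_und Fs)))\<rparr>),
      Assoc = (\<lambda>ks Xss.
        (T (length ks) (map (\<lambda>i. T (ks ! i) (Xss ! i)) [0..<length ks]),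
         T (sum_list ks) (concat Xss),
         Assoc L ks (map (map fst) Xss))),
      Unit = (\<lambda>X. (X, T 1 [X], Unit L (fst X)))\<rparr>)"

end

theory Submission
  imports Defs
begin

text \<open>
  The coherence laws of the two new monoidal structures cost nothing. The forgetful functor from
  (co)semigroups to the underlying category is faithful and strictly preserves all structure, so every
  equation between arrows, naturality and functoriality included, can be checked after applying it, where
  it is one of the laws of \<open>(\<circ>, \<Psi>, \<upsilon>)\<close> or \<open>(\<bullet>, \<Phi>, \<iota>)\<close>. This is theorem \<open>lax_N\<close> of the locale
  \<open>faithful_strict\<close>. What remains is that products of (co)semigroups are (co)semigroups, that products of
  their morphisms are morphisms, and that the components of \<open>\<Psi>\<close>, \<open>\<upsilon>\<close>, \<open>\<Phi>\<close> and \<open>\<iota>\<close> are morphisms.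

  The first two hold because a lax monoidal functor (here with \<open>\<Gamma>\<^sub>n : G \<cdot> \<bullet>\<^sub>n \<rightarrow> \<bullet>'\<^sub>n \<cdot> G\<^sup>n\<close>) carries
  cosemigroups to cosemigroups: in coassociativity, both composites become \<open>\<Gamma>\<^sub>3\<close> after the image of a
  composite in the source. Only \<open>\<Gamma>\<^sub>1\<close>, \<open>\<Gamma>\<^sub>2\<close>, \<open>\<Gamma>\<^sub>3\<close>, the naturality of \<open>\<Gamma>\<^sub>2\<close>, the unit law and the associativity laws with indices
  \<open>(2, 1)\<close> and \<open>(1, 2)\<close> enter. The locale \<open>power_functor\<close> collects them for functors of \<open>n\<close> variables, and it
  is instantiated twice. For cosemigroups the functor is \<open>\<circ>\<^sub>n\<close> with \<open>\<xi>\<^sup>p\<^sub>n\<close> for \<open>p \<le> 3\<close>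
  (\<open>circ_power_functor\<close>). Semigroups are cosemigroups in the opposite category, where the functor is
  \<open>\<bullet>\<^sub>p\<close> with \<open>\<xi>\<^sup>p\<^sub>n\<close> for \<open>n \<le> 3\<close> (\<open>bullet_power_functor\<close>); its laws are the compatibility of \<open>\<xi>\<close> with
  \<open>\<upsilon>\<close> and \<open>\<Psi>\<close>, that is, the monoidality of these transformations.

  The components of \<open>\<Psi>\<close> and \<open>\<upsilon>\<close> are morphisms of cosemigroups by the case \<open>p = 2\<close> of this monoidality,
  and those of \<open>\<Phi>\<close> and \<open>\<iota>\<close> are morphisms of semigroups by the case \<open>n = 2\<close> of the laws of the lax
  monoidal functor \<open>\<circ>\<^sub>n\<close>, in each case combined with naturality.
\<close>

section \<open>Finite powers of a category in terms of lists\<close>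

lemma nth_Obj_iff: "(\<forall>i < length xs. xs ! i \<in> A) \<longleftrightarrow> set xs \<subseteq> A"
  by (auto simp: in_set_conv_nth subset_iff)

lemma Obj_power_cat: "xs \<in> Obj (power_cat C n) \<longleftrightarrow> length xs = n \<and> set xs \<subseteq> Obj C"
  using nth_Obj_iff[of xs "Obj C"] by (auto simp: power_cat_def prod_cat_def)

lemma hom_power_cat:
  "fs \<in> hom (power_cat C n) xs ys \<longleftrightarrow>
    length fs = n \<and> set fs \<subseteq> Arr C \<and> map (Dom C) fs = xs \<and> map (Cod C) fs = ys"
  using nth_Obj_iff[of fs "Arr C"]
  by (auto simp: power_cat_def prod_cat_def hom_def list_eq_iff_nth_eq)

lemma Ident_power_cat: "length xs = n \<Longrightarrow> Ident (power_cat C n) xs = map (Ident C) xs"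
  by (auto simp: power_cat_def prod_cat_def intro: nth_equalityI)

lemma Comp_power_cat:
  "length fs = n \<Longrightarrow> length gs = n \<Longrightarrow> gs \<cdot>\<^bsub>power_cat C n\<^esub> fs = map2 (\<lambda>g f. g \<cdot>\<^bsub>C\<^esub> f) gs fs"
  by (auto simp: power_cat_def prod_cat_def intro!: nth_equalityI)

lemma all_nth_iff:
  "length xss = length ks \<Longrightarrow>
    (\<forall>i < length ks. P (xss ! i) \<and> h (xss ! i) = ks ! i) \<longleftrightarrow> map h xss = ks \<and> (\<forall>x \<in> set xss. P x)"
  by (auto simp: list_eq_iff_nth_eq all_set_conv_all_nth)

lemma Obj_prod_power:
  "xss \<in> Obj (prod_cat (map (power_cat C) ks)) \<longleftrightarrow>
    map length xss = ks \<and> (\<forall>xs \<in> set xss. set xs \<subseteq> Obj C)"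
proof (cases "length xss = length ks")
  case True
  have "xss \<in> Obj (prod_cat (map (power_cat C) ks)) \<longleftrightarrow>
      (\<forall>i < length ks. set (xss ! i) \<subseteq> Obj C \<and> length (xss ! i) = ks ! i)"
    using True by (auto simp: prod_cat_def Obj_power_cat[unfolded prod_cat_def] Obj_power_cat)
  then show ?thesis using all_nth_iff[OF True, of "\<lambda>xs. set xs \<subseteq> Obj C" length] by simp
qed (auto simp: prod_cat_def)

lemma Obj_prod_prod_power:
  "xsss \<in> Obj (prod_cat (map (\<lambda>ks. prod_cat (map (power_cat C) ks)) kss)) \<longleftrightarrow>
    map (map length) xsss = kss \<and> (\<forall>xss \<in> set xsss. \<forall>xs \<in> set xss. set xs \<subseteq> Obj C)"
proof (cases "length xsss = length kss")
  case True
  then have "xsss \<in> Obj (prod_cat (map (\<lambda>ks. prod_cat (map (power_cat C) ks)) kss)) \<longleftrightarrow>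
      (\<forall>i < length kss. (\<forall>xs \<in> set (xsss ! i). set xs \<subseteq> Obj C) \<and> map length (xsss ! i) = kss ! i)"
    unfolding prod_cat_def[of "map _ kss"] using True Obj_prod_power[of _ C]
    by (simp add: conj_commute)
  then show ?thesis
    using all_nth_iff[OF True, of "\<lambda>xss. \<forall>xs \<in> set xss. set xs \<subseteq> Obj C" "map length"] by simp
qed (auto simp: prod_cat_def)

lemma hom_prod_power:
  "fss \<in> hom (prod_cat (map (power_cat C) ks)) xss yss \<longleftrightarrow>
    map length fss = ks \<and> (\<forall>fs \<in> set fss. set fs \<subseteq> Arr C) \<and>
    map (map (Dom C)) fss = xss \<and> map (map (Cod C)) fss = yss"
proof (cases "length fss = length ks")
  case True
  have Arr: "fs \<in> Arr (power_cat C k) \<longleftrightarrow> set fs \<subseteq> Arr C \<and> length fs = k" for fs k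
    using nth_Obj_iff[of fs "Arr C"] by (auto simp: power_cat_def prod_cat_def)
  have Dom: "Dom (power_cat C k) fs = map (Dom C) fs" and Cod: "Cod (power_cat C k) fs = map (Cod C) fs"
    if "length fs = k" for fs k
    using that by (auto simp: power_cat_def prod_cat_def intro: nth_equalityI)
  have "fss \<in> Arr (prod_cat (map (power_cat C) ks)) \<longleftrightarrow>
      (\<forall>i < length ks. set (fss ! i) \<subseteq> Arr C \<and> length (fss ! i) = ks ! i)"
    using True by (auto simp: prod_cat_def[of "map _ ks"] Arr)
  then have 1: "fss \<in> Arr (prod_cat (map (power_cat C) ks)) \<longleftrightarrow>
      map length fss = ks \<and> (\<forall>fs \<in> set fss. set fs \<subseteq> Arr C)"
    using all_nth_iff[OF True, of "\<lambda>fs. set fs \<subseteq> Arr C" length] by simp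
  have "Dom (prod_cat (map (power_cat C) ks)) fss = map (map (Dom C)) fss"
    "Cod (prod_cat (map (power_cat C) ks)) fss = map (map (Cod C)) fss"
    if "map length fss = ks"
    using that by (auto simp: prod_cat_def[of "map _ _"] Dom Cod intro!: nth_equalityI)
  then show ?thesis using 1 by (auto simp: hom_def)
qed (auto simp: prod_cat_def hom_def)

section \<open>Lax monoidal categories in terms of lists\<close>

text \<open>
  The product of a list of objects; its arity is the length of the list.
\<close>

definition ten :: "('o, 'a) moncat \<Rightarrow> 'o list \<Rightarrow> 'o" where
  "ten M xs = on_obj (Tensor M (length xs)) xs"

text \<open>The product of a list of arrows, with the same convention.\<close>

definition ten_arr :: "('o, 'a) moncat \<Rightarrow> 'a list \<Rightarrow> 'a" where
  "ten_arr M fs = on_arr (Tensor M (length fs)) fs"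

text \<open>
  The component of \<open>\<Phi>\<close> (or \<open>\<Psi>\<close>) at a list of lists of objects, whose lengths give the indices.
\<close>

definition asc :: "('o, 'a) moncat \<Rightarrow> 'o list list \<Rightarrow> 'a" where
  "asc M xss = Assoc M (map length xss) xss"

text \<open>
  The objects of the powers \<open>C\<^sup>n\<close> with \<open>n \<ge> 1\<close>, and those of the products of such powers.
\<close>

definition obj_list :: "('o, 'a) cat \<Rightarrow> 'o list \<Rightarrow> bool" where
  "obj_list C xs \<longleftrightarrow> xs \<noteq> [] \<and> set xs \<subseteq> Obj C"

definition obj_lists :: "('o, 'a) cat \<Rightarrow> 'o list list \<Rightarrow> bool" where
  "obj_lists C xss \<longleftrightarrow> xss \<noteq> [] \<and> (\<forall>xs \<in> set xss. obj_list C xs)"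

text \<open>
  The axioms of a lax monoidal category with product categories unfolded to conditions on lists. They are
  equivalent to \<open>lax_monoidal\<close>.
\<close>

locale listed_lax_monoidal =
  fixes M :: "('o, 'a) moncat"
  assumes Cat: "category (Cat M)"
    and ten_Obj: "obj_list (Cat M) xs \<Longrightarrow> ten M xs \<in> Obj (Cat M)"
    and ten_hom: "fs \<noteq> [] \<Longrightarrow> set fs \<subseteq> Arr (Cat M) \<Longrightarrow>
      ten_arr M fs \<in> hom (Cat M) (ten M (map (Dom (Cat M)) fs)) (ten M (map (Cod (Cat M)) fs))"
    and ten_Ident: "obj_list (Cat M) xs \<Longrightarrow> ten_arr M (map (Ident (Cat M)) xs) = Ident (Cat M) (ten M xs)"
    and ten_Comp: "fs \<noteq> [] \<Longrightarrow> set fs \<subseteq> Arr (Cat M) \<Longrightarrow> set gs \<subseteq> Arr (Cat M) \<Longrightarrow>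
      map (Dom (Cat M)) gs = map (Cod (Cat M)) fs \<Longrightarrow>
      ten_arr M (map2 (\<lambda>g f. g \<cdot>\<^bsub>Cat M\<^esub> f) gs fs) = ten_arr M gs \<cdot>\<^bsub>Cat M\<^esub> ten_arr M fs"
    and asc_hom: "obj_lists (Cat M) xss \<Longrightarrow>
      asc M xss \<in> hom (Cat M) (ten M (map (ten M) xss)) (ten M (concat xss))"
    and asc_nat: "fss \<noteq> [] \<Longrightarrow> (\<And>fs. fs \<in> set fss \<Longrightarrow> fs \<noteq> [] \<and> set fs \<subseteq> Arr (Cat M)) \<Longrightarrow>
      asc M (map (map (Cod (Cat M))) fss) \<cdot>\<^bsub>Cat M\<^esub> ten_arr M (map (ten_arr M) fss)
      = ten_arr M (concat fss) \<cdot>\<^bsub>Cat M\<^esub> asc M (map (map (Dom (Cat M))) fss)"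
    and Unit_hom: "x \<in> Obj (Cat M) \<Longrightarrow> Unit M x \<in> hom (Cat M) x (ten M [x])"
    and Unit_nat: "f \<in> Arr (Cat M) \<Longrightarrow>
      Unit M (Cod (Cat M) f) \<cdot>\<^bsub>Cat M\<^esub> f = ten_arr M [f] \<cdot>\<^bsub>Cat M\<^esub> Unit M (Dom (Cat M) f)"
    and asc_asc: "xsss \<noteq> [] \<Longrightarrow> (\<And>xss. xss \<in> set xsss \<Longrightarrow> obj_lists (Cat M) xss) \<Longrightarrow>
      asc M (concat xsss) \<cdot>\<^bsub>Cat M\<^esub> asc M (map (map (ten M)) xsss)
      = asc M (map concat xsss) \<cdot>\<^bsub>Cat M\<^esub> ten_arr M (map (asc M) xsss)"
    and asc_Unit: "obj_list (Cat M) xs \<Longrightarrow>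
      asc M [xs] \<cdot>\<^bsub>Cat M\<^esub> Unit M (ten M xs) = Ident (Cat M) (ten M xs)"
    and asc_Units: "obj_list (Cat M) xs \<Longrightarrow>
      asc M (map (\<lambda>x. [x]) xs) \<cdot>\<^bsub>Cat M\<^esub> ten_arr M (map (Unit M) xs) = Ident (Cat M) (ten M xs)"

lemma map_upt_eq_iff: "map f [0..<n] = xs \<longleftrightarrow> length xs = n \<and> (\<forall>i < n. f i = xs ! i)"
  by (auto simp: list_eq_iff_nth_eq)

lemma hom_prod_cat:
  "fs \<in> hom (prod_cat Cs) xs ys \<longleftrightarrow> length fs = length Cs \<and> length xs = length Cs \<and>
    length ys = length Cs \<and> (\<forall>i < length Cs. fs ! i \<in> hom (Cs ! i) (xs ! i) (ys ! i))"
  by (auto simp: prod_cat_def hom_def map_upt_eq_iff)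

lemma category_prod_cat:
  assumes "\<And>C. C \<in> set Cs \<Longrightarrow> category C"
  shows "category (prod_cat Cs)"
proof -
  have c: "i < length Cs \<Longrightarrow> category (Cs ! i)" for i using assms by simp
  note h = hom_prod_cat
  note D = category.Dom_Obj[OF c] category.Cod_Obj[OF c]
  note p = prod_cat_def[of Cs]
  show ?thesis
  proof
    fix fs assume "fs \<in> Arr (prod_cat Cs)"
    then show "Dom (prod_cat Cs) fs \<in> Obj (prod_cat Cs)" "Cod (prod_cat Cs) fs \<in> Obj (prod_cat Cs)"
      by (simp_all add: p D)
  next
    fix xs assume "xs \<in> Obj (prod_cat Cs)"
    then show "Ident (prod_cat Cs) xs \<in> hom (prod_cat Cs) xs xs"
      unfolding h by (simp add: p category.Ident_hom[OF c])
  next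
    fix fs gs xs ys zs assume "fs \<in> hom (prod_cat Cs) xs ys" "gs \<in> hom (prod_cat Cs) ys zs"
    then show "gs \<cdot>\<^bsub>prod_cat Cs\<^esub> fs \<in> hom (prod_cat Cs) xs zs"
      unfolding h by (auto simp: p intro: category.Comp_hom[OF c])
  next
    fix fs xs ys assume a: "fs \<in> hom (prod_cat Cs) xs ys"
    then have f: "length fs = length Cs" "i < length Cs \<Longrightarrow> fs ! i \<in> hom (Cs ! i) (xs ! i) (ys ! i)" for i
      unfolding h by auto
    show "fs \<cdot>\<^bsub>prod_cat Cs\<^esub> Ident (prod_cat Cs) xs = fs"
      by (rule nth_equalityI) (simp_all add: p f category.Comp_Ident[OF c f(2)])
    show "Ident (prod_cat Cs) ys \<cdot>\<^bsub>prod_cat Cs\<^esub> fs = fs"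
      by (rule nth_equalityI) (simp_all add: p f category.Ident_Comp[OF c f(2)])
  next
    fix fs gs ks xs ys zs ws
    assume a: "fs \<in> hom (prod_cat Cs) xs ys" "gs \<in> hom (prod_cat Cs) ys zs" "ks \<in> hom (prod_cat Cs) zs ws"
    have "ks ! i \<cdot>\<^bsub>Cs ! i\<^esub> (gs ! i \<cdot>\<^bsub>Cs ! i\<^esub> fs ! i) = (ks ! i \<cdot>\<^bsub>Cs ! i\<^esub> gs ! i) \<cdot>\<^bsub>Cs ! i\<^esub> fs ! i"
      if "i < length Cs" for i
      using a that unfolding h by (intro category.Comp_assoc[OF c]) auto
    then show "ks \<cdot>\<^bsub>prod_cat Cs\<^esub> (gs \<cdot>\<^bsub>prod_cat Cs\<^esub> fs) = (ks \<cdot>\<^bsub>prod_cat Cs\<^esub> gs) \<cdot>\<^bsub>prod_cat Cs\<^esub> fs"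
      by (simp add: p)
  qed
qed

lemma category_power_cat: "category C \<Longrightarrow> category (power_cat C n)"
  unfolding power_cat_def by (rule category_prod_cat) auto

lemma fun_prod_Tensor:
  "map length xss = ks \<Longrightarrow> on_obj (fun_prod (map (Tensor M) ks)) xss = map (ten M) xss"
  "map length fss = ks \<Longrightarrow> on_arr (fun_prod (map (Tensor M) ks)) fss = map (ten_arr M) fss"
  by (auto simp: fun_prod_def ten_def ten_arr_def intro!: nth_equalityI)

lemma fun_prod_fun_prod_Tensor:
  "map (map length) xsss = kss \<Longrightarrow>
    on_obj (fun_prod (map (\<lambda>ks. fun_prod (map (Tensor M) ks)) kss)) xsss = map (map (ten M)) xsss"
  by (auto simp: fun_prod_def[of "map _ kss" for kss] fun_prod_Tensor ten_def intro!: nth_equalityI)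

lemma pos_list_map_length: "xss \<noteq> [] \<Longrightarrow> [] \<notin> set xss \<Longrightarrow> pos_list (map length xss)"
  by (force simp: pos_list_def Suc_le_eq)

lemma lax_monoidal_listed:
  assumes "lax_monoidal M"
  shows "listed_lax_monoidal M"
proof -
  interpret lax_monoidal M by fact
  interpret C: category "Cat M" by (rule Cat_category)
  let ?C = "Cat M"
  have F: "cat_functor (power_cat ?C (length xs)) ?C (Tensor M (length xs))" if "xs \<noteq> []" for xs :: "'x list"
    using that by (intro Tensor_functor) (cases xs, auto)
  show ?thesis
  proof
    fix xs assume a: "obj_list ?C xs"
    then have "xs \<noteq> []" by (simp add: obj_list_def)
    with a show "ten M xs \<in> Obj ?C"
      using cat_functor.on_obj_Obj[OF F] by (auto simp: obj_list_def ten_def Obj_power_cat)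
  next
    fix fs assume a: "fs \<noteq> []" "set fs \<subseteq> Arr ?C"
    then show "ten_arr M fs \<in> hom ?C (ten M (map (Dom ?C) fs)) (ten M (map (Cod ?C) fs))"
      using cat_functor.on_arr_hom[OF F[OF a(1)], of fs] by (auto simp: ten_def ten_arr_def hom_power_cat)
  next
    fix xs assume a: "obj_list ?C xs"
    then have "xs \<noteq> []" by (simp add: obj_list_def)
    with a show "ten_arr M (map (Ident ?C) xs) = Ident ?C (ten M xs)"
      using cat_functor.on_arr_Ident[OF F[of xs]]
      by (auto simp: obj_list_def ten_def ten_arr_def Obj_power_cat Ident_power_cat)
  next
    fix fs gs assume a: "fs \<noteq> []" "set fs \<subseteq> Arr ?C" "set gs \<subseteq> Arr ?C" "map (Dom ?C) gs = map (Cod ?C) fs"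
    then have l: "length gs = length fs" by (metis length_map)
    show "ten_arr M (map2 (\<lambda>g f. g \<cdot>\<^bsub>?C\<^esub> f) gs fs) = ten_arr M gs \<cdot>\<^bsub>?C\<^esub> ten_arr M fs"
      using cat_functor.on_arr_Comp[OF F[OF a(1)], of fs "map (Dom ?C) fs" "map (Cod ?C) fs" gs "map (Cod ?C) gs"] a l
      by (simp add: ten_arr_def hom_power_cat Comp_power_cat)
  next
    fix xss assume "obj_lists ?C xss"
    then have p: "pos_list (map length xss)" and o: "xss \<in> Obj (prod_cat (map (power_cat ?C) (map length xss)))"
      by (auto simp: obj_lists_def obj_list_def Obj_prod_power simp del: map_map intro!: pos_list_map_length)
    from nat_trans.component_hom[OF Assoc_nat_trans[OF p] o]
    show "asc M xss \<in> hom ?C (ten M (map (ten M) xss)) (ten M (concat xss))"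
      by (simp add: fun_comp_def fun_concat_def fun_prod_Tensor asc_def del: map_map)
         (simp add: ten_def length_concat)
  next
    fix fss assume a: "fss \<noteq> []" "\<And>fs. fs \<in> set fss \<Longrightarrow> fs \<noteq> [] \<and> set fs \<subseteq> Arr ?C"
    have p: "pos_list (map length fss)" using a by (auto intro!: pos_list_map_length)
    have h: "fss \<in> hom (prod_cat (map (power_cat ?C) (map length fss))) (map (map (Dom ?C)) fss) (map (map (Cod ?C)) fss)"
      using a(2) by (auto simp: hom_prod_power simp del: map_map)
    from nat_trans.naturality[OF Assoc_nat_trans[OF p] h]
    show "asc M (map (map (Cod ?C)) fss) \<cdot>\<^bsub>?C\<^esub> ten_arr M (map (ten_arr M) fss)
      = ten_arr M (concat fss) \<cdot>\<^bsub>?C\<^esub> asc M (map (map (Dom ?C)) fss)"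
      by (simp add: fun_comp_def fun_concat_def fun_prod_Tensor asc_def o_def length_concat del: map_map)
         (simp add: ten_arr_def length_concat o_def)
  next
    fix x assume "x \<in> Obj ?C"
    from nat_trans.component_hom[OF Unit_nat_trans this]
    show "Unit M x \<in> hom ?C x (ten M [x])" by (simp add: fun_id_def fun_comp_def fun_single_def ten_def)
  next
    fix f assume "f \<in> Arr ?C"
    then have "f \<in> hom ?C (Dom ?C f) (Cod ?C f)" by (simp add: hom_def)
    from nat_trans.naturality[OF Unit_nat_trans this]
    show "Unit M (Cod ?C f) \<cdot>\<^bsub>?C\<^esub> f = ten_arr M [f] \<cdot>\<^bsub>?C\<^esub> Unit M (Dom ?C f)"
      by (simp add: fun_id_def fun_comp_def fun_single_def ten_arr_def)
  next
    fix xsss assume a: "xsss \<noteq> []" "\<And>xss. xss \<in> set xsss \<Longrightarrow> obj_lists ?C xss"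
    let ?k = "map (map length) xsss"
    have 1: "?k \<noteq> []" using a by simp
    have 2: "ks \<in> set ?k \<Longrightarrow> pos_list ks" for ks
      using a(2) by (force simp: obj_lists_def obj_list_def intro!: pos_list_map_length)
    have 3: "xsss \<in> Obj (prod_cat (map (\<lambda>ks. prod_cat (map (power_cat ?C) ks)) ?k))"
      using a(2) by (auto simp: Obj_prod_prod_power obj_lists_def obj_list_def subset_iff simp del: map_map)
    have 4: "map (\<lambda>i. Assoc M (?k ! i) (xsss ! i)) [0..<length ?k] = map (asc M) xsss"
      by (auto simp: asc_def intro!: nth_equalityI)
    show "asc M (concat xsss) \<cdot>\<^bsub>?C\<^esub> asc M (map (map (ten M)) xsss)
      = asc M (map concat xsss) \<cdot>\<^bsub>?C\<^esub> ten_arr M (map (asc M) xsss)"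
      using Assoc_Assoc[OF 1 2 3] unfolding 4 fun_prod_fun_prod_Tensor[OF refl]
      by (simp add: asc_def ten_arr_def o_def length_concat map_concat)
  next
    fix xs assume "obj_list ?C xs"
    then have l: "length xs \<ge> 1" and o: "xs \<in> Obj (power_cat ?C (length xs))"
      by (auto simp: obj_list_def Obj_power_cat simp: Suc_le_eq)
    show "asc M [xs] \<cdot>\<^bsub>?C\<^esub> Unit M (ten M xs) = Ident ?C (ten M xs)"
      using Assoc_Unit[OF l o] by (simp add: asc_def ten_def)
    show "asc M (map (\<lambda>x. [x]) xs) \<cdot>\<^bsub>?C\<^esub> ten_arr M (map (Unit M) xs) = Ident ?C (ten M xs)"
      using Assoc_Units[OF l o] by (simp add: asc_def ten_def ten_arr_def o_def map_replicate_const)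
  qed
qed

lemma category_prod_power: "category C \<Longrightarrow> category (prod_cat (map (power_cat C) ks))"
  by (rule category_prod_cat) (auto intro: category_power_cat)

lemma cat_functor_comp:
  assumes "cat_functor A B F" "cat_functor B C G"
  shows "cat_functor A C (fun_comp G F)"
proof -
  interpret F: cat_functor A B F by fact
  interpret G: cat_functor B C G by fact
  show ?thesis
    by unfold_locales (auto simp: fun_comp_def F.on_obj_Obj G.on_obj_Obj F.on_arr_Ident G.on_arr_Ident
      F.on_arr_Comp G.on_arr_Comp[OF F.on_arr_hom F.on_arr_hom] intro: F.on_arr_hom G.on_arr_hom)
qed

lemma cat_functor_fun_prod:
  assumes l: "length Cs = length Fs" "length Ds = length Fs"
    and F: "\<And>i. i < length Fs \<Longrightarrow> cat_functor (Cs ! i) (Ds ! i) (Fs ! i)"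
  shows "cat_functor (prod_cat Cs) (prod_cat Ds) (fun_prod Fs)"
proof -
  interpret C: category "prod_cat Cs"
    using l F by (intro category_prod_cat) (metis cat_functor.axioms(1) in_set_conv_nth)
  interpret D: category "prod_cat Ds"
    using l F by (intro category_prod_cat) (metis cat_functor.axioms(2) in_set_conv_nth)
  show ?thesis
  proof
    fix xs assume "xs \<in> Obj (prod_cat Cs)"
    then show "on_obj (fun_prod Fs) xs \<in> Obj (prod_cat Ds)"
      "on_arr (fun_prod Fs) (Ident (prod_cat Cs) xs) = Ident (prod_cat Ds) (on_obj (fun_prod Fs) xs)"
      by (simp_all add: prod_cat_def fun_prod_def l cat_functor.on_obj_Obj[OF F] cat_functor.on_arr_Ident[OF F])
  next
    fix fs xs ys assume "fs \<in> hom (prod_cat Cs) xs ys"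
    then show "on_arr (fun_prod Fs) fs \<in> hom (prod_cat Ds) (on_obj (fun_prod Fs) xs) (on_obj (fun_prod Fs) ys)"
      by (auto simp: hom_prod_cat fun_prod_def l intro: cat_functor.on_arr_hom[OF F])
  next
    fix fs gs xs ys zs assume a: "fs \<in> hom (prod_cat Cs) xs ys" "gs \<in> hom (prod_cat Cs) ys zs"
    have "on_arr (Fs ! i) (gs ! i \<cdot>\<^bsub>Cs ! i\<^esub> fs ! i) = on_arr (Fs ! i) (gs ! i) \<cdot>\<^bsub>Ds ! i\<^esub> on_arr (Fs ! i) (fs ! i)"
      if "i < length Fs" for i
      using a that l by (intro cat_functor.on_arr_Comp[OF F]) (auto simp: hom_prod_cat)
    then show "on_arr (fun_prod Fs) (gs \<cdot>\<^bsub>prod_cat Cs\<^esub> fs)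
        = on_arr (fun_prod Fs) gs \<cdot>\<^bsub>prod_cat Ds\<^esub> on_arr (fun_prod Fs) fs"
      by (simp add: prod_cat_def fun_prod_def l)
  qed
qed

lemma Ident_prod_power:
  "map length xss = ks \<Longrightarrow> Ident (prod_cat (map (power_cat C) ks)) xss = map (map (Ident C)) xss"
  by (auto simp: prod_cat_def[of "map _ _"] Ident_power_cat intro!: nth_equalityI)

lemma Comp_prod_power:
  assumes "map length fss = ks" "map length gss = ks"
  shows "gss \<cdot>\<^bsub>prod_cat (map (power_cat C) ks)\<^esub> fss = map2 (map2 (\<lambda>g f. g \<cdot>\<^bsub>C\<^esub> f)) gss fss"
proof -
  have l: "length fss = length ks" "length gss = length ks"
    "i < length ks \<Longrightarrow> length (fss ! i) = ks ! i" "i < length ks \<Longrightarrow> length (gss ! i) = ks ! i" for i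
    using assms by (metis length_map, metis length_map, metis length_map nth_map, metis length_map nth_map)
  show ?thesis
    by (rule nth_equalityI) (simp_all add: prod_cat_def[of "map _ _"] l Comp_power_cat)
qed

lemma concat_map2:
  "map length xss = map length yss \<Longrightarrow> concat (map2 (map2 h) xss yss) = map2 h (concat xss) (concat yss)"
proof (induction xss arbitrary: yss)
  case (Cons xs xss)
  then show ?case by (cases yss) auto
qed simp

lemma cat_functor_concat:
  assumes "category C"
  shows "cat_functor (prod_cat (map (power_cat C) ks)) (power_cat C (sum_list ks)) fun_concat"
proof -
  interpret A: category "prod_cat (map (power_cat C) ks)" using assms by (rule category_prod_power)
  interpret B: category "power_cat C (sum_list ks)" using assms by (rule category_power_cat)
  show ?thesis
  proof
    fix xss assume "xss \<in> Obj (prod_cat (map (power_cat C) ks))"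
    then show "on_obj fun_concat xss \<in> Obj (power_cat C (sum_list ks))"
      "on_arr fun_concat (Ident (prod_cat (map (power_cat C) ks)) xss)
        = Ident (power_cat C (sum_list ks)) (on_obj fun_concat xss)"
      by (auto simp: Obj_prod_power Obj_power_cat fun_concat_def length_concat Ident_prod_power
        Ident_power_cat map_concat)
  next
    fix fss xss yss assume "fss \<in> hom (prod_cat (map (power_cat C) ks)) xss yss"
    then show "on_arr fun_concat fss
        \<in> hom (power_cat C (sum_list ks)) (on_obj fun_concat xss) (on_obj fun_concat yss)"
      by (auto simp: hom_prod_power hom_power_cat fun_concat_def length_concat map_concat)
  next
    fix fss gss xss yss zss
    assume "fss \<in> hom (prod_cat (map (power_cat C) ks)) xss yss"
      "gss \<in> hom (prod_cat (map (power_cat C) ks)) yss zss"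
    then have l: "map length fss = ks" "map length gss = ks" by (auto simp: hom_prod_power)
    then have "length (concat fss) = sum_list ks" "length (concat gss) = sum_list ks"
      by (auto simp: length_concat)
    with l show "on_arr fun_concat (gss \<cdot>\<^bsub>prod_cat (map (power_cat C) ks)\<^esub> fss)
        = on_arr fun_concat gss \<cdot>\<^bsub>power_cat C (sum_list ks)\<^esub> on_arr fun_concat fss"
      by (simp add: Comp_prod_power fun_concat_def Comp_power_cat concat_map2)
  qed
qed

lemma cat_functor_id: "category C \<Longrightarrow> cat_functor C C fun_id"
  by (simp add: cat_functor_def cat_functor_axioms_def fun_id_def)

lemma cat_functor_single:
  assumes "category C"
  shows "cat_functor C (power_cat C 1) fun_single"
proof -
  interpret A: category C by fact
  interpret B: category "power_cat C 1" using assms by (rule category_power_cat)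
  show ?thesis
    by unfold_locales (auto simp: Obj_power_cat hom_power_cat fun_single_def Ident_power_cat Comp_power_cat hom_def
      power_cat_def prod_cat_def)
qed

lemma (in listed_lax_monoidal) lax_monoidal: "lax_monoidal M"
proof -
  let ?C = "Cat M"
  interpret category ?C by (rule Cat)
  have T: "cat_functor (power_cat ?C n) ?C (Tensor M n)" if n: "n \<ge> 1" for n
  proof -
    interpret P: category "power_cat ?C n" by (rule category_power_cat[OF Cat])
    show ?thesis
    proof
      fix xs assume "xs \<in> Obj (power_cat ?C n)"
      then have "obj_list ?C xs" "n = length xs" using n by (auto simp: Obj_power_cat obj_list_def)
      then show "on_obj (Tensor M n) xs \<in> Obj ?C"
        "on_arr (Tensor M n) (Ident (power_cat ?C n) xs) = Ident ?C (on_obj (Tensor M n) xs)"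
        using ten_Obj[of xs] ten_Ident[of xs] by (simp_all add: Ident_power_cat ten_def ten_arr_def)
    next
      fix fs xs ys assume "fs \<in> hom (power_cat ?C n) xs ys"
      then show "on_arr (Tensor M n) fs \<in> hom ?C (on_obj (Tensor M n) xs) (on_obj (Tensor M n) ys)"
        using n ten_hom[of fs] by (cases fs) (auto simp: hom_power_cat ten_def ten_arr_def)
    next
      fix fs gs xs ys zs assume "fs \<in> hom (power_cat ?C n) xs ys" "gs \<in> hom (power_cat ?C n) ys zs"
      then show "on_arr (Tensor M n) (gs \<cdot>\<^bsub>power_cat ?C n\<^esub> fs)
          = on_arr (Tensor M n) gs \<cdot>\<^bsub>?C\<^esub> on_arr (Tensor M n) fs"
        using n ten_Comp[of fs gs] by (cases "fs = []") (auto simp: hom_power_cat ten_def ten_arr_def Comp_power_cat)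
    qed
  qed
  have len: "[] \<notin> set xss" if "pos_list (map length xss)" for xss :: "'x list list"
    using that by (force simp: pos_list_def)
  have FT: "cat_functor (prod_cat (map (power_cat ?C) ks)) ?C
      (fun_comp (Tensor M (length ks)) (fun_prod (map (Tensor M) ks)))" if "pos_list ks" for ks
  proof (rule cat_functor_comp[OF _ T])
    show "cat_functor (prod_cat (map (power_cat ?C) ks)) (power_cat ?C (length ks)) (fun_prod (map (Tensor M) ks))"
      unfolding power_cat_def[of _ "length ks"]
      using that by (intro cat_functor_fun_prod) (auto simp: pos_list_def intro: T)
    show "1 \<le> length ks" using that by (cases ks) (auto simp: pos_list_def)
  qed
  have TC: "cat_functor (prod_cat (map (power_cat ?C) ks)) ?C (fun_comp (Tensor M (sum_list ks)) fun_concat)"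
    if "pos_list ks" for ks
  proof (rule cat_functor_comp[OF cat_functor_concat[OF Cat] T])
    show "1 \<le> sum_list ks" using that by (cases ks) (auto simp: pos_list_def)
  qed
  show ?thesis
  proof (rule lax_monoidal.intro[OF Cat])
    fix n :: nat assume "1 \<le> n"
    then show "cat_functor (power_cat ?C n) ?C (Tensor M n)" by (rule T)
  next
    fix ks assume ks: "pos_list ks"
    show "nat_trans (prod_cat (map (power_cat ?C) ks)) ?C
        (fun_comp (Tensor M (length ks)) (fun_prod (map (Tensor M) ks)))
        (fun_comp (Tensor M (sum_list ks)) fun_concat) (Assoc M ks)"
    proof (intro nat_trans.intro nat_trans_axioms.intro FT TC ks)
      fix xss assume "xss \<in> Obj (prod_cat (map (power_cat ?C) ks))"
      then have l: "map length xss = ks" and o: "\<forall>xs \<in> set xss. set xs \<subseteq> Obj ?C" by (auto simp: Obj_prod_power)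
      then have "obj_lists ?C xss" using ks len[of xss] by (auto simp: obj_lists_def obj_list_def pos_list_def)
      from asc_hom[OF this] l
      show "Assoc M ks xss \<in> hom ?C
          (on_obj (fun_comp (Tensor M (length ks)) (fun_prod (map (Tensor M) ks))) xss)
          (on_obj (fun_comp (Tensor M (sum_list ks)) fun_concat) xss)"
        by (auto simp: fun_comp_def fun_concat_def fun_prod_Tensor asc_def length_concat ten_def[of _ "map _ _"]
          ten_def[of _ "concat _"])
    next
      fix fss xss yss assume "fss \<in> hom (prod_cat (map (power_cat ?C) ks)) xss yss"
      then have l: "map length fss = ks" and o: "\<forall>fs \<in> set fss. set fs \<subseteq> Arr ?C"
        and xy: "xss = map (map (Dom ?C)) fss" "yss = map (map (Cod ?C)) fss" by (auto simp: hom_prod_power)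
      then have "fss \<noteq> []" "\<And>fs. fs \<in> set fss \<Longrightarrow> fs \<noteq> [] \<and> set fs \<subseteq> Arr ?C"
        using ks len[of fss] by (auto simp: pos_list_def)
      from asc_nat[OF this] l
      show "Assoc M ks yss \<cdot>\<^bsub>?C\<^esub> on_arr (fun_comp (Tensor M (length ks)) (fun_prod (map (Tensor M) ks))) fss
          = on_arr (fun_comp (Tensor M (sum_list ks)) fun_concat) fss \<cdot>\<^bsub>?C\<^esub> Assoc M ks xss"
        by (auto simp: xy fun_comp_def fun_concat_def fun_prod_Tensor asc_def length_concat
          ten_arr_def[of _ "map _ _"] ten_arr_def[of _ "concat _"] o_def)
    qed
  next
    show "nat_trans ?C ?C fun_id (fun_comp (Tensor M 1) fun_single) (Unit M)"
    proof (intro nat_trans.intro nat_trans_axioms.intro cat_functor_id Cat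
        cat_functor_comp[OF cat_functor_single[OF Cat] T] order.refl)
      fix x assume "x \<in> Obj ?C"
      from Unit_hom[OF this]
      show "Unit M x \<in> hom ?C (on_obj fun_id x) (on_obj (fun_comp (Tensor M 1) fun_single) x)"
        by (simp add: fun_id_def fun_comp_def fun_single_def ten_def)
    next
      fix f x y assume "f \<in> hom ?C x y"
      then show "Unit M y \<cdot>\<^bsub>?C\<^esub> on_arr fun_id f = on_arr (fun_comp (Tensor M 1) fun_single) f \<cdot>\<^bsub>?C\<^esub> Unit M x"
        using Unit_nat[of f] by (auto simp: fun_id_def fun_comp_def fun_single_def ten_arr_def hom_def)
    qed
  next
    fix kss xsss assume a: "kss \<noteq> []" "\<And>ks. ks \<in> set kss \<Longrightarrow> pos_list ks"
      "xsss \<in> Obj (prod_cat (map (\<lambda>ks. prod_cat (map (power_cat ?C) ks)) kss))"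
    then have l: "map (map length) xsss = kss" and o: "\<forall>xss \<in> set xsss. \<forall>xs \<in> set xss. set xs \<subseteq> Obj ?C"
      by (auto simp: Obj_prod_prod_power)
    have 1: "xsss \<noteq> []" using a(1) l by auto
    have 2: "obj_lists ?C xss" if "xss \<in> set xsss" for xss
    proof -
      have "pos_list (map length xss)" using a(2) l that by auto
      with len[OF this] o that show ?thesis by (auto simp: obj_lists_def obj_list_def pos_list_def)
    qed
    have 4: "map (\<lambda>i. Assoc M (kss ! i) (xsss ! i)) [0..<length kss] = map (asc M) xsss"
      using l by (auto simp: asc_def intro!: nth_equalityI)
    show "Assoc M (concat kss) (concat xsss) \<cdot>\<^bsub>?C\<^esub> Assoc M (map length kss)
          (on_obj (fun_prod (map (\<lambda>ks. fun_prod (map (Tensor M) ks)) kss)) xsss)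
      = Assoc M (map sum_list kss) (map concat xsss) \<cdot>\<^bsub>?C\<^esub>
        on_arr (Tensor M (length kss)) (map (\<lambda>i. Assoc M (kss ! i) (xsss ! i)) [0..<length kss])"
      using asc_asc[OF 1 2] unfolding 4 fun_prod_fun_prod_Tensor[OF l]
      by (simp add: l[symmetric] asc_def[of _ "concat _"] asc_def[of _ "map _ _"] ten_arr_def o_def length_concat map_concat)
  next
    fix n :: nat and xs assume "1 \<le> n" "xs \<in> Obj (power_cat ?C n)"
    then have "obj_list ?C xs" and n: "n = length xs" by (auto simp: obj_list_def Obj_power_cat)
    from asc_Unit[OF this(1)] asc_Units[OF this(1)]
    show "Assoc M [n] [xs] \<cdot>\<^bsub>?C\<^esub> Unit M (on_obj (Tensor M n) xs) = Ident ?C (on_obj (Tensor M n) xs)"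
      "Assoc M (replicate n 1) (map (\<lambda>x. [x]) xs) \<cdot>\<^bsub>?C\<^esub> on_arr (Tensor M n) (map (Unit M) xs)
        = Ident ?C (on_obj (Tensor M n) xs)"
      by (simp_all add: n asc_def ten_def ten_arr_def o_def map_replicate_const)
  qed
qed

lemma map_hom:
  assumes "\<And>x. x \<in> set xs \<Longrightarrow> f x \<in> hom C (a x) (b x)"
  shows "set (map f xs) \<subseteq> Arr C" "map (Dom C) (map f xs) = map a xs" "map (Cod C) (map f xs) = map b xs"
  using assms by (auto simp: hom_def)

lemma Arr_hom: "f \<in> Arr C \<Longrightarrow> f \<in> hom C (Dom C f) (Cod C f)"
  by (simp add: hom_def)

lemma obj_list_map_Dom_Cod:
  assumes "category C" "fs \<noteq> []" "set fs \<subseteq> Arr C"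
  shows "obj_list C (map (Dom C) fs)" "obj_list C (map (Cod C) fs)"
  using assms category.Dom_Obj[OF assms(1)] category.Cod_Obj[OF assms(1)] by (auto simp: obj_list_def)

lemma obj_list_singleton [simp]: "obj_list C [x] \<longleftrightarrow> x \<in> Obj C"
  by (auto simp: obj_list_def)

lemma obj_lists_concat: "obj_lists C xss \<Longrightarrow> obj_list C (concat xss)"
  by (cases xss) (auto simp: obj_lists_def obj_list_def)

section \<open>Lifting a lax monoidal structure along a faithful functor\<close>

text \<open>
  A functor \<open>(U, V) : N \<rightarrow> M\<close>, injective on each set of arrows with given domain and codomain, that
  strictly preserves the \<open>n\<close>-ary products and sends the candidates for \<open>\<Phi>\<close> and \<open>\<iota>\<close> in \<open>N\<close> to those
  of the lax monoidal category \<open>M\<close>.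
\<close>

locale faithful_strict =
  fixes M :: "('o, 'a) moncat" and N :: "('p, 'b) moncat" and U :: "'p \<Rightarrow> 'o" and V :: "'b \<Rightarrow> 'a"
  assumes lax_M: "lax_monoidal M"
    and Cat_N: "category (Cat N)"
    and U_Obj: "x \<in> Obj (Cat N) \<Longrightarrow> U x \<in> Obj (Cat M)"
    and V_hom: "f \<in> hom (Cat N) x y \<Longrightarrow> V f \<in> hom (Cat M) (U x) (U y)"
    and V_inj: "f \<in> hom (Cat N) x y \<Longrightarrow> g \<in> hom (Cat N) x y \<Longrightarrow> V f = V g \<Longrightarrow> f = g"
    and V_Ident: "x \<in> Obj (Cat N) \<Longrightarrow> V (Ident (Cat N) x) = Ident (Cat M) (U x)"
    and V_Comp: "f \<in> hom (Cat N) x y \<Longrightarrow> g \<in> hom (Cat N) y z \<Longrightarrow>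
      V (g \<cdot>\<^bsub>Cat N\<^esub> f) = V g \<cdot>\<^bsub>Cat M\<^esub> V f"
    and ten_Obj_N: "obj_list (Cat N) xs \<Longrightarrow> ten N xs \<in> Obj (Cat N)"
    and U_ten: "obj_list (Cat N) xs \<Longrightarrow> U (ten N xs) = ten M (map U xs)"
    and ten_hom_N: "fs \<noteq> [] \<Longrightarrow> set fs \<subseteq> Arr (Cat N) \<Longrightarrow>
      ten_arr N fs \<in> hom (Cat N) (ten N (map (Dom (Cat N)) fs)) (ten N (map (Cod (Cat N)) fs))"
    and V_ten: "fs \<noteq> [] \<Longrightarrow> set fs \<subseteq> Arr (Cat N) \<Longrightarrow> V (ten_arr N fs) = ten_arr M (map V fs)"
    and asc_hom_N: "obj_lists (Cat N) xss \<Longrightarrow>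
      asc N xss \<in> hom (Cat N) (ten N (map (ten N) xss)) (ten N (concat xss))"
    and V_asc: "obj_lists (Cat N) xss \<Longrightarrow> V (asc N xss) = asc M (map (map U) xss)"
    and Unit_hom_N: "x \<in> Obj (Cat N) \<Longrightarrow> Unit N x \<in> hom (Cat N) x (ten N [x])"
    and V_Unit: "x \<in> Obj (Cat N) \<Longrightarrow> V (Unit N x) = Unit M (U x)"

lemma concat_map_concat: "concat (map concat xsss) = concat (concat xsss)"
  by (induction xsss) auto

context faithful_strict
begin

sublocale M: listed_lax_monoidal M by (rule lax_monoidal_listed[OF lax_M])
sublocale CM: category "Cat M" by (rule M.Cat)
sublocale CN: category "Cat N" by (rule Cat_N)

lemma V_Arr: "f \<in> Arr (Cat N) \<Longrightarrow> V f \<in> Arr (Cat M) \<and> Dom (Cat M) (V f) = U (Dom (Cat N) f) \<and>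
    Cod (Cat M) (V f) = U (Cod (Cat N) f)"
  using V_hom[of f] by (auto simp: hom_def)

lemma obj_list_U: "obj_list (Cat N) xs \<Longrightarrow> obj_list (Cat M) (map U xs)"
  using U_Obj by (auto simp: obj_list_def)

lemma obj_lists_U: "obj_lists (Cat N) xss \<Longrightarrow> obj_lists (Cat M) (map (map U) xss)"
  using obj_list_U by (auto simp: obj_lists_def)

lemma obj_list_ten: "obj_lists (Cat N) xss \<Longrightarrow> obj_list (Cat N) (map (ten N) xss)"
  using ten_Obj_N by (auto simp: obj_lists_def obj_list_def[of _ "map _ _"])

lemma ten_hom_map_N:
  assumes "xs \<noteq> []" "\<And>x. x \<in> set xs \<Longrightarrow> f x \<in> hom (Cat N) (a x) (b x)"
  shows "ten_arr N (map f xs) \<in> hom (Cat N) (ten N (map a xs)) (ten N (map b xs))"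
proof -
  note h = map_hom[of xs f "Cat N" a b, OF assms(2)]
  have "map f xs \<noteq> []" using assms(1) by simp
  from ten_hom_N[OF this h(1)] show ?thesis by (simp only: h(2,3))
qed

text \<open>
  Equations between composites are reflected by \<open>V\<close>, once both sides are known to have the same domain and
  codomain. In the coherence laws these agree by identities between lists, never by a property of the
  objects involved.
\<close>

lemma eqI:
  assumes "f \<in> hom (Cat N) x y" "g \<in> hom (Cat N) y z" "f' \<in> hom (Cat N) x y'" "g' \<in> hom (Cat N) y' z"
    and "V g \<cdot>\<^bsub>Cat M\<^esub> V f = V g' \<cdot>\<^bsub>Cat M\<^esub> V f'"
  shows "g \<cdot>\<^bsub>Cat N\<^esub> f = g' \<cdot>\<^bsub>Cat N\<^esub> f'"
  by (rule V_inj[OF CN.Comp_hom[OF assms(1,2)] CN.Comp_hom[OF assms(3,4)]])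
     (simp add: V_Comp[OF assms(1,2)] V_Comp[OF assms(3,4)] assms(5))

lemma eq_IdentI:
  assumes "f \<in> hom (Cat N) x y" "g \<in> hom (Cat N) y x"
    and "V g \<cdot>\<^bsub>Cat M\<^esub> V f = Ident (Cat M) (U x)"
  shows "g \<cdot>\<^bsub>Cat N\<^esub> f = Ident (Cat N) x"
proof (rule V_inj[OF CN.Comp_hom[OF assms(1,2)] CN.Ident_hom])
  show x: "x \<in> Obj (Cat N)" using assms(1) CN.Dom_Obj by (auto simp: hom_def)
  show "V (g \<cdot>\<^bsub>Cat N\<^esub> f) = V (Ident (Cat N) x)"
    by (simp add: V_Comp[OF assms(1,2)] V_Ident[OF x] assms(3))
qed

text \<open>The structure of \<open>N\<close> is lax monoidal because the images of all axioms hold in \<open>M\<close>.\<close>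

theorem lax_N: "lax_monoidal N"
proof (rule listed_lax_monoidal.lax_monoidal, unfold_locales)
  fix xs assume a: "obj_list (Cat N) xs"
  then have ne: "xs \<noteq> []" and o: "set xs \<subseteq> Obj (Cat N)" by (auto simp: obj_list_def)
  have h: "ten_arr N (map (Ident (Cat N)) xs) \<in> hom (Cat N) (ten N xs) (ten N xs)"
    using ten_hom_map_N[of xs "Ident (Cat N)" "\<lambda>x. x" "\<lambda>x. x"] ne o CN.Ident_hom by (auto simp: subset_iff)
  have i: "set (map (Ident (Cat N)) xs) \<subseteq> Arr (Cat N)" using o CN.Ident_hom by (auto simp: hom_def)
  have VI: "map V (map (Ident (Cat N)) xs) = map (Ident (Cat M)) (map U xs)"
    using o by (auto simp: V_Ident)
  show "ten_arr N (map (Ident (Cat N)) xs) = Ident (Cat N) (ten N xs)"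
  proof (rule V_inj[OF h CN.Ident_hom[OF ten_Obj_N[OF a]]])
    have "V (ten_arr N (map (Ident (Cat N)) xs)) = ten_arr M (map (Ident (Cat M)) (map U xs))"
      using V_ten[OF _ i] ne unfolding VI by simp
    then show "V (ten_arr N (map (Ident (Cat N)) xs)) = V (Ident (Cat N) (ten N xs))"
      using M.ten_Ident[OF obj_list_U[OF a]] by (simp add: V_Ident ten_Obj_N a U_ten)
  qed
  have t: "ten N xs \<in> Obj (Cat N)" by (rule ten_Obj_N[OF a])
  have 1: "obj_lists (Cat N) [xs]" using a by (simp add: obj_lists_def)
  show "asc N [xs] \<cdot>\<^bsub>Cat N\<^esub> Unit N (ten N xs) = Ident (Cat N) (ten N xs)"
  proof (rule eq_IdentI)
    show "Unit N (ten N xs) \<in> hom (Cat N) (ten N xs) (ten N [ten N xs])" by (rule Unit_hom_N[OF t])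
    show "asc N [xs] \<in> hom (Cat N) (ten N [ten N xs]) (ten N xs)" using asc_hom_N[OF 1] by simp
    show "V (asc N [xs]) \<cdot>\<^bsub>Cat M\<^esub> V (Unit N (ten N xs)) = Ident (Cat M) (U (ten N xs))"
      using M.asc_Unit[OF obj_list_U[OF a]] by (simp add: V_asc[OF 1] V_Unit[OF t] U_ten[OF a])
  qed
  let ?s = "map (\<lambda>x. [x]) xs"
  have 2: "obj_lists (Cat N) ?s" using ne o by (auto simp: obj_lists_def obj_list_def)
  have u: "x \<in> set xs \<Longrightarrow> Unit N x \<in> hom (Cat N) x (ten N [x])" for x using o Unit_hom_N by auto
  show "asc N ?s \<cdot>\<^bsub>Cat N\<^esub> ten_arr N (map (Unit N) xs) = Ident (Cat N) (ten N xs)"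
  proof (rule eq_IdentI)
    show "ten_arr N (map (Unit N) xs) \<in> hom (Cat N) (ten N xs) (ten N (map (ten N) ?s))"
      using ten_hom_map_N[of xs "Unit N" "\<lambda>x. x" "\<lambda>x. ten N [x]", OF ne u] by (simp add: o_def)
    show "asc N ?s \<in> hom (Cat N) (ten N (map (ten N) ?s)) (ten N xs)" using asc_hom_N[OF 2] by simp
    have m: "map V (map (Unit N) xs) = map (Unit M) (map U xs)" using o by (auto simp: V_Unit)
    have "V (ten_arr N (map (Unit N) xs)) = ten_arr M (map (Unit M) (map U xs))"
      using V_ten[of "map (Unit N) xs"] map_hom(1)[of xs "Unit N" "Cat N", OF u] ne unfolding m by simp
    then show "V (asc N ?s) \<cdot>\<^bsub>Cat M\<^esub> V (ten_arr N (map (Unit N) xs)) = Ident (Cat M) (U (ten N xs))"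
      using M.asc_Units[OF obj_list_U[OF a]] by (simp add: V_asc[OF 2] U_ten[OF a] o_def)
  qed
next
  fix fs gs assume a: "fs \<noteq> []" "set fs \<subseteq> Arr (Cat N)" "set gs \<subseteq> Arr (Cat N)"
    "map (Dom (Cat N)) gs = map (Cod (Cat N)) fs"
  have l: "length gs = length fs" using a(4) by (metis length_map)
  have gne: "gs \<noteq> []" using a(1) l by auto
  have z: "f \<in> hom (Cat N) (Dom (Cat N) f) (Cod (Cat N) f) \<and> g \<in> hom (Cat N) (Cod (Cat N) f) (Cod (Cat N) g)"
    if "(g, f) \<in> set (zip gs fs)" for g f
  proof -
    have "Dom (Cat N) g = Cod (Cat N) f"
      using that a(4) l by (metis in_set_zip fst_conv snd_conv nth_map)
    then show ?thesis using a(2,3) set_zip_leftD[OF that] set_zip_rightD[OF that] by (auto simp: hom_def)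
  qed
  let ?m = "map2 (\<lambda>g f. g \<cdot>\<^bsub>Cat N\<^esub> f) gs fs"
  have m: "ten_arr N ?m \<in> hom (Cat N) (ten N (map (\<lambda>(g, f). Dom (Cat N) f) (zip gs fs)))
      (ten N (map (\<lambda>(g, f). Cod (Cat N) g) (zip gs fs)))"
    using gne a(1) by (intro ten_hom_map_N) (auto simp: zip_eq_Nil_iff dest!: z intro: CN.Comp_hom)
  have mA: "set ?m \<subseteq> Arr (Cat N)"
    using z CN.Comp_hom by (fastforce simp: hom_def)
  have d: "map (\<lambda>(g, f). Dom (Cat N) f) (zip gs fs) = map (Dom (Cat N)) fs"
    "map (\<lambda>(g, f). Cod (Cat N) g) (zip gs fs) = map (Cod (Cat N)) gs"
    using l by (auto intro!: nth_equalityI)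
  have fh: "ten_arr N fs \<in> hom (Cat N) (ten N (map (Dom (Cat N)) fs)) (ten N (map (Cod (Cat N)) fs))"
    by (rule ten_hom_N[OF a(1,2)])
  have gh: "ten_arr N gs \<in> hom (Cat N) (ten N (map (Cod (Cat N)) fs)) (ten N (map (Cod (Cat N)) gs))"
    using ten_hom_N[OF gne a(3)] by (simp add: a(4))
  show "ten_arr N ?m = ten_arr N gs \<cdot>\<^bsub>Cat N\<^esub> ten_arr N fs"
  proof (rule V_inj[OF m[unfolded d] CN.Comp_hom[OF fh gh]])
    have Vm: "map V ?m = map2 (\<lambda>g f. g \<cdot>\<^bsub>Cat M\<^esub> f) (map V gs) (map V fs)"
      using z V_Comp by (fastforce simp: zip_map_map)
    have "map (U \<circ> Dom (Cat N)) gs = map (U \<circ> Cod (Cat N)) fs" using a(4) by (metis map_map)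
    then have dc: "map (Dom (Cat M)) (map V gs) = map (Cod (Cat M)) (map V fs)"
      using V_Arr a(2,3) by (simp add: subset_iff o_def cong: map_cong)
    have "ten_arr M (map V ?m) = ten_arr M (map V gs) \<cdot>\<^bsub>Cat M\<^esub> ten_arr M (map V fs)"
      unfolding Vm using a(1-3) V_Arr by (intro M.ten_Comp dc) auto
    then show "V (ten_arr N ?m) = V (ten_arr N gs \<cdot>\<^bsub>Cat N\<^esub> ten_arr N fs)"
      using a(1) gne by (simp add: V_Comp[OF fh gh] V_ten a(2,3) V_ten[OF _ mA] zip_eq_Nil_iff del: map_map)
  qed
next
  fix fss assume fss: "fss \<noteq> []" "\<And>fs. fs \<in> set fss \<Longrightarrow> fs \<noteq> [] \<and> set fs \<subseteq> Arr (Cat N)"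
  let ?d = "map (map (Dom (Cat N))) fss" and ?c = "map (map (Cod (Cat N))) fss"
  have obj_list: "obj_lists (Cat N) ?d" "obj_lists (Cat N) ?c"
    using fss obj_list_map_Dom_Cod[OF Cat_N] by (auto simp: obj_lists_def)
  have cc: "concat fss \<noteq> []" "set (concat fss) \<subseteq> Arr (Cat N)" using fss by (cases fss; fastforce)+
  have t: "ten_arr N fs \<in> hom (Cat N) (ten N (map (Dom (Cat N)) fs)) (ten N (map (Cod (Cat N)) fs))"
    if "fs \<in> set fss" for fs using ten_hom_N fss(2) that by blast
  show "asc N ?c \<cdot>\<^bsub>Cat N\<^esub> ten_arr N (map (ten_arr N) fss) = ten_arr N (concat fss) \<cdot>\<^bsub>Cat N\<^esub> asc N ?d"
  proof (rule eqI)
    show "ten_arr N (map (ten_arr N) fss) \<in> hom (Cat N) (ten N (map (ten N) ?d)) (ten N (map (ten N) ?c))"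
      using ten_hom_map_N[OF fss(1) t] by (simp add: o_def)
    show "asc N ?c \<in> hom (Cat N) (ten N (map (ten N) ?c)) (ten N (concat ?c))" by (rule asc_hom_N[OF obj_list(2)])
    show "asc N ?d \<in> hom (Cat N) (ten N (map (ten N) ?d)) (ten N (concat ?d))" by (rule asc_hom_N[OF obj_list(1)])
    show "ten_arr N (concat fss) \<in> hom (Cat N) (ten N (concat ?d)) (ten N (concat ?c))"
      using ten_hom_N[OF cc] by (simp add: map_concat)
    have v: "V (ten_arr N (map (ten_arr N) fss)) = ten_arr M (map (ten_arr M) (map (map V) fss))"
    proof -
      have "map V (map (ten_arr N) fss) = map (ten_arr M) (map (map V) fss)"
        using fss(2) by (auto simp: V_ten)
      then show ?thesis
        using V_ten[of "map (ten_arr N) fss"] map_hom(1)[of fss "ten_arr N" "Cat N", OF t] fss(1)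
        by (simp only: map_is_Nil_conv not_False_eq_True)
    qed
    have e: "map (map U) ?d = map (map (Dom (Cat M))) (map (map V) fss)"
      "map (map U) ?c = map (map (Cod (Cat M))) (map (map V) fss)"
      using fss(2) V_Arr by (auto simp: subset_iff)
    show "V (asc N ?c) \<cdot>\<^bsub>Cat M\<^esub> V (ten_arr N (map (ten_arr N) fss))
        = V (ten_arr N (concat fss)) \<cdot>\<^bsub>Cat M\<^esub> V (asc N ?d)"
      unfolding V_asc[OF obj_list(1)] V_asc[OF obj_list(2)] v V_ten[OF cc] e map_concat
      using fss(1) by (intro M.asc_nat) (auto dest!: fss(2) simp: subset_iff V_Arr)
  qed
next
  fix f assume f: "f \<in> Arr (Cat N)"
  then have o: "Dom (Cat N) f \<in> Obj (Cat N)" "Cod (Cat N) f \<in> Obj (Cat N)" by (auto intro: CN.Dom_Obj CN.Cod_Obj)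
  show "Unit N (Cod (Cat N) f) \<cdot>\<^bsub>Cat N\<^esub> f = ten_arr N [f] \<cdot>\<^bsub>Cat N\<^esub> Unit N (Dom (Cat N) f)"
  proof (rule eqI[OF Arr_hom[OF f] Unit_hom_N[OF o(2)] Unit_hom_N[OF o(1)]])
    show "ten_arr N [f] \<in> hom (Cat N) (ten N [Dom (Cat N) f]) (ten N [Cod (Cat N) f])"
      using ten_hom_N[of "[f]"] f by simp
    show "V (Unit N (Cod (Cat N) f)) \<cdot>\<^bsub>Cat M\<^esub> V f = V (ten_arr N [f]) \<cdot>\<^bsub>Cat M\<^esub> V (Unit N (Dom (Cat N) f))"
      using M.Unit_nat[of "V f"] V_Arr[OF f] f V_ten[of "[f]"] by (simp add: V_Unit o)
  qed
next
  fix xsss assume a: "xsss \<noteq> []" "\<And>xss. xss \<in> set xsss \<Longrightarrow> obj_lists (Cat N) xss"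
  have o1: "obj_lists (Cat N) (concat xsss)"
    using a by (cases xsss) (auto simp: obj_lists_def)
  have o2: "obj_lists (Cat N) (map (map (ten N)) xsss)" using a obj_list_ten by (auto simp: obj_lists_def[of _ "map _ _"])
  have o3: "obj_lists (Cat N) (map concat xsss)" using a obj_lists_concat by (auto simp: obj_lists_def[of _ "map _ _"])
  have h: "asc N xss \<in> hom (Cat N) (ten N (map (ten N) xss)) (ten N (concat xss))" if "xss \<in> set xsss" for xss
    using a(2) asc_hom_N that by blast
  show "asc N (concat xsss) \<cdot>\<^bsub>Cat N\<^esub> asc N (map (map (ten N)) xsss)
    = asc N (map concat xsss) \<cdot>\<^bsub>Cat N\<^esub> ten_arr N (map (asc N) xsss)"
  proof (rule eqI)
    show "asc N (map (map (ten N)) xsss) \<in> hom (Cat N) (ten N (map (\<lambda>xss. ten N (map (ten N) xss)) xsss))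
        (ten N (map (ten N) (concat xsss)))"
      using asc_hom_N[OF o2] by (simp add: o_def map_concat)
    show "asc N (concat xsss) \<in> hom (Cat N) (ten N (map (ten N) (concat xsss))) (ten N (concat (concat xsss)))"
      by (rule asc_hom_N[OF o1])
    show "ten_arr N (map (asc N) xsss) \<in> hom (Cat N) (ten N (map (\<lambda>xss. ten N (map (ten N) xss)) xsss))
        (ten N (map (\<lambda>xss. ten N (concat xss)) xsss))"
      by (rule ten_hom_map_N[OF a(1) h])
    show "asc N (map concat xsss) \<in> hom (Cat N) (ten N (map (\<lambda>xss. ten N (concat xss)) xsss))
        (ten N (concat (concat xsss)))"
      using asc_hom_N[OF o3] by (simp add: o_def concat_map_concat)
    have v: "V (ten_arr N (map (asc N) xsss)) = ten_arr M (map (asc M) (map (map (map U)) xsss))"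
    proof -
      have "map V (map (asc N) xsss) = map (asc M) (map (map (map U)) xsss)"
        using a(2) by (auto simp: V_asc)
      then show ?thesis
        using V_ten[of "map (asc N) xsss"] map_hom(1)[of xsss "asc N" "Cat N", OF h] a(1)
        by (simp only: map_is_Nil_conv not_False_eq_True)
    qed
    have e: "map (map U) (map (map (ten N)) xsss) = map (map (ten M)) (map (map (map U)) xsss)"
      using a(2) U_ten by (auto simp: obj_lists_def)
    have e2: "map (map U) (map concat xsss) = map concat (map (map (map U)) xsss)"
      by (simp add: map_concat)
    have e3: "map (map U) (concat xsss) = concat (map (map (map U)) xsss)"
      by (simp add: map_concat)
    show "V (asc N (concat xsss)) \<cdot>\<^bsub>Cat M\<^esub> V (asc N (map (map (ten N)) xsss))
        = V (asc N (map concat xsss)) \<cdot>\<^bsub>Cat M\<^esub> V (ten_arr N (map (asc N) xsss))"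
      unfolding V_asc[OF o1] V_asc[OF o2] V_asc[OF o3] v e e2 e3
      using a obj_lists_U by (intro M.asc_asc) auto
  qed
qed (use ten_Obj_N ten_hom_N asc_hom_N Unit_hom_N in auto)

end

section \<open>Cosemigroups under a functor of several variables\<close>

context listed_lax_monoidal
begin

lemma ten_hom_map:
  assumes "xs \<noteq> []" "\<And>x. x \<in> set xs \<Longrightarrow> f x \<in> hom (Cat M) (a x) (b x)"
  shows "ten_arr M (map f xs) \<in> hom (Cat M) (ten M (map a xs)) (ten M (map b xs))"
proof -
  note h = map_hom[of xs f "Cat M" a b, OF assms(2)]
  have "map f xs \<noteq> []" using assms(1) by simp
  from ten_hom[OF this h(1)] show ?thesis by (simp only: h(2,3))
qed

lemma ten_Comp_map:
  assumes "xs \<noteq> []" "\<And>x. x \<in> set xs \<Longrightarrow> f x \<in> hom (Cat M) (a x) (b x)"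
    "\<And>x. x \<in> set xs \<Longrightarrow> g x \<in> hom (Cat M) (b x) (c x)"
  shows "ten_arr M (map (\<lambda>x. g x \<cdot>\<^bsub>Cat M\<^esub> f x) xs)
    = ten_arr M (map g xs) \<cdot>\<^bsub>Cat M\<^esub> ten_arr M (map f xs)"
proof -
  note f = map_hom[of xs f "Cat M" a b, OF assms(2)] and g = map_hom[of xs g "Cat M" b c, OF assms(3)]
  have "map f xs \<noteq> []" using assms(1) by simp
  from ten_Comp[OF this f(1) g(1)] show ?thesis by (simp only: f(3) g(2) map2_map_map)
qed

lemma ten2_hom:
  assumes "f \<in> hom (Cat M) a b" "g \<in> hom (Cat M) c d"
  shows "on_arr (Tensor M 2) [f, g] \<in> hom (Cat M) (on_obj (Tensor M 2) [a, c]) (on_obj (Tensor M 2) [b, d])"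
  using ten_hom[of "[f, g]"] assms by (simp add: hom_def ten_def ten_arr_def numeral_2_eq_2)

lemma ten2_Comp:
  assumes "f \<in> hom (Cat M) a b" "g \<in> hom (Cat M) c d" "f' \<in> hom (Cat M) b b'" "g' \<in> hom (Cat M) d d'"
  shows "on_arr (Tensor M 2) [f' \<cdot>\<^bsub>Cat M\<^esub> f, g' \<cdot>\<^bsub>Cat M\<^esub> g]
    = on_arr (Tensor M 2) [f', g'] \<cdot>\<^bsub>Cat M\<^esub> on_arr (Tensor M 2) [f, g]"
  using ten_Comp[of "[f, g]" "[f', g']"] assms by (simp add: hom_def ten_arr_def numeral_2_eq_2)

lemma ten2_Ident:
  assumes "a \<in> Obj (Cat M)" "b \<in> Obj (Cat M)"
  shows "on_arr (Tensor M 2) [Ident (Cat M) a, Ident (Cat M) b] = Ident (Cat M) (on_obj (Tensor M 2) [a, b])"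
  using ten_Ident[of "[a, b]"] assms by (simp add: obj_list_def ten_def ten_arr_def numeral_2_eq_2)

lemma Assoc_21_12_hom:
  assumes "a \<in> Obj (Cat M)" "b \<in> Obj (Cat M)" "c \<in> Obj (Cat M)"
  shows "Assoc M [2, 1] [[a, b], [c]] \<in> hom (Cat M)
      (on_obj (Tensor M 2) [on_obj (Tensor M 2) [a, b], on_obj (Tensor M 1) [c]]) (on_obj (Tensor M 3) [a, b, c])"
    and "Assoc M [1, 2] [[a], [b, c]] \<in> hom (Cat M)
      (on_obj (Tensor M 2) [on_obj (Tensor M 1) [a], on_obj (Tensor M 2) [b, c]]) (on_obj (Tensor M 3) [a, b, c])"
  using asc_hom[of "[[a, b], [c]]"] asc_hom[of "[[a], [b, c]]"] assms
  by (simp_all add: obj_lists_def obj_list_def asc_def ten_def numeral_2_eq_2 numeral_3_eq_3)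

lemma Unit_hom1: "a \<in> Obj (Cat M) \<Longrightarrow> Unit M a \<in> hom (Cat M) a (on_obj (Tensor M 1) [a])"
  using Unit_hom[of a] by (simp add: ten_def)

end

text \<open>
  The diagram chase for coassociativity, in one of its two halves. In the application \<open>G \<cdot> d\<close> is the new
  comultiplication, \<open>P \<cdot> Q\<close> is its product with a unit component, \<open>A\<close> is a component of \<open>\<Phi>\<close>, \<open>QG\<close> is
  the naturality of \<open>\<gamma>2\<close> and \<open>APH\<close> is an associativity law. The right-hand side is \<open>K = \<gamma>3\<close> after the
  image of one side of the coassociativity equation of the given cosemigroups.
\<close>

lemma (in category) Comp_chain:
  assumes "d \<in> hom C s x" "G \<in> hom C x y" "Q \<in> hom C y z" "P \<in> hom C z w" "A \<in> hom C w v"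
    and "e \<in> hom C x u" "H \<in> hom C u z" "\<phi> \<in> hom C u r" "K \<in> hom C r v"
    and QG: "Q \<cdot> G = H \<cdot> e" and APH: "A \<cdot> P \<cdot> H = K \<cdot> \<phi>"
  shows "A \<cdot> (P \<cdot> Q) \<cdot> (G \<cdot> d) = K \<cdot> (\<phi> \<cdot> e \<cdot> d)"
proof -
  note h = assms(1-9) and c = Comp_hom
  have ed: "e \<cdot> d \<in> hom C s u" by (rule c[OF h(1,6)])
  have "A \<cdot> (P \<cdot> Q) \<cdot> (G \<cdot> d) = (A \<cdot> P) \<cdot> (Q \<cdot> (G \<cdot> d))"
    by (simp add: Comp_assoc[OF h(3-5)] Comp_assoc[OF c[OF h(1,2)] h(3) c[OF h(4,5)]])
  also have "Q \<cdot> (G \<cdot> d) = H \<cdot> (e \<cdot> d)"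
    by (simp add: Comp_assoc[OF h(1-3)] QG Comp_assoc[OF h(1,6,7)])
  also have "(A \<cdot> P) \<cdot> (H \<cdot> (e \<cdot> d)) = K \<cdot> \<phi> \<cdot> (e \<cdot> d)"
    by (simp add: Comp_assoc[OF ed h(7) c[OF h(4,5)]] APH)
  also have "\<dots> = K \<cdot> (\<phi> \<cdot> e \<cdot> d)"
    by (simp add: Comp_assoc[OF ed h(8,9), symmetric] Comp_assoc[OF h(1,6,8)])
  finally show ?thesis .
qed

text \<open>
  The diagram chase showing that a component \<open>\<psi>\<close> is a morphism: \<open>N\<close> is the naturality of the
  transformation and \<open>P\<close> its compatibility with \<open>\<xi>\<close>.
\<close>

lemma (in category) Comp_square:
  assumes "s \<in> hom C x y" "\<psi>' \<in> hom C y z" "\<psi> \<in> hom C x w" "t \<in> hom C w z" "u \<in> hom C z v" "X \<in> hom C v r"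
    and "X' \<in> hom C y q" "T \<in> hom C q r"
    and N: "t \<cdot> \<psi> = \<psi>' \<cdot> s" and P: "X \<cdot> u \<cdot> \<psi>' = T \<cdot> X'"
  shows "X \<cdot> (u \<cdot> t) \<cdot> \<psi> = T \<cdot> (X' \<cdot> s)"
proof -
  note h = assms(1-8) and c = Comp_hom
  have "X \<cdot> (u \<cdot> t) \<cdot> \<psi> = (X \<cdot> u) \<cdot> (t \<cdot> \<psi>)"
    by (simp only: Comp_assoc[OF h(4-6)] Comp_assoc[OF h(3,4) c[OF h(5,6)]])
  also have "\<dots> = T \<cdot> (X' \<cdot> s)"
    by (simp only: N Comp_assoc[OF h(1,2) c[OF h(5,6)]] P Comp_assoc[OF h(1,7,8)])
  finally show ?thesis .
qed

text \<open>
  A functor \<open>S : L\<^sup>n \<rightarrow> L\<close> with the part of a lax monoidal structure that concerns at most three factors.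
  An object of \<open>L\<^sup>n\<close> is given by a function on the indices \<open>{0..<n}\<close>. Here \<open>\<gamma>2\<close> takes pairs of such
  objects, but \<open>\<gamma>3\<close> is only needed on triples of equal ones and so takes a single argument. Preservation of
  identities is not needed.
\<close>

locale power_functor =
  fixes L :: "('o, 'a) moncat" and n :: nat and S :: "('o list, 'a list, 'o, 'a) fun_data"
    and \<gamma>1 :: "(nat \<Rightarrow> 'o) \<Rightarrow> 'a" and \<gamma>2 :: "(nat \<Rightarrow> 'o) \<Rightarrow> (nat \<Rightarrow> 'o) \<Rightarrow> 'a"
    and \<gamma>3 :: "(nat \<Rightarrow> 'o) \<Rightarrow> 'a"
  assumes lax: "lax_monoidal L"
    and S_Obj: "(\<And>i. i < n \<Longrightarrow> a i \<in> Obj (Cat L)) \<Longrightarrow> on_obj S (map a [0..<n]) \<in> Obj (Cat L)"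
    and S_hom: "(\<And>i. i < n \<Longrightarrow> f i \<in> hom (Cat L) (a i) (b i)) \<Longrightarrow>
      on_arr S (map f [0..<n]) \<in> hom (Cat L) (on_obj S (map a [0..<n])) (on_obj S (map b [0..<n]))"
    and S_Comp: "(\<And>i. i < n \<Longrightarrow> f i \<in> hom (Cat L) (a i) (b i)) \<Longrightarrow>
      (\<And>i. i < n \<Longrightarrow> g i \<in> hom (Cat L) (b i) (c i)) \<Longrightarrow>
      on_arr S (map (\<lambda>i. g i \<cdot>\<^bsub>Cat L\<^esub> f i) [0..<n])
      = on_arr S (map g [0..<n]) \<cdot>\<^bsub>Cat L\<^esub> on_arr S (map f [0..<n])"
    and \<gamma>1_hom: "(\<And>i. i < n \<Longrightarrow> a i \<in> Obj (Cat L)) \<Longrightarrow>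
      \<gamma>1 a \<in> hom (Cat L) (on_obj S (map (\<lambda>i. on_obj (Tensor L 1) [a i]) [0..<n]))
        (on_obj (Tensor L 1) [on_obj S (map a [0..<n])])"
    and \<gamma>1_Unit: "(\<And>i. i < n \<Longrightarrow> a i \<in> Obj (Cat L)) \<Longrightarrow>
      \<gamma>1 a \<cdot>\<^bsub>Cat L\<^esub> on_arr S (map (\<lambda>i. Unit L (a i)) [0..<n]) = Unit L (on_obj S (map a [0..<n]))"
    and \<gamma>2_hom: "(\<And>i. i < n \<Longrightarrow> a i \<in> Obj (Cat L)) \<Longrightarrow> (\<And>i. i < n \<Longrightarrow> b i \<in> Obj (Cat L)) \<Longrightarrow>
      \<gamma>2 a b \<in> hom (Cat L) (on_obj S (map (\<lambda>i. on_obj (Tensor L 2) [a i, b i]) [0..<n]))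
        (on_obj (Tensor L 2) [on_obj S (map a [0..<n]), on_obj S (map b [0..<n])])"
    and \<gamma>2_nat: "(\<And>i. i < n \<Longrightarrow> f i \<in> hom (Cat L) (a i) (a' i)) \<Longrightarrow>
      (\<And>i. i < n \<Longrightarrow> g i \<in> hom (Cat L) (b i) (b' i)) \<Longrightarrow>
      \<gamma>2 a' b' \<cdot>\<^bsub>Cat L\<^esub> on_arr S (map (\<lambda>i. on_arr (Tensor L 2) [f i, g i]) [0..<n])
      = on_arr (Tensor L 2) [on_arr S (map f [0..<n]), on_arr S (map g [0..<n])] \<cdot>\<^bsub>Cat L\<^esub> \<gamma>2 a b"
    and \<gamma>3_hom: "(\<And>i. i < n \<Longrightarrow> a i \<in> Obj (Cat L)) \<Longrightarrow>
      \<gamma>3 a \<in> hom (Cat L) (on_obj S (map (\<lambda>i. on_obj (Tensor L 3) [a i, a i, a i]) [0..<n]))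
        (on_obj (Tensor L 3) [on_obj S (map a [0..<n]), on_obj S (map a [0..<n]), on_obj S (map a [0..<n])])"
    and \<gamma>3_Assoc_21: "(\<And>i. i < n \<Longrightarrow> a i \<in> Obj (Cat L)) \<Longrightarrow>
      Assoc L [2, 1] [[on_obj S (map a [0..<n]), on_obj S (map a [0..<n])], [on_obj S (map a [0..<n])]]
        \<cdot>\<^bsub>Cat L\<^esub> on_arr (Tensor L 2) [\<gamma>2 a a, \<gamma>1 a]
        \<cdot>\<^bsub>Cat L\<^esub> \<gamma>2 (\<lambda>i. on_obj (Tensor L 2) [a i, a i]) (\<lambda>i. on_obj (Tensor L 1) [a i])
      = \<gamma>3 a \<cdot>\<^bsub>Cat L\<^esub> on_arr S (map (\<lambda>i. Assoc L [2, 1] [[a i, a i], [a i]]) [0..<n])"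
    and \<gamma>3_Assoc_12: "(\<And>i. i < n \<Longrightarrow> a i \<in> Obj (Cat L)) \<Longrightarrow>
      Assoc L [1, 2] [[on_obj S (map a [0..<n])], [on_obj S (map a [0..<n]), on_obj S (map a [0..<n])]]
        \<cdot>\<^bsub>Cat L\<^esub> on_arr (Tensor L 2) [\<gamma>1 a, \<gamma>2 a a]
        \<cdot>\<^bsub>Cat L\<^esub> \<gamma>2 (\<lambda>i. on_obj (Tensor L 1) [a i]) (\<lambda>i. on_obj (Tensor L 2) [a i, a i])
      = \<gamma>3 a \<cdot>\<^bsub>Cat L\<^esub> on_arr S (map (\<lambda>i. Assoc L [1, 2] [[a i], [a i, a i]]) [0..<n])"
begin

sublocale L: listed_lax_monoidal L by (rule lax_monoidal_listed[OF lax])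
sublocale C: category "Cat L" by (rule L.Cat)

text \<open>
  Both sides of the coassociativity equation are rewritten to \<open>\<gamma>3 a\<close> after the image under \<open>S\<close> of the
  corresponding side for the \<open>\<delta> i\<close>. The unit component of the image object is replaced by
  \<open>\<gamma>1 a \<cdot> S(\<iota>)\<close>, so that it factors in the same way as the comultiplication.
\<close>

lemma cosemigroup_image:
  assumes cs: "\<And>i. i < n \<Longrightarrow> cosemigroup L (a i) (\<delta> i)"
  shows "cosemigroup L (on_obj S (map a [0..<n])) (\<gamma>2 a a \<cdot>\<^bsub>Cat L\<^esub> on_arr S (map \<delta> [0..<n]))"
proof -
  let ?C = "Cat L" and ?I = "[0..<n]"
  let ?T1 = "\<lambda>x. on_obj (Tensor L 1) [x]" and ?T2 = "\<lambda>x y. on_obj (Tensor L 2) [x, y]"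
  let ?T2a = "\<lambda>f g. on_arr (Tensor L 2) [f, g]"
  let ?O = "\<lambda>a. on_obj S (map a ?I)" and ?S = "\<lambda>f. on_arr S (map f ?I)"
  let ?\<iota> = "\<lambda>i. Unit L (a i)" and ?a2 = "\<lambda>i. ?T2 (a i) (a i)" and ?a1 = "\<lambda>i. ?T1 (a i)"
  let ?D = "\<gamma>2 a a \<cdot>\<^bsub>?C\<^esub> ?S \<delta>"
  have a: "i < n \<Longrightarrow> a i \<in> Obj ?C" and \<delta>: "i < n \<Longrightarrow> \<delta> i \<in> hom ?C (a i) (?a2 i)" for i
    using cs by (auto simp: cosemigroup_def)
  have \<iota>: "i < n \<Longrightarrow> ?\<iota> i \<in> hom ?C (a i) (?a1 i)" for i using a by (intro L.Unit_hom1)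
  have a1: "i < n \<Longrightarrow> ?a1 i \<in> Obj ?C" for i
    using C.Cod_Obj \<iota> by (fastforce simp: hom_def)
  have a2: "i < n \<Longrightarrow> ?a2 i \<in> Obj ?C" for i
    using C.Cod_Obj \<delta> by (fastforce simp: hom_def)
  have g2: "\<gamma>2 a a \<in> hom ?C (?O ?a2) (?T2 (?O a) (?O a))" by (rule \<gamma>2_hom[OF a a])
  have g1: "\<gamma>1 a \<in> hom ?C (?O ?a1) (?T1 (?O a))" by (rule \<gamma>1_hom[OF a])
  have Sd: "?S \<delta> \<in> hom ?C (?O a) (?O ?a2)" by (rule S_hom[OF \<delta>])
  have Si: "?S ?\<iota> \<in> hom ?C (?O a) (?O ?a1)" by (rule S_hom[OF \<iota>])
  have D: "?D \<in> hom ?C (?O a) (?T2 (?O a) (?O a))" by (rule C.Comp_hom[OF Sd g2])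
  have Oa: "?O a \<in> Obj ?C" by (rule S_Obj[OF a])
  note A = L.Assoc_21_12_hom[OF Oa Oa Oa]
  note Ai = L.Assoc_21_12_hom[OF a a a]
  let ?e = "\<lambda>i. ?T2a (\<delta> i) (?\<iota> i)" and ?e' = "\<lambda>i. ?T2a (?\<iota> i) (\<delta> i)"
  have e: "i < n \<Longrightarrow> ?e i \<in> hom ?C (?a2 i) (?T2 (?a2 i) (?a1 i))"
    and e': "i < n \<Longrightarrow> ?e' i \<in> hom ?C (?a2 i) (?T2 (?a1 i) (?a2 i))" for i
    using \<delta> \<iota> by (auto intro: L.ten2_hom)
  let ?\<phi> = "\<lambda>i. Assoc L [2, 1] [[a i, a i], [a i]]" and ?\<phi>' = "\<lambda>i. Assoc L [1, 2] [[a i], [a i, a i]]"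
  have K: "\<gamma>3 a \<in> hom ?C (?O (\<lambda>i. on_obj (Tensor L 3) [a i, a i, a i])) (on_obj (Tensor L 3) [?O a, ?O a, ?O a])"
    by (rule \<gamma>3_hom[OF a])
  have u: "\<gamma>1 a \<cdot>\<^bsub>?C\<^esub> ?S ?\<iota> = Unit L (?O a)" by (rule \<gamma>1_Unit[OF a])
  have Se: "?S ?e \<in> hom ?C (?O ?a2) (?O (\<lambda>i. ?T2 (?a2 i) (?a1 i)))" by (rule S_hom[OF e])
  have Se': "?S ?e' \<in> hom ?C (?O ?a2) (?O (\<lambda>i. ?T2 (?a1 i) (?a2 i)))" by (rule S_hom[OF e'])
  have S\<phi>: "?S ?\<phi> \<in> hom ?C (?O (\<lambda>i. ?T2 (?a2 i) (?a1 i))) (?O (\<lambda>i. on_obj (Tensor L 3) [a i, a i, a i]))"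
    by (rule S_hom[OF Ai(1)])
  have S\<phi>': "?S ?\<phi>' \<in> hom ?C (?O (\<lambda>i. ?T2 (?a1 i) (?a2 i))) (?O (\<lambda>i. on_obj (Tensor L 3) [a i, a i, a i]))"
    by (rule S_hom[OF Ai(2)])
  have H: "\<gamma>2 ?a2 ?a1 \<in> hom ?C (?O (\<lambda>i. ?T2 (?a2 i) (?a1 i))) (?T2 (?O ?a2) (?O ?a1))"
    by (rule \<gamma>2_hom[OF a2 a1])
  have H': "\<gamma>2 ?a1 ?a2 \<in> hom ?C (?O (\<lambda>i. ?T2 (?a1 i) (?a2 i))) (?T2 (?O ?a1) (?O ?a2))"
    by (rule \<gamma>2_hom[OF a1 a2])
  have nat: "?T2a (?S \<delta>) (?S ?\<iota>) \<cdot>\<^bsub>?C\<^esub> \<gamma>2 a a = \<gamma>2 ?a2 ?a1 \<cdot>\<^bsub>?C\<^esub> ?S ?e"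
    by (rule \<gamma>2_nat[OF \<delta> \<iota>, symmetric])
  have nat': "?T2a (?S ?\<iota>) (?S \<delta>) \<cdot>\<^bsub>?C\<^esub> \<gamma>2 a a = \<gamma>2 ?a1 ?a2 \<cdot>\<^bsub>?C\<^esub> ?S ?e'"
    by (rule \<gamma>2_nat[OF \<iota> \<delta>, symmetric])
  have "Assoc L [2, 1] [[?O a, ?O a], [?O a]] \<cdot>\<^bsub>?C\<^esub> ?T2a ?D (Unit L (?O a)) \<cdot>\<^bsub>?C\<^esub> ?D
      = \<gamma>3 a \<cdot>\<^bsub>?C\<^esub> (?S ?\<phi> \<cdot>\<^bsub>?C\<^esub> ?S ?e \<cdot>\<^bsub>?C\<^esub> ?S \<delta>)"
    unfolding u[symmetric] L.ten2_Comp[OF Sd Si g2 g1]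
    by (rule C.Comp_chain[OF Sd g2 L.ten2_hom[OF Sd Si] L.ten2_hom[OF g2 g1] A(1) Se H S\<phi> K nat
      \<gamma>3_Assoc_21[OF a]])
  also have "?S ?\<phi> \<cdot>\<^bsub>?C\<^esub> ?S ?e \<cdot>\<^bsub>?C\<^esub> ?S \<delta> = ?S (\<lambda>i. ?\<phi> i \<cdot>\<^bsub>?C\<^esub> ?e i \<cdot>\<^bsub>?C\<^esub> \<delta> i)"
    using S_Comp[OF e Ai(1)] S_Comp[OF \<delta> C.Comp_hom[OF e Ai(1)]] by simp
  also have "\<dots> = ?S (\<lambda>i. ?\<phi>' i \<cdot>\<^bsub>?C\<^esub> ?e' i \<cdot>\<^bsub>?C\<^esub> \<delta> i)"
    using cs by (intro arg_cong[of _ _ "on_arr S"]) (auto simp: cosemigroup_def)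
  also have "\<dots> = ?S ?\<phi>' \<cdot>\<^bsub>?C\<^esub> ?S ?e' \<cdot>\<^bsub>?C\<^esub> ?S \<delta>"
    using S_Comp[OF e' Ai(2)] S_Comp[OF \<delta> C.Comp_hom[OF e' Ai(2)]] by simp
  also have "\<gamma>3 a \<cdot>\<^bsub>?C\<^esub> (?S ?\<phi>' \<cdot>\<^bsub>?C\<^esub> ?S ?e' \<cdot>\<^bsub>?C\<^esub> ?S \<delta>)
      = Assoc L [1, 2] [[?O a], [?O a, ?O a]] \<cdot>\<^bsub>?C\<^esub> ?T2a (Unit L (?O a)) ?D \<cdot>\<^bsub>?C\<^esub> ?D"
    unfolding u[symmetric] L.ten2_Comp[OF Si Sd g1 g2]
    by (rule C.Comp_chain[OF Sd g2 L.ten2_hom[OF Si Sd] L.ten2_hom[OF g1 g2] A(2) Se' H' S\<phi>' K nat'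
      \<gamma>3_Assoc_12[OF a], symmetric])
  finally show ?thesis using D Oa by (simp add: cosemigroup_def)
qed

lemma cosemigroup_hom_image:
  assumes f: "\<And>i. i < n \<Longrightarrow> f i \<in> hom (Cat L) (a i) (b i)"
    and a: "\<And>i. i < n \<Longrightarrow> cosemigroup L (a i) (\<delta> i)" and b: "\<And>i. i < n \<Longrightarrow> cosemigroup L (b i) (\<epsilon> i)"
    and comm: "\<And>i. i < n \<Longrightarrow> \<epsilon> i \<cdot>\<^bsub>Cat L\<^esub> f i = on_arr (Tensor L 2) [f i, f i] \<cdot>\<^bsub>Cat L\<^esub> \<delta> i"
  shows "\<gamma>2 b b \<cdot>\<^bsub>Cat L\<^esub> on_arr S (map \<epsilon> [0..<n]) \<cdot>\<^bsub>Cat L\<^esub> on_arr S (map f [0..<n])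
    = on_arr (Tensor L 2) [on_arr S (map f [0..<n]), on_arr S (map f [0..<n])]
      \<cdot>\<^bsub>Cat L\<^esub> (\<gamma>2 a a \<cdot>\<^bsub>Cat L\<^esub> on_arr S (map \<delta> [0..<n]))"
proof -
  let ?C = "Cat L" and ?S = "\<lambda>f. on_arr S (map f [0..<n])"
  have ao: "i < n \<Longrightarrow> a i \<in> Obj ?C" and \<delta>: "i < n \<Longrightarrow> \<delta> i \<in> hom ?C (a i) (on_obj (Tensor L 2) [a i, a i])"
    and bo: "i < n \<Longrightarrow> b i \<in> Obj ?C" and \<epsilon>: "i < n \<Longrightarrow> \<epsilon> i \<in> hom ?C (b i) (on_obj (Tensor L 2) [b i, b i])" for i
    using a b by (auto simp: cosemigroup_def)
  note ga = \<gamma>2_hom[OF ao ao] and gb = \<gamma>2_hom[OF bo bo]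
  have ff: "i < n \<Longrightarrow> on_arr (Tensor L 2) [f i, f i]
      \<in> hom ?C (on_obj (Tensor L 2) [a i, a i]) (on_obj (Tensor L 2) [b i, b i])" for i
    using f by (intro L.ten2_hom)
  have "\<gamma>2 b b \<cdot>\<^bsub>?C\<^esub> ?S \<epsilon> \<cdot>\<^bsub>?C\<^esub> ?S f = \<gamma>2 b b \<cdot>\<^bsub>?C\<^esub> ?S (\<lambda>i. \<epsilon> i \<cdot>\<^bsub>?C\<^esub> f i)"
    using S_Comp[OF f \<epsilon>] C.Comp_assoc[OF S_hom[OF f] S_hom[OF \<epsilon>] gb] by simp
  also have "?S (\<lambda>i. \<epsilon> i \<cdot>\<^bsub>?C\<^esub> f i) = ?S (\<lambda>i. on_arr (Tensor L 2) [f i, f i] \<cdot>\<^bsub>?C\<^esub> \<delta> i)"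
    using comm by (intro arg_cong[of _ _ "on_arr S"]) auto
  also have "\<dots> = ?S (\<lambda>i. on_arr (Tensor L 2) [f i, f i]) \<cdot>\<^bsub>?C\<^esub> ?S \<delta>"
    by (rule S_Comp[OF \<delta> ff])
  also have "\<gamma>2 b b \<cdot>\<^bsub>?C\<^esub> \<dots> = on_arr (Tensor L 2) [?S f, ?S f] \<cdot>\<^bsub>?C\<^esub> (\<gamma>2 a a \<cdot>\<^bsub>?C\<^esub> ?S \<delta>)"
    by (simp add: C.Comp_assoc[OF S_hom[OF \<delta>] S_hom[OF ff] gb] \<gamma>2_nat[OF f f]
      C.Comp_assoc[OF S_hom[OF \<delta>] ga L.ten2_hom[OF S_hom[OF f] S_hom[OF f]]])
  finally show ?thesis .
qed

end

section \<open>Duality\<close>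

lemma op_cat_simps [simp]:
  "Obj (op_cat C) = Obj C" "Arr (op_cat C) = Arr C" "Dom (op_cat C) = Cod C" "Cod (op_cat C) = Dom C"
  "Ident (op_cat C) = Ident C" "g \<cdot>\<^bsub>op_cat C\<^esub> f = f \<cdot>\<^bsub>C\<^esub> g" "hom (op_cat C) a b = hom C b a"
  by (auto simp: op_cat_def hom_def)

lemma op_moncat_simps [simp]:
  "Cat (op_moncat M) = op_cat (Cat M)" "Tensor (op_moncat M) = Tensor M" "Assoc (op_moncat M) = Assoc M"
  "Unit (op_moncat M) = Unit M" "ten (op_moncat M) = ten M" "ten_arr (op_moncat M) = ten_arr M"
  "asc (op_moncat M) = asc M"
  by (auto simp: op_moncat_def ten_def ten_arr_def asc_def fun_eq_iff)

lemma obj_list_op_cat [simp]: "obj_list (op_cat C) = obj_list C" "obj_lists (op_cat C) = obj_lists C"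
  by (auto simp: obj_list_def obj_lists_def fun_eq_iff)

lemma category_op_cat:
  assumes "category C"
  shows "category (op_cat C)"
proof -
  interpret category C by fact
  show ?thesis
    by (rule category.intro; unfold op_cat_simps)
       (rule Cod_Obj Dom_Obj Ident_hom Comp_hom Comp_Ident Ident_Comp Comp_assoc[symmetric]; assumption)+
qed

text \<open>
  The two coassociativity conditions differ only in the bracketing of the composites.
\<close>

lemma semigroup_in_iff_cosemigroup:
  assumes "oplax_monoidal R"
  shows "semigroup_in R a \<mu> \<longleftrightarrow> cosemigroup (op_moncat R) a \<mu>"
proof (cases "a \<in> Obj (Cat R) \<and> \<mu> \<in> hom (Cat R) (on_obj (Tensor R 2) [a, a]) a")
  case True
  interpret R: listed_lax_monoidal "op_moncat R"
    using assms by (intro lax_monoidal_listed) (simp add: oplax_monoidal_def)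
  interpret C: category "op_cat (Cat R)" using R.Cat by simp
  have a: "a \<in> Obj (Cat (op_moncat R))" and m: "\<mu> \<in> hom (Cat (op_moncat R)) a (on_obj (Tensor R 2) [a, a])"
    using True by auto
  note A = R.Assoc_21_12_hom[OF a a a, unfolded op_moncat_simps]
  note t = R.ten2_hom[OF m R.Unit_hom1[OF a], unfolded op_moncat_simps]
    R.ten2_hom[OF R.Unit_hom1[OF a] m, unfolded op_moncat_simps]
  note m' = m[unfolded op_moncat_simps]
  show ?thesis
    using C.Comp_assoc[OF m' t(1) A(1)] C.Comp_assoc[OF m' t(2) A(2)] True
    unfolding semigroup_in_def cosemigroup_def op_moncat_simps op_cat_simps by metis
qed (auto simp: semigroup_in_def cosemigroup_def)

section \<open>The categories of cosemigroups and of semigroups\<close>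

text \<open>
  Morphisms of cosemigroups, between objects given as pairs. By duality, \<open>f\<close> is a morphism of semigroups
  \<open>X \<rightarrow> Y\<close> in \<open>R\<close> when it is a morphism of cosemigroups \<open>Y \<rightarrow> X\<close> in \<open>op_moncat R\<close>.
\<close>

definition cosemigroup_hom :: "('o, 'a) moncat \<Rightarrow> ('o, 'a) sg_obj \<Rightarrow> ('o, 'a) sg_obj \<Rightarrow> 'a \<Rightarrow> bool" where
  "cosemigroup_hom M X Y f \<longleftrightarrow> cosemigroup M (fst X) (snd X) \<and> cosemigroup M (fst Y) (snd Y) \<and>
     f \<in> hom (Cat M) (fst X) (fst Y) \<and>
     snd Y \<cdot>\<^bsub>Cat M\<^esub> f = on_arr (Tensor M 2) [f, f] \<cdot>\<^bsub>Cat M\<^esub> snd X"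

context listed_lax_monoidal
begin

interpretation C: category "Cat M" by (rule Cat)

lemma cosemigroup_hom_Ident:
  assumes "cosemigroup M (fst X) (snd X)"
  shows "cosemigroup_hom M X X (Ident (Cat M) (fst X))"
proof -
  have a: "fst X \<in> Obj (Cat M)" and d: "snd X \<in> hom (Cat M) (fst X) (on_obj (Tensor M 2) [fst X, fst X])"
    using assms by (auto simp: cosemigroup_def)
  show ?thesis
    using assms C.Ident_hom[OF a] by (simp add: cosemigroup_hom_def ten2_Ident a C.Comp_Ident[OF d] C.Ident_Comp[OF d])
qed

lemma cosemigroup_hom_Comp:
  assumes "cosemigroup_hom M X Y f" "cosemigroup_hom M Y Z g"
  shows "cosemigroup_hom M X Z (g \<cdot>\<^bsub>Cat M\<^esub> f)"
proof -
  have f: "f \<in> hom (Cat M) (fst X) (fst Y)" and g: "g \<in> hom (Cat M) (fst Y) (fst Z)"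
    and x: "snd X \<in> hom (Cat M) (fst X) (on_obj (Tensor M 2) [fst X, fst X])"
    and y: "snd Y \<in> hom (Cat M) (fst Y) (on_obj (Tensor M 2) [fst Y, fst Y])"
    and z: "snd Z \<in> hom (Cat M) (fst Z) (on_obj (Tensor M 2) [fst Z, fst Z])"
    and ef: "snd Y \<cdot>\<^bsub>Cat M\<^esub> f = on_arr (Tensor M 2) [f, f] \<cdot>\<^bsub>Cat M\<^esub> snd X"
    and eg: "snd Z \<cdot>\<^bsub>Cat M\<^esub> g = on_arr (Tensor M 2) [g, g] \<cdot>\<^bsub>Cat M\<^esub> snd Y"
    using assms by (auto simp: cosemigroup_hom_def cosemigroup_def)
  note ff = ten2_hom[OF f f] and gg = ten2_hom[OF g g]
  have "snd Z \<cdot>\<^bsub>Cat M\<^esub> (g \<cdot>\<^bsub>Cat M\<^esub> f) = on_arr (Tensor M 2) [g, g] \<cdot>\<^bsub>Cat M\<^esub> (snd Y \<cdot>\<^bsub>Cat M\<^esub> f)"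
    by (simp only: C.Comp_assoc[OF f g z] C.Comp_assoc[OF f y gg] eg)
  also have "\<dots> = on_arr (Tensor M 2) [g \<cdot>\<^bsub>Cat M\<^esub> f, g \<cdot>\<^bsub>Cat M\<^esub> f] \<cdot>\<^bsub>Cat M\<^esub> snd X"
    by (simp only: ef C.Comp_assoc[OF x ff gg] ten2_Comp[OF f f g g])
  finally show ?thesis
    using assms C.Comp_hom[OF f g] by (simp add: cosemigroup_hom_def)
qed

end

lemma Arr_cosemigroup_cat: "F \<in> Arr (cosemigroup_cat M) \<longleftrightarrow> cosemigroup_hom M (sg_dom F) (sg_cod F) (sg_und F)"
  by (cases F) (auto simp: cosemigroup_cat_def cosemigroup_hom_def)

lemma Arr_semigroup_cat:
  assumes "oplax_monoidal R"
  shows "F \<in> Arr (semigroup_cat R) \<longleftrightarrow> cosemigroup_hom (op_moncat R) (sg_cod F) (sg_dom F) (sg_und F)"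
  by (cases F) (auto simp: semigroup_cat_def cosemigroup_hom_def semigroup_in_iff_cosemigroup[OF assms])

lemma cosemigroup_cat_simps [simp]:
  "X \<in> Obj (cosemigroup_cat M) \<longleftrightarrow> cosemigroup M (fst X) (snd X)"
  "Dom (cosemigroup_cat M) = sg_dom" "Cod (cosemigroup_cat M) = sg_cod"
  "Ident (cosemigroup_cat M) = (\<lambda>X. (X, X, Ident (Cat M) (fst X)))"
  "G \<cdot>\<^bsub>cosemigroup_cat M\<^esub> F = (sg_dom F, sg_cod G, sg_und G \<cdot>\<^bsub>Cat M\<^esub> sg_und F)"
  by (auto simp: cosemigroup_cat_def)

lemma semigroup_cat_simps [simp]:
  "Dom (semigroup_cat R) = sg_dom" "Cod (semigroup_cat R) = sg_cod"
  "Ident (semigroup_cat R) = (\<lambda>X. (X, X, Ident (Cat R) (fst X)))"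
  "G \<cdot>\<^bsub>semigroup_cat R\<^esub> F = (sg_dom F, sg_cod G, sg_und G \<cdot>\<^bsub>Cat R\<^esub> sg_und F)"
  by (auto simp: semigroup_cat_def)

lemma Obj_semigroup_cat:
  "oplax_monoidal R \<Longrightarrow> X \<in> Obj (semigroup_cat R) \<longleftrightarrow> cosemigroup (op_moncat R) (fst X) (snd X)"
  by (auto simp: semigroup_cat_def semigroup_in_iff_cosemigroup)

lemma hom_cosemigroup_cat:
  "F \<in> hom (cosemigroup_cat M) X Y \<longleftrightarrow> (\<exists>f. F = (X, Y, f) \<and> cosemigroup_hom M X Y f)"
  by (cases F) (auto simp: hom_def Arr_cosemigroup_cat)

lemma hom_semigroup_cat:
  "oplax_monoidal R \<Longrightarrow>
    F \<in> hom (semigroup_cat R) X Y \<longleftrightarrow> (\<exists>f. F = (X, Y, f) \<and> cosemigroup_hom (op_moncat R) Y X f)"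
  by (cases F) (auto simp: hom_def Arr_semigroup_cat)

lemma category_cosemigroup_cat:
  assumes "lax_monoidal M"
  shows "category (cosemigroup_cat M)"
proof -
  interpret M: listed_lax_monoidal M by (rule lax_monoidal_listed[OF assms])
  interpret C: category "Cat M" by (rule M.Cat)
  have h: "cosemigroup_hom M X Y f \<Longrightarrow> f \<in> hom (Cat M) (fst X) (fst Y)" for X Y f
    by (simp add: cosemigroup_hom_def)
  show ?thesis
    by (rule category.intro)
      (auto simp: Arr_cosemigroup_cat hom_cosemigroup_cat intro: M.cosemigroup_hom_Ident M.cosemigroup_hom_Comp
        C.Comp_Ident[OF h] C.Ident_Comp[OF h] C.Comp_assoc[OF h h h], auto simp: cosemigroup_hom_def intro: C.Comp_Ident C.Ident_Comp)
qed

lemma category_semigroup_cat: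
  assumes "oplax_monoidal R"
  shows "category (semigroup_cat R)"
proof -
  let ?R = "op_moncat R"
  interpret R: listed_lax_monoidal ?R
    using assms by (intro lax_monoidal_listed) (simp add: oplax_monoidal_def)
  interpret C: category "Cat ?R" by (rule R.Cat)
  have h: "cosemigroup_hom ?R X Y f \<Longrightarrow> f \<in> hom (Cat ?R) (fst X) (fst Y)" for X Y f
    by (simp add: cosemigroup_hom_def)
  note i = R.cosemigroup_hom_Ident[simplified] R.cosemigroup_hom_Comp[simplified]
    C.Comp_Ident[OF h, simplified] C.Ident_Comp[OF h, simplified] C.Comp_assoc[OF h h h, symmetric, simplified]
  show ?thesis
    by (rule category.intro)
      (auto simp: Arr_semigroup_cat[OF assms] hom_semigroup_cat[OF assms] Obj_semigroup_cat[OF assms] intro: i,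
        auto simp: cosemigroup_hom_def intro: C.Comp_Ident[simplified] C.Ident_Comp[simplified])
qed

section \<open>The structure of a duoidal category in terms of lists\<close>

lemma lax_power_simps:
  "Cat (lax_power L n) = power_cat (Cat L) n"
  "on_obj (Tensor (lax_power L n) p) xss = map (\<lambda>i. on_obj (Tensor L p) (map (\<lambda>x. x ! i) xss)) [0..<n]"
  "on_arr (Tensor (lax_power L n) p) fss = map (\<lambda>i. on_arr (Tensor L p) (map (\<lambda>x. x ! i) fss)) [0..<n]"
  "Assoc (lax_power L n) ks xsss = map (\<lambda>i. Assoc L ks (map (map (\<lambda>x. x ! i)) xsss)) [0..<n]"
  "Unit (lax_power L n) xs = map (\<lambda>i. Unit L (xs ! i)) [0..<n]"
  by (simp_all add: lax_power_def lax_prod_def power_cat_def)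

lemma hom_Dom_Cod: "f \<in> hom C a b \<Longrightarrow> f \<in> Arr C \<and> Dom C f = a \<and> Cod C f = b"
  by (simp add: hom_def)

context duoidal
begin

sublocale L: listed_lax_monoidal L by (rule lax_monoidal_listed[OF lax])
sublocale R: listed_lax_monoidal "op_moncat R"
  using oplax by (intro lax_monoidal_listed) (simp add: oplax_monoidal_def)
sublocale C: category "Cat L" by (rule L.Cat)

abbreviation "C \<equiv> Cat L"
abbreviation "S n \<equiv> on_obj (Tensor R n)"
abbreviation "Sa n \<equiv> on_arr (Tensor R n)"
abbreviation "T n \<equiv> on_obj (Tensor L n)"
abbreviation "Ta n \<equiv> on_arr (Tensor L n)"

lemma xi_lax_functor:
  assumes "n \<ge> 1" "p \<ge> 1"
  shows "nat_trans (power_cat (power_cat C n) p) C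
    (fun_comp (Tensor R n) (Tensor (lax_power L n) p))
    (fun_comp (Tensor L p) (fun_power (Tensor R n) p)) (xi n p)"
  using lax_functor.Lax_nat_trans[OF circ_lax_functor[OF assms(1)] assms(2)]
  by (simp add: circ_lax_def lax_power_simps)

lemma fun_power_on:
  "on_obj (fun_power F p) (map x [0..<p]) = map (\<lambda>j. on_obj F (x j)) [0..<p]"
  "on_arr (fun_power F p) (map f [0..<p]) = map (\<lambda>j. on_arr F (f j)) [0..<p]"
  by (simp_all add: fun_power_def fun_prod_def)

lemma rows:
  "map (\<lambda>i. F (map (\<lambda>j. map (\<lambda>i. a i j) [0..<n] ! i) [0..<p])) [0..<n] = map (\<lambda>i. F (map (a i) [0..<p])) [0..<n]"
  by auto

lemma xi_hom_cols:
  assumes "n \<ge> 1" "p \<ge> 1" "length cols = p" "\<forall>xs \<in> set cols. length xs = n \<and> set xs \<subseteq> Obj C"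
  shows "xi n p cols \<in> hom C (S n (map (\<lambda>i. T p (map (\<lambda>x. x ! i) cols)) [0..<n])) (T p (map (S n) cols))"
proof -
  have o: "cols \<in> Obj (power_cat (power_cat C n) p)"
    using assms(3,4) by (auto simp: Obj_power_cat subset_iff)
  have "on_obj (fun_power (Tensor R n) p) cols = map (S n) cols"
    using assms(3) by (auto simp: fun_power_def fun_prod_def intro!: nth_equalityI)
  then show ?thesis
    using nat_trans.component_hom[OF xi_lax_functor[OF assms(1,2)] o]
    by (simp add: fun_comp_def lax_power_simps)
qed

text \<open>
  Naturality of \<open>\<xi>\<close>, with the entry in row \<open>i\<close> and column \<open>j\<close> of the matrix of arrows written \<open>f i j\<close>.
\<close>

lemma xi_nat:
  assumes "n \<ge> 1" "p \<ge> 1" and f: "\<And>i j. i < n \<Longrightarrow> j < p \<Longrightarrow> f i j \<in> hom C (a i j) (b i j)"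
  shows "xi n p (map (\<lambda>j. map (\<lambda>i. b i j) [0..<n]) [0..<p])
      \<cdot>\<^bsub>C\<^esub> Sa n (map (\<lambda>i. Ta p (map (f i) [0..<p])) [0..<n])
    = Ta p (map (\<lambda>j. Sa n (map (\<lambda>i. f i j) [0..<n])) [0..<p])
      \<cdot>\<^bsub>C\<^esub> xi n p (map (\<lambda>j. map (\<lambda>i. a i j) [0..<n]) [0..<p])"
proof -
  have o: "map (\<lambda>j. map (\<lambda>i. f i j) [0..<n]) [0..<p] \<in> hom (power_cat (power_cat C n) p)
      (map (\<lambda>j. map (\<lambda>i. a i j) [0..<n]) [0..<p]) (map (\<lambda>j. map (\<lambda>i. b i j) [0..<n]) [0..<p])"
  proof -
    have "map (\<lambda>i. f i j) [0..<n] \<in> hom (power_cat C n) (map (\<lambda>i. a i j) [0..<n]) (map (\<lambda>i. b i j) [0..<n])"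
      if "j < p" for j using hom_Dom_Cod[OF f] that by (auto simp: hom_power_cat)
    note h = hom_Dom_Cod[OF this]
    show ?thesis unfolding hom_power_cat[of _ "power_cat C n"] using h by auto
  qed
  show ?thesis
    using nat_trans.naturality[OF xi_lax_functor[OF assms(1,2)] o]
    by (simp add: fun_comp_def lax_power_simps fun_power_on o_def rows)
qed

lemma xi_Unit:
  assumes "n \<ge> 1" "\<And>i. i < n \<Longrightarrow> a i \<in> Obj C"
  shows "xi n 1 [map a [0..<n]] \<cdot>\<^bsub>C\<^esub> Sa n (map (\<lambda>i. Unit L (a i)) [0..<n]) = Unit L (S n (map a [0..<n]))"
proof -
  have "map a [0..<n] \<in> Obj (Cat (lax_power L n))"
    using assms(2) by (auto simp: lax_power_simps Obj_power_cat)
  from lax_functor.Lax_Unit[OF circ_lax_functor[OF assms(1)] this]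
  moreover have "map (\<lambda>i. Unit L (map a [0..<n] ! i)) [0..<n] = map (\<lambda>i. Unit L (a i)) [0..<n]" by auto
  ultimately show ?thesis by (simp add: circ_lax_def lax_power_simps)
qed

text \<open>
  Compatibility of \<open>\<xi>\<close> with \<open>\<Phi>\<close>: the columns of a matrix with \<open>n\<close> rows are grouped into the blocks
  \<open>Xss\<close>.
\<close>

lemma xi_asc:
  assumes "n \<ge> 1" "Xss \<noteq> []" "[] \<notin> set Xss"
    and X: "\<forall>cols \<in> set Xss. \<forall>col \<in> set cols. length col = n \<and> set col \<subseteq> Obj C"
  shows "xi n (length (concat Xss)) (concat Xss)
      \<cdot>\<^bsub>C\<^esub> Sa n (map (\<lambda>i. asc L (map (map (\<lambda>x. x ! i)) Xss)) [0..<n])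
    = asc L (map (map (S n)) Xss)
      \<cdot>\<^bsub>C\<^esub> ten_arr L (map (\<lambda>cols. xi n (length cols) cols) Xss)
      \<cdot>\<^bsub>C\<^esub> xi n (length Xss) (map (\<lambda>cols. map (\<lambda>i. T (length cols) (map (\<lambda>x. x ! i) cols)) [0..<n]) Xss)"
proof -
  let ?k = "map length Xss"
  have p: "pos_list ?k" by (rule pos_list_map_length[OF assms(2,3)])
  have o: "Xss \<in> Obj (prod_cat (map (power_cat (Cat (lax_power L n))) ?k))"
    using X by (auto simp: Obj_prod_power lax_power_simps Obj_power_cat subset_iff simp del: map_map)
  have 1: "on_obj (fun_prod (map (Tensor (lax_power L n)) ?k)) Xss
      = map (\<lambda>cols. map (\<lambda>i. T (length cols) (map (\<lambda>x. x ! i) cols)) [0..<n]) Xss"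
    by (auto simp: fun_prod_def lax_power_simps intro!: nth_equalityI)
  have 2: "map (\<lambda>i. xi n (?k ! i) (Xss ! i)) [0..<length ?k] = map (\<lambda>cols. xi n (length cols) cols) Xss"
    by (auto intro!: nth_equalityI)
  show ?thesis
    using lax_functor.Lax_Assoc[OF circ_lax_functor[OF assms(1)] p o] unfolding 1
    by (simp add: circ_lax_def lax_power_simps 2[simplified] asc_def ten_arr_def length_concat o_def)
qed


lemma Sa_Ident:
  assumes "n \<ge> 1" "length xs = n" "set xs \<subseteq> Obj C"
  shows "Sa n (Ident (Cat (lax_power L n)) xs) = Ident C (S n xs)"
proof -
  have "obj_list C xs" using assms by (auto simp: obj_list_def)
  then show ?thesis
    using R.ten_Ident[of xs] assms(2) same_Cat by (simp add: lax_power_simps Ident_power_cat ten_def ten_arr_def)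
qed

lemma T_Obj: "p \<ge> 1 \<Longrightarrow> length xs = p \<Longrightarrow> set xs \<subseteq> Obj C \<Longrightarrow> T p xs \<in> Obj C"
  using L.ten_Obj[of xs] by (cases xs) (auto simp: obj_list_def ten_def)

text \<open>
  The composite of \<open>\<circ>\<^sub>n\<close> with an identification of power categories has \<open>\<xi>\<close> after an image of identities as
  its structure, which is just \<open>\<xi>\<close>.
\<close>

lemma xi_Comp_Ident:
  assumes "n \<ge> 1" "p \<ge> 1" "length cols = p" "\<forall>xs \<in> set cols. length xs = n \<and> set xs \<subseteq> Obj C"
  shows "xi n p cols \<cdot>\<^bsub>C\<^esub> Sa n (Ident (Cat (lax_power L n)) (on_obj (Tensor (lax_power L n) p) cols)) = xi n p cols"
proof -
  let ?y = "map (\<lambda>i. T p (map (\<lambda>x. x ! i) cols)) [0..<n]"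
  have "T p (map (\<lambda>x. x ! i) cols) \<in> Obj C" if "i < n" for i
  proof (rule T_Obj[OF assms(2)])
    show "set (map (\<lambda>x. x ! i) cols) \<subseteq> Obj C" using assms(4) that by (auto simp: subset_iff)
  qed (simp add: assms(3))
  then have y: "set ?y \<subseteq> Obj C" by auto
  show ?thesis
    using C.Comp_Ident[OF xi_hom_cols[OF assms]] by (simp add: lax_power_simps(2) Sa_Ident[OF assms(1) _ y])
qed

text \<open>The monoidality of \<open>\<upsilon>\<close>, in terms of \<open>\<xi>\<close>.\<close>

lemma upsilon_xi:
  assumes p: "p \<ge> 1" and xs: "length xs = p" "set xs \<subseteq> Obj C"
  shows "Unit R (T p xs) = Ta p (map (Unit R) xs) \<cdot>\<^bsub>C\<^esub> xi 1 p (map (\<lambda>x. [x]) xs)"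
proof -
  let ?m = "map (\<lambda>x. [x]) xs"
  have o: "xs \<in> Obj (power_cat C p)" using xs by (simp add: Obj_power_cat)
  have u: "Unit R (T p xs) \<in> hom C (S 1 [T p xs]) (T p xs)"
    using R.Unit_hom1[of "T p xs"] T_Obj[OF p xs] same_Cat by simp
  have x: "xi 1 p ?m \<cdot>\<^bsub>C\<^esub> Sa 1 (Ident (Cat (lax_power L 1)) (on_obj (Tensor (lax_power L 1) p) ?m)) = xi 1 p ?m"
    using xs p by (intro xi_Comp_Ident) auto
  have "Ident C (T p xs) \<cdot>\<^bsub>C\<^esub> Unit R (T p xs)
      = Ta p (map (Unit R) xs) \<cdot>\<^bsub>C\<^esub> (xi 1 p ?m
        \<cdot>\<^bsub>C\<^esub> Sa 1 (Ident (Cat (lax_power L 1)) (on_obj (Tensor (lax_power L 1) p) ?m)))"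
    using lax_nat_trans.Lax_component[OF upsilon_lax_nat_trans p o]
    by (simp add: lax_strict_def lax_comp_def fun_id_def fun_single_def circ_lax_def)
  then show ?thesis by (simp only: x C.Ident_Comp[OF u])
qed

text \<open>
  The monoidality of \<open>\<Psi>\<close>, in terms of \<open>\<xi>\<close>: here the rows of a matrix are grouped into blocks. It is given
  by the list \<open>X\<close> of its \<open>p\<close> columns, each of them split into lists with the lengths \<open>ks\<close>.
\<close>

lemma Psi_xi:
  assumes "p \<ge> 1" "ks \<noteq> []" "\<forall>k \<in> set ks. k \<ge> 1"
    and X: "\<forall>xss \<in> set X. map length xss = ks \<and> (\<forall>xs \<in> set xss. set xs \<subseteq> Obj C)"
    and p: "length X = p"
  shows "xi (length ks) p (map (map (ten R)) X)
      \<cdot>\<^bsub>C\<^esub> Sa (length ks) (map (\<lambda>i. xi (ks ! i) p (map (\<lambda>x. x ! i) X)) [0..<length ks])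
      \<cdot>\<^bsub>C\<^esub> Assoc R ks (map (\<lambda>i. map (\<lambda>j. T p (map (\<lambda>x. x ! i ! j) X)) [0..<ks ! i]) [0..<length ks])
    = Ta p (map (Assoc R ks) X) \<cdot>\<^bsub>C\<^esub> xi (sum_list ks) p (map concat X)"
proof -
  let ?P = "lax_prod (map (lax_power L) ks)"
  have k: "pos_list ks" using assms by (simp add: pos_list_def)
  have K: "sum_list ks \<ge> 1" using assms(2,3) by (cases ks) auto
  have Cat: "Cat ?P = prod_cat (map (power_cat C) ks)"
    by (simp add: lax_prod_def o_def lax_power_simps)
  have o: "X \<in> Obj (power_cat (Cat ?P) p)"
    unfolding Cat Obj_power_cat using X p by (auto simp: Obj_prod_power)
  have ten: "on_obj (Tensor ?P p) X = map (\<lambda>i. map (\<lambda>j. T p (map (\<lambda>x. x ! i ! j) X)) [0..<ks ! i]) [0..<length ks]"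
    by (simp add: lax_prod_def lax_power_simps o_def)
  have S: "map (on_obj (fun_prod (map Fun (map (circ_lax R xi) ks)))) X = map (map (ten R)) X"
    using X fun_prod_Tensor(1)[of _ ks R] by (simp add: circ_lax_def o_def)
  have l: "map (\<lambda>i. Lax (map (circ_lax R xi) ks ! i) p (map (\<lambda>x. x ! i) X)) [0..<length ks]
      = map (\<lambda>i. xi (ks ! i) p (map (\<lambda>x. x ! i) X)) [0..<length ks]"
    by (auto simp: circ_lax_def)
  have x: "xi (sum_list ks) p (map concat X) \<cdot>\<^bsub>C\<^esub> Sa (sum_list ks)
      (Ident (Cat (lax_power L (sum_list ks))) (on_obj (Tensor (lax_power L (sum_list ks)) p) (map concat X)))
      = xi (sum_list ks) p (map concat X)"
    using assms(1) K X p by (intro xi_Comp_Ident) (fastforce simp: length_concat)+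
  have "xi (length ks) p (map (map (ten R)) X)
      \<cdot>\<^bsub>C\<^esub> Sa (length ks) (map (\<lambda>i. xi (ks ! i) p (map (\<lambda>x. x ! i) X)) [0..<length ks])
      \<cdot>\<^bsub>C\<^esub> Assoc R ks (on_obj (Tensor ?P p) X)
    = Ta p (map (Assoc R ks) X) \<cdot>\<^bsub>C\<^esub> (xi (sum_list ks) p (map concat X) \<cdot>\<^bsub>C\<^esub> Sa (sum_list ks)
      (Ident (Cat (lax_power L (sum_list ks))) (on_obj (Tensor (lax_power L (sum_list ks)) p) (map concat X))))"
    using lax_nat_trans.Lax_component[OF Psi_lax_nat_trans[OF k] assms(1) o]
    unfolding lax_comp_def lax_fun_prod_def lax_fun_data.simps S
    by (simp add: lax_strict_def fun_concat_def circ_lax_def l)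
  then show ?thesis by (simp only: x ten)
qed


lemma columns:
  "map (\<lambda>i. F [map a [0..<n] ! i]) [0..<n] = map (\<lambda>i. F [a i]) [0..<n]"
  "map (\<lambda>i. F [map a [0..<n] ! i, map b [0..<n] ! i]) [0..<n] = map (\<lambda>i. F [a i, b i]) [0..<n]"
  "map (\<lambda>i. F [map a [0..<n] ! i, map b [0..<n] ! i, map c [0..<n] ! i]) [0..<n] = map (\<lambda>i. F [a i, b i, c i]) [0..<n]"
  "map (\<lambda>i. G [[map a [0..<n] ! i, map b [0..<n] ! i], [map c [0..<n] ! i]]) [0..<n]
    = map (\<lambda>i. G [[a i, b i], [c i]]) [0..<n]"
  "map (\<lambda>i. G [[map a [0..<n] ! i], [map b [0..<n] ! i, map c [0..<n] ! i]]) [0..<n]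
    = map (\<lambda>i. G [[a i], [b i, c i]]) [0..<n]"
  by auto

lemma upt_2: "[0..<2] = [0, 1]" "[0..<3] = [0, 1, 2]" "[0..<1] = [0::nat]"
  by (simp_all add: numeral_2_eq_2 numeral_3_eq_3)

text \<open>The instance for cosemigroups: matrices with at most three columns.\<close>

lemma circ_power_functor:
  assumes n: "n \<ge> 1"
  shows "power_functor L n (Tensor R n) (\<lambda>a. xi n 1 [map a [0..<n]])
    (\<lambda>a b. xi n 2 [map a [0..<n], map b [0..<n]]) (\<lambda>a. xi n 3 [map a [0..<n], map a [0..<n], map a [0..<n]])"
proof (rule power_functor.intro)
  have ne: "[0..<n] \<noteq> []" using n by simp
  show "lax_monoidal L" by (rule lax)
  {
    fix a assume a: "\<And>i. i < n \<Longrightarrow> a i \<in> Obj C"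
    show "S n (map a [0..<n]) \<in> Obj C"
      using R.ten_Obj[of "map a [0..<n]"] a ne by (auto simp: obj_list_def ten_def same_Cat image_subset_iff)
    show "xi n 1 [map a [0..<n]] \<in> hom C (S n (map (\<lambda>i. T 1 [a i]) [0..<n])) (T 1 [S n (map a [0..<n])])"
      using xi_hom_cols[of n 1 "[map a [0..<n]]"] n a by (auto simp: image_subset_iff columns)
    show "xi n 1 [map a [0..<n]] \<cdot>\<^bsub>C\<^esub> Sa n (map (\<lambda>i. Unit L (a i)) [0..<n]) = Unit L (S n (map a [0..<n]))"
      by (rule xi_Unit[OF n a])
    show "xi n 3 [map a [0..<n], map a [0..<n], map a [0..<n]]
      \<in> hom C (S n (map (\<lambda>i. T 3 [a i, a i, a i]) [0..<n]))
        (T 3 [S n (map a [0..<n]), S n (map a [0..<n]), S n (map a [0..<n])])"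
      using xi_hom_cols[of n 3 "[map a [0..<n], map a [0..<n], map a [0..<n]]"] n a by (auto simp: image_subset_iff columns)
    show "Assoc L [2, 1] [[S n (map a [0..<n]), S n (map a [0..<n])], [S n (map a [0..<n])]]
        \<cdot>\<^bsub>C\<^esub> Ta 2 [xi n 2 [map a [0..<n], map a [0..<n]], xi n 1 [map a [0..<n]]]
        \<cdot>\<^bsub>C\<^esub> xi n 2 [map (\<lambda>i. T 2 [a i, a i]) [0..<n], map (\<lambda>i. T 1 [a i]) [0..<n]]
      = xi n 3 [map a [0..<n], map a [0..<n], map a [0..<n]]
        \<cdot>\<^bsub>C\<^esub> Sa n (map (\<lambda>i. Assoc L [2, 1] [[a i, a i], [a i]]) [0..<n])"
      using xi_asc[of n "[[map a [0..<n], map a [0..<n]], [map a [0..<n]]]"] n a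
      by (auto simp: image_subset_iff columns asc_def ten_arr_def numeral_2_eq_2 numeral_3_eq_3)
    show "Assoc L [1, 2] [[S n (map a [0..<n])], [S n (map a [0..<n]), S n (map a [0..<n])]]
        \<cdot>\<^bsub>C\<^esub> Ta 2 [xi n 1 [map a [0..<n]], xi n 2 [map a [0..<n], map a [0..<n]]]
        \<cdot>\<^bsub>C\<^esub> xi n 2 [map (\<lambda>i. T 1 [a i]) [0..<n], map (\<lambda>i. T 2 [a i, a i]) [0..<n]]
      = xi n 3 [map a [0..<n], map a [0..<n], map a [0..<n]]
        \<cdot>\<^bsub>C\<^esub> Sa n (map (\<lambda>i. Assoc L [1, 2] [[a i], [a i, a i]]) [0..<n])"
      using xi_asc[of n "[[map a [0..<n]], [map a [0..<n], map a [0..<n]]]"] n a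
      by (auto simp: image_subset_iff columns asc_def ten_arr_def numeral_2_eq_2 numeral_3_eq_3)
  next
    fix a b assume "\<And>i. i < n \<Longrightarrow> a i \<in> Obj C" "\<And>i. i < n \<Longrightarrow> b i \<in> Obj C"
    then show "xi n 2 [map a [0..<n], map b [0..<n]]
      \<in> hom C (S n (map (\<lambda>i. T 2 [a i, b i]) [0..<n])) (T 2 [S n (map a [0..<n]), S n (map b [0..<n])])"
      using xi_hom_cols[of n 2 "[map a [0..<n], map b [0..<n]]"] n by (auto simp: image_subset_iff columns)
  next
    fix f a b assume f: "\<And>i. i < n \<Longrightarrow> f i \<in> hom C (a i) (b i)"
    show "Sa n (map f [0..<n]) \<in> hom C (S n (map a [0..<n])) (S n (map b [0..<n]))"
      using R.ten_hom_map[OF ne, of f b a] f by (simp add: ten_def ten_arr_def same_Cat)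
    fix g c assume "\<And>i. i < n \<Longrightarrow> g i \<in> hom C (b i) (c i)"
    then show "Sa n (map (\<lambda>i. g i \<cdot>\<^bsub>C\<^esub> f i) [0..<n]) = Sa n (map g [0..<n]) \<cdot>\<^bsub>C\<^esub> Sa n (map f [0..<n])"
      using R.ten_Comp_map[OF ne, of g c b f a] f by (simp add: ten_arr_def same_Cat)
  next
    fix f a a' g b b'
    assume "\<And>i. i < n \<Longrightarrow> f i \<in> hom C (a i) (a' i)" "\<And>i. i < n \<Longrightarrow> g i \<in> hom C (b i) (b' i)"
    then show "xi n 2 [map a' [0..<n], map b' [0..<n]] \<cdot>\<^bsub>C\<^esub> Sa n (map (\<lambda>i. Ta 2 [f i, g i]) [0..<n])
      = Ta 2 [Sa n (map f [0..<n]), Sa n (map g [0..<n])] \<cdot>\<^bsub>C\<^esub> xi n 2 [map a [0..<n], map b [0..<n]]"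
      using xi_nat[of n 2 "\<lambda>i j. if j = 0 then f i else g i" "\<lambda>i j. if j = 0 then a i else b i"
          "\<lambda>i j. if j = 0 then a' i else b' i"] n
      by (simp add: upt_2)
  }
qed

text \<open>
  The instance for semigroups, in the opposite category: matrices with at most three rows. The roles of the
  laws are exchanged, as the unit law comes from \<open>\<upsilon>\<close> and the associativity laws from \<open>\<Psi>\<close>.
\<close>

lemma bullet_power_functor:
  assumes p: "p \<ge> 1"
  shows "power_functor (op_moncat R) p (Tensor L p) (\<lambda>a. xi 1 p (map (\<lambda>j. [a j]) [0..<p]))
    (\<lambda>a b. xi 2 p (map (\<lambda>j. [a j, b j]) [0..<p])) (\<lambda>a. xi 3 p (map (\<lambda>j. [a j, a j, a j]) [0..<p]))"
proof (rule power_functor.intro)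
  let ?R = "op_moncat R"
  have ne: "[0..<p] \<noteq> []" using p by simp
  note same_Cat [simp]
  show "lax_monoidal ?R" using oplax by (simp add: oplax_monoidal_def)
  {
    fix a assume a: "\<And>i. i < p \<Longrightarrow> a i \<in> Obj (Cat ?R)"
    then have ao: "set (map a [0..<p]) \<subseteq> Obj C" by auto
    have To: "T p (map a [0..<p]) \<in> Obj (Cat ?R)" using T_Obj[OF p _ ao] by simp
    show "T p (map a [0..<p]) \<in> Obj (Cat ?R)" by (rule To)
    show g1: "xi 1 p (map (\<lambda>j. [a j]) [0..<p]) \<in> hom (Cat ?R) (T p (map (\<lambda>i. on_obj (Tensor ?R 1) [a i]) [0..<p]))
        (on_obj (Tensor ?R 1) [T p (map a [0..<p])])"
      using xi_hom_cols[of 1 p "map (\<lambda>j. [a j]) [0..<p]"] p a by (auto simp: o_def)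
    have g2': "xi 2 p (map (\<lambda>j. [b j, c j]) [0..<p]) \<in> hom C (S 2 [T p (map b [0..<p]), T p (map c [0..<p])])
        (T p (map (\<lambda>i. S 2 [b i, c i]) [0..<p]))"
      if "\<And>i. i < p \<Longrightarrow> b i \<in> Obj C" "\<And>i. i < p \<Longrightarrow> c i \<in> Obj C" for b c
      using xi_hom_cols[of 2 p "map (\<lambda>j. [b j, c j]) [0..<p]"] p that by (auto simp: o_def upt_2)
    show "xi 1 p (map (\<lambda>j. [a j]) [0..<p]) \<cdot>\<^bsub>Cat ?R\<^esub> Ta p (map (\<lambda>i. Unit ?R (a i)) [0..<p])
        = Unit ?R (T p (map a [0..<p]))"
      using upsilon_xi[OF p _ ao] by (simp add: o_def)
    show "xi 3 p (map (\<lambda>j. [a j, a j, a j]) [0..<p])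
      \<in> hom (Cat ?R) (T p (map (\<lambda>i. on_obj (Tensor ?R 3) [a i, a i, a i]) [0..<p]))
        (on_obj (Tensor ?R 3) [T p (map a [0..<p]), T p (map a [0..<p]), T p (map a [0..<p])])"
      using xi_hom_cols[of 3 p "map (\<lambda>j. [a j, a j, a j]) [0..<p]"] p a by (auto simp: o_def upt_2)
    let ?x1 = "xi 1 p (map (\<lambda>j. [a j]) [0..<p])" and ?x2 = "xi 2 p (map (\<lambda>j. [a j, a j]) [0..<p])"
    let ?t = "T p (map a [0..<p])"
    have s: "i < p \<Longrightarrow> S 1 [a i] \<in> Obj C" "i < p \<Longrightarrow> S 2 [a i, a i] \<in> Obj C" for i
      using R.ten_Obj[of "[a i]"] R.ten_Obj[of "[a i, a i]"] a by (auto simp: obj_list_def ten_def numeral_2_eq_2)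
    have g2: "?x2 \<in> hom (Cat ?R) (T p (map (\<lambda>i. S 2 [a i, a i]) [0..<p])) (S 2 [?t, ?t])"
      using g2'[of a a] a by simp
    note A = R.Assoc_21_12_hom[OF To To To]
    have H: "xi 2 p (map (\<lambda>i. [S 2 [a i, a i], S 1 [a i]]) [0..<p])
        \<in> hom (op_cat C) (T p (map (\<lambda>i. S 2 [S 2 [a i, a i], S 1 [a i]]) [0..<p]))
          (S 2 [T p (map (\<lambda>i. S 2 [a i, a i]) [0..<p]), T p (map (\<lambda>i. S 1 [a i]) [0..<p])])"
      "xi 2 p (map (\<lambda>i. [S 1 [a i], S 2 [a i, a i]]) [0..<p])
        \<in> hom (op_cat C) (T p (map (\<lambda>i. S 2 [S 1 [a i], S 2 [a i, a i]]) [0..<p]))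
          (S 2 [T p (map (\<lambda>i. S 1 [a i]) [0..<p]), T p (map (\<lambda>i. S 2 [a i, a i]) [0..<p])])"
      using g2'[OF s(2) s(1)] g2'[OF s(1) s(2)] by simp_all
    have e1: "xi 2 p (map (\<lambda>i. [S 2 [a i, a i], S 1 [a i]]) [0..<p]) \<cdot>\<^bsub>C\<^esub> Sa 2 [?x2, ?x1] \<cdot>\<^bsub>C\<^esub> Assoc R [2, 1] [[?t, ?t], [?t]]
        = Ta p (map (\<lambda>i. Assoc R [2, 1] [[a i, a i], [a i]]) [0..<p]) \<cdot>\<^bsub>C\<^esub> xi 3 p (map (\<lambda>j. [a j, a j, a j]) [0..<p])"
      using Psi_xi[OF p, of "[2, 1]" "map (\<lambda>j. [[a j, a j], [a j]]) [0..<p]"] a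
      by (simp add: o_def upt_2 ten_def numeral_2_eq_2 numeral_3_eq_3)
    show "Assoc ?R [2, 1] [[?t, ?t], [?t]] \<cdot>\<^bsub>Cat ?R\<^esub> on_arr (Tensor ?R 2) [?x2, ?x1]
        \<cdot>\<^bsub>Cat ?R\<^esub> xi 2 p (map (\<lambda>i. [on_obj (Tensor ?R 2) [a i, a i], on_obj (Tensor ?R 1) [a i]]) [0..<p])
      = xi 3 p (map (\<lambda>j. [a j, a j, a j]) [0..<p])
        \<cdot>\<^bsub>Cat ?R\<^esub> Ta p (map (\<lambda>i. Assoc ?R [2, 1] [[a i, a i], [a i]]) [0..<p])"
      using e1 C.Comp_assoc[OF A(1)[simplified] R.ten2_hom[OF g2 g1, simplified] H(1)[simplified]]
      by simp
    have e2: "xi 2 p (map (\<lambda>i. [S 1 [a i], S 2 [a i, a i]]) [0..<p]) \<cdot>\<^bsub>C\<^esub> Sa 2 [?x1, ?x2] \<cdot>\<^bsub>C\<^esub> Assoc R [1, 2] [[?t], [?t, ?t]]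
        = Ta p (map (\<lambda>i. Assoc R [1, 2] [[a i], [a i, a i]]) [0..<p]) \<cdot>\<^bsub>C\<^esub> xi 3 p (map (\<lambda>j. [a j, a j, a j]) [0..<p])"
      using Psi_xi[OF p, of "[1, 2]" "map (\<lambda>j. [[a j], [a j, a j]]) [0..<p]"] a
      by (simp add: o_def upt_2 ten_def numeral_2_eq_2 numeral_3_eq_3)
    show "Assoc ?R [1, 2] [[?t], [?t, ?t]] \<cdot>\<^bsub>Cat ?R\<^esub> on_arr (Tensor ?R 2) [?x1, ?x2]
        \<cdot>\<^bsub>Cat ?R\<^esub> xi 2 p (map (\<lambda>i. [on_obj (Tensor ?R 1) [a i], on_obj (Tensor ?R 2) [a i, a i]]) [0..<p])
      = xi 3 p (map (\<lambda>j. [a j, a j, a j]) [0..<p])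
        \<cdot>\<^bsub>Cat ?R\<^esub> Ta p (map (\<lambda>i. Assoc ?R [1, 2] [[a i], [a i, a i]]) [0..<p])"
      using e2 C.Comp_assoc[OF A(2)[simplified] R.ten2_hom[OF g1 g2, simplified] H(2)[simplified]]
      by simp
  next
    fix a b assume "\<And>i. i < p \<Longrightarrow> a i \<in> Obj (Cat ?R)" "\<And>i. i < p \<Longrightarrow> b i \<in> Obj (Cat ?R)"
    then show "xi 2 p (map (\<lambda>j. [a j, b j]) [0..<p]) \<in> hom (Cat ?R)
        (T p (map (\<lambda>i. on_obj (Tensor ?R 2) [a i, b i]) [0..<p]))
        (on_obj (Tensor ?R 2) [T p (map a [0..<p]), T p (map b [0..<p])])"
      using xi_hom_cols[of 2 p "map (\<lambda>j. [a j, b j]) [0..<p]"] p by (auto simp: o_def upt_2)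
  next
    fix f a b assume f: "\<And>i. i < p \<Longrightarrow> f i \<in> hom (Cat ?R) (a i) (b i)"
    then show "Ta p (map f [0..<p]) \<in> hom (Cat ?R) (T p (map a [0..<p])) (T p (map b [0..<p]))"
      using L.ten_hom_map[OF ne, of f b a] by (simp add: ten_def ten_arr_def)
    fix g c assume "\<And>i. i < p \<Longrightarrow> g i \<in> hom (Cat ?R) (b i) (c i)"
    then show "Ta p (map (\<lambda>i. g i \<cdot>\<^bsub>Cat ?R\<^esub> f i) [0..<p]) = Ta p (map g [0..<p]) \<cdot>\<^bsub>Cat ?R\<^esub> Ta p (map f [0..<p])"
      using L.ten_Comp_map[OF ne, of g c b f a] f by (simp add: ten_arr_def)
  next
    fix f a a' g b b'
    assume "\<And>i. i < p \<Longrightarrow> f i \<in> hom (Cat ?R) (a i) (a' i)" "\<And>i. i < p \<Longrightarrow> g i \<in> hom (Cat ?R) (b i) (b' i)"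
    then show "xi 2 p (map (\<lambda>j. [a' j, b' j]) [0..<p])
        \<cdot>\<^bsub>Cat ?R\<^esub> Ta p (map (\<lambda>i. on_arr (Tensor ?R 2) [f i, g i]) [0..<p])
      = on_arr (Tensor ?R 2) [Ta p (map f [0..<p]), Ta p (map g [0..<p])]
        \<cdot>\<^bsub>Cat ?R\<^esub> xi 2 p (map (\<lambda>j. [a j, b j]) [0..<p])"
      using xi_nat[of 2 p "\<lambda>i j. if i = 0 then f j else g j" "\<lambda>i j. if i = 0 then a' j else b' j"
          "\<lambda>i j. if i = 0 then a j else b j"] p
      by (simp add: upt_2)
  }
qed



section \<open>Products of cosemigroups and of semigroups\<close>

abbreviation "circ Xs \<equiv> cosemigroup_circ L R xi (length Xs) Xs"
abbreviation "bullet Xs \<equiv> semigroup_bullet L R xi (length Xs) Xs"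

lemma map_upt_nth: "map (\<lambda>i. f (xs ! i)) [0..<length xs] = map f xs"
  by (auto intro: nth_equalityI)

lemma length_ge_1: "xs \<noteq> [] \<Longrightarrow> length xs \<ge> 1"
  by (cases xs) auto

lemma circ_cosemigroup:
  assumes "Xs \<noteq> []" and X: "\<forall>X \<in> set Xs. cosemigroup L (fst X) (snd X)"
  shows "cosemigroup L (fst (circ Xs)) (snd (circ Xs))"
  using power_functor.cosemigroup_image[OF circ_power_functor[OF length_ge_1[OF assms(1)]],
      of "\<lambda>i. fst (Xs ! i)" "\<lambda>i. snd (Xs ! i)"] X
  by (simp add: cosemigroup_circ_def map_upt_nth)

lemma circ_cosemigroup_hom:
  assumes "Fs \<noteq> []" and F: "\<forall>F \<in> set Fs. cosemigroup_hom L (sg_dom F) (sg_cod F) (sg_und F)"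
  shows "cosemigroup_hom L (circ (map sg_dom Fs)) (circ (map sg_cod Fs)) (ten_arr R (map sg_und Fs))"
proof -
  let ?n = "length Fs"
  interpret P: power_functor L ?n "Tensor R ?n" "\<lambda>a. xi ?n 1 [map a [0..<?n]]"
    "\<lambda>a b. xi ?n 2 [map a [0..<?n], map b [0..<?n]]" "\<lambda>a. xi ?n 3 [map a [0..<?n], map a [0..<?n], map a [0..<?n]]"
    by (rule circ_power_functor[OF length_ge_1[OF assms(1)]])
  let ?a = "\<lambda>i. fst (sg_dom (Fs ! i))" and ?b = "\<lambda>i. fst (sg_cod (Fs ! i))" and ?f = "\<lambda>i. sg_und (Fs ! i)"
  note m = map_upt_nth[of "\<lambda>F. fst (sg_dom F)" Fs]
    map_upt_nth[of "\<lambda>F. fst (sg_cod F)" Fs]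
    map_upt_nth[of "\<lambda>F. snd (sg_dom F)" Fs]
    map_upt_nth[of "\<lambda>F. snd (sg_cod F)" Fs]
    map_upt_nth[of "\<lambda>F. sg_und F" Fs]
  have c: "cosemigroup L (fst (circ (map sg_dom Fs))) (snd (circ (map sg_dom Fs)))"
    "cosemigroup L (fst (circ (map sg_cod Fs))) (snd (circ (map sg_cod Fs)))"
    using assms circ_cosemigroup[of "map sg_dom Fs"] circ_cosemigroup[of "map sg_cod Fs"]
    by (simp_all add: cosemigroup_hom_def)
  have f: "i < ?n \<Longrightarrow> ?f i \<in> hom C (?a i) (?b i)" for i
    using F by (simp add: cosemigroup_hom_def)
  have "Sa ?n (map ?f [0..<?n]) \<in> hom C (S ?n (map ?a [0..<?n])) (S ?n (map ?b [0..<?n]))"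
    by (rule P.S_hom[OF f])
  moreover have "xi ?n 2 [map ?b [0..<?n], map ?b [0..<?n]] \<cdot>\<^bsub>C\<^esub> Sa ?n (map (\<lambda>i. snd (sg_cod (Fs ! i))) [0..<?n])
      \<cdot>\<^bsub>C\<^esub> Sa ?n (map ?f [0..<?n])
    = Ta 2 [Sa ?n (map ?f [0..<?n]), Sa ?n (map ?f [0..<?n])]
      \<cdot>\<^bsub>C\<^esub> (xi ?n 2 [map ?a [0..<?n], map ?a [0..<?n]] \<cdot>\<^bsub>C\<^esub> Sa ?n (map (\<lambda>i. snd (sg_dom (Fs ! i))) [0..<?n]))"
    using F by (intro P.cosemigroup_hom_image) (auto simp: cosemigroup_hom_def)
  ultimately show ?thesis
    using c unfolding cosemigroup_hom_def m by (simp add: cosemigroup_circ_def ten_arr_def o_def)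
qed

lemma bullet_cosemigroup:
  assumes "Xs \<noteq> []" and X: "\<forall>X \<in> set Xs. cosemigroup (op_moncat R) (fst X) (snd X)"
  shows "cosemigroup (op_moncat R) (fst (bullet Xs)) (snd (bullet Xs))"
  using power_functor.cosemigroup_image[OF bullet_power_functor[OF length_ge_1[OF assms(1)]],
      of "\<lambda>i. fst (Xs ! i)" "\<lambda>i. snd (Xs ! i)"] X
  by (simp add: semigroup_bullet_def map_upt_nth map_upt_nth[of "\<lambda>X. [fst X, fst X]"] same_Cat)

lemma bullet_cosemigroup_hom:
  assumes "Fs \<noteq> []" and F: "\<forall>F \<in> set Fs. cosemigroup_hom (op_moncat R) (sg_cod F) (sg_dom F) (sg_und F)"
  shows "cosemigroup_hom (op_moncat R) (bullet (map sg_cod Fs)) (bullet (map sg_dom Fs)) (ten_arr L (map sg_und Fs))"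
proof -
  let ?p = "length Fs" and ?R = "op_moncat R"
  interpret P: power_functor ?R ?p "Tensor L ?p" "\<lambda>a. xi 1 ?p (map (\<lambda>j. [a j]) [0..<?p])"
    "\<lambda>a b. xi 2 ?p (map (\<lambda>j. [a j, b j]) [0..<?p])" "\<lambda>a. xi 3 ?p (map (\<lambda>j. [a j, a j, a j]) [0..<?p])"
    by (rule bullet_power_functor[OF length_ge_1[OF assms(1)]])
  let ?a = "\<lambda>i. fst (sg_dom (Fs ! i))" and ?b = "\<lambda>i. fst (sg_cod (Fs ! i))" and ?f = "\<lambda>i. sg_und (Fs ! i)"
  note m = map_upt_nth[of "\<lambda>F. fst (sg_dom F)" Fs]
    map_upt_nth[of "\<lambda>F. fst (sg_cod F)" Fs]
    map_upt_nth[of "\<lambda>F. snd (sg_dom F)" Fs]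
    map_upt_nth[of "\<lambda>F. snd (sg_cod F)" Fs]
    map_upt_nth[of "\<lambda>F. sg_und F" Fs]
    map_upt_nth[of "\<lambda>F. [fst (sg_dom F), fst (sg_dom F)]" Fs]
    map_upt_nth[of "\<lambda>F. [fst (sg_cod F), fst (sg_cod F)]" Fs]
  have c: "cosemigroup ?R (fst (bullet (map sg_dom Fs))) (snd (bullet (map sg_dom Fs)))"
    "cosemigroup ?R (fst (bullet (map sg_cod Fs))) (snd (bullet (map sg_cod Fs)))"
    using assms bullet_cosemigroup[of "map sg_dom Fs"] bullet_cosemigroup[of "map sg_cod Fs"]
    by (simp_all add: cosemigroup_hom_def)
  have f: "i < ?p \<Longrightarrow> ?f i \<in> hom (Cat ?R) (?b i) (?a i)" for i
    using F unfolding cosemigroup_hom_def by simp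
  have "Ta ?p (map ?f [0..<?p]) \<in> hom (Cat ?R) (T ?p (map ?b [0..<?p])) (T ?p (map ?a [0..<?p]))"
    by (rule P.S_hom[OF f])
  moreover have "xi 2 ?p (map (\<lambda>j. [?a j, ?a j]) [0..<?p]) \<cdot>\<^bsub>Cat ?R\<^esub> Ta ?p (map (\<lambda>i. snd (sg_dom (Fs ! i))) [0..<?p])
      \<cdot>\<^bsub>Cat ?R\<^esub> Ta ?p (map ?f [0..<?p])
    = on_arr (Tensor ?R 2) [Ta ?p (map ?f [0..<?p]), Ta ?p (map ?f [0..<?p])]
      \<cdot>\<^bsub>Cat ?R\<^esub> (xi 2 ?p (map (\<lambda>j. [?b j, ?b j]) [0..<?p])
      \<cdot>\<^bsub>Cat ?R\<^esub> Ta ?p (map (\<lambda>i. snd (sg_cod (Fs ! i))) [0..<?p]))"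
    using F unfolding cosemigroup_hom_def by (intro P.cosemigroup_hom_image) auto
  ultimately show ?thesis
    using c unfolding cosemigroup_hom_def
    unfolding m by (simp add: semigroup_bullet_def ten_arr_def o_def same_Cat)
qed

text \<open>
  In the proof, \<open>?as\<close> are the underlying objects, \<open>?bs\<close> their squares \<open>a \<bullet> a\<close>, \<open>?s\<close> the products of the
  comultiplications within a block and \<open>?x\<close> the components of \<open>\<xi>\<close> that turn these into the comultiplication
  of the block.
\<close>

lemma Psi_cosemigroup_hom:
  assumes ne: "Xss \<noteq> []" "\<forall>Xs \<in> set Xss. Xs \<noteq> [] \<and> (\<forall>X \<in> set Xs. cosemigroup L (fst X) (snd X))"
  shows "cosemigroup_hom L (circ (concat Xss)) (circ (map (\<lambda>Xs. circ Xs) Xss)) (asc R (map (map fst) Xss))"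
proof -
  let ?n = "length Xss" and ?as = "map (map fst) Xss" and ?K = "length (concat Xss)"
  let ?t = "\<lambda>Xs. ten R (map fst Xs)" and ?d = "\<lambda>X. T 2 [fst X, fst X]"
  let ?x = "\<lambda>Xs. xi (length Xs) 2 [map fst Xs, map fst Xs]" and ?s = "\<lambda>Xs. ten_arr R (map snd Xs)"
  let ?bs = "map (map ?d) Xss"
  have cc: "concat Xss \<noteq> []" "\<forall>X \<in> set (concat Xss). cosemigroup L (fst X) (snd X)"
    using assms by (cases Xss; auto)+
  have c: "cosemigroup L (fst (circ (concat Xss))) (snd (circ (concat Xss)))"
    "cosemigroup L (fst (circ (map (\<lambda>Xs. circ Xs) Xss))) (snd (circ (map (\<lambda>Xs. circ Xs) Xss)))"
    using circ_cosemigroup[OF cc] circ_cosemigroup[of "map (\<lambda>Xs. circ Xs) Xss"] circ_cosemigroup assms by auto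
  have o: "fst X \<in> Obj C" "snd X \<in> hom C (fst X) (?d X)" if "Xs \<in> set Xss" "X \<in> set Xs" for Xs X
    using assms(2) that by (auto simp: cosemigroup_def)
  have ks: "obj_lists C ?as" "obj_lists C ?bs"
    using ne o o(2)[THEN hom_Dom_Cod] C.Cod_Obj by (fastforce simp: obj_lists_def obj_list_def)+
  have x: "?x Xs \<in> hom C (ten R (map ?d Xs)) (T 2 [?t Xs, ?t Xs])" if "Xs \<in> set Xss" for Xs
  proof -
    have "map (\<lambda>i. T 2 [map fst Xs ! i, map fst Xs ! i]) [0..<length Xs] = map ?d Xs"
      by (auto intro: nth_equalityI)
    then show ?thesis
      using xi_hom_cols[of "length Xs" 2 "[map fst Xs, map fst Xs]"] ne that o(1)[OF that]
      by (simp add: ten_def image_subset_iff Suc_le_eq)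
  qed
  have sn: "?s Xs \<in> hom C (?t Xs) (ten R (map ?d Xs))" if "Xs \<in> set Xss" for Xs
    using R.ten_hom_map[of Xs snd ?d fst] o(2)[OF that] ne that by (simp add: same_Cat)
  have X: "xi ?n 2 [map ?t Xss, map ?t Xss] \<in> hom C (ten R (map (\<lambda>Xs. T 2 [?t Xs, ?t Xs]) Xss))
      (T 2 [ten R (map ?t Xss), ten R (map ?t Xss)])"
  proof -
    have "map (\<lambda>i. T 2 [map ?t Xss ! i, map ?t Xss ! i]) [0..<?n] = map (\<lambda>Xs. T 2 [?t Xs, ?t Xs]) Xss"
      by (auto intro: nth_equalityI)
    moreover have "set (map ?t Xss) \<subseteq> Obj C"
      using ks(1) R.ten_Obj same_Cat by (auto simp: obj_lists_def)
    ultimately show ?thesis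
      using xi_hom_cols[of ?n 2 "[map ?t Xss, map ?t Xss]"] ne
      by (simp add: ten_def image_subset_iff Suc_le_eq)
  qed
  have X': "xi ?K 2 [concat ?as, concat ?as] \<in> hom C (ten R (concat ?bs)) (T 2 [ten R (concat ?as), ten R (concat ?as)])"
  proof -
    have "map (\<lambda>i. T 2 [concat ?as ! i, concat ?as ! i]) [0..<?K] = concat ?bs"
      unfolding map_concat[symmetric] by (auto intro: nth_equalityI)
    moreover have "set (concat ?as) \<subseteq> Obj C" "length (concat ?as) = ?K" "length (concat ?bs) = ?K"
      using o(1) by (auto simp: map_concat[symmetric])
    ultimately show ?thesis
      using xi_hom_cols[of ?K 2 "[concat ?as, concat ?as]"] cc(1)
      by (simp add: ten_def Suc_le_eq del: concat_eq_Nil_conv)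
  qed
  note A = R.asc_hom[simplified, unfolded same_Cat]
  have \<psi>: "asc R ?as \<in> hom C (ten R (concat ?as)) (ten R (map ?t Xss))"
    "asc R ?bs \<in> hom C (ten R (concat ?bs)) (ten R (map (\<lambda>Xs. ten R (map ?d Xs)) Xss))"
    using A[OF ks(1)] A[OF ks(2)] by (simp_all add: o_def)
  have N: "ten_arr R (map ?s Xss) \<cdot>\<^bsub>C\<^esub> asc R ?as = asc R ?bs \<cdot>\<^bsub>C\<^esub> ten_arr R (map snd (concat Xss))"
  proof -
    have "set (map snd Xs) \<subseteq> Arr C" "map (Dom C) (map snd Xs) = map fst Xs" "map (Cod C) (map snd Xs) = map ?d Xs"
      if "Xs \<in> set Xss" for Xs
      using o(2)[OF that] by (auto simp: hom_def)
    note m = this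
    have e: "map (map (Dom C)) (map (map snd) Xss) = ?as" "map (map (Cod C)) (map (map snd) Xss) = ?bs"
      using m(2,3) by simp_all
    have "ten_arr R (map (ten_arr R) (map (map snd) Xss))
          \<cdot>\<^bsub>C\<^esub> asc R (map (map (Dom C)) (map (map snd) Xss)) =
        asc R (map (map (Cod C)) (map (map snd) Xss)) \<cdot>\<^bsub>C\<^esub> ten_arr R (concat (map (map snd) Xss))"
      using R.asc_nat[of "map (map snd) Xss"] m(1) ne unfolding op_moncat_simps op_cat_simps same_Cat by force
    then show ?thesis unfolding e by (simp add: map_concat o_def)
  qed
  have P: "xi ?n 2 [map ?t Xss, map ?t Xss] \<cdot>\<^bsub>C\<^esub> ten_arr R (map ?x Xss) \<cdot>\<^bsub>C\<^esub> asc R ?bs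
      = Ta 2 [asc R ?as, asc R ?as] \<cdot>\<^bsub>C\<^esub> xi ?K 2 [concat ?as, concat ?as]"
  proof -
    have "map (\<lambda>i. map (\<lambda>j. T 2 (map (\<lambda>x. x ! i ! j) [?as, ?as])) [0..<map length Xss ! i]) [0..<length (map length Xss)] = ?bs"
      by (auto intro!: nth_equalityI)
    moreover have "map (\<lambda>i. xi (map length Xss ! i) 2 (map (\<lambda>x. x ! i) [?as, ?as])) [0..<length (map length Xss)] = map ?x Xss"
      by (auto intro!: nth_equalityI)
    moreover have "\<forall>k \<in> set (map length Xss). k \<ge> 1" using ne(2) by (auto simp: Suc_le_eq)
    moreover have "\<forall>xss \<in> set [?as, ?as]. map length xss = map length Xss \<and> (\<forall>xs \<in> set xss. set xs \<subseteq> Obj C)"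
      using o(1) by auto
    ultimately show ?thesis
      using Psi_xi[of 2 "map length Xss" "[?as, ?as]"] ne(1)
      by (simp add: asc_def ten_arr_def length_concat o_def)
  qed
  have "xi ?n 2 [map ?t Xss, map ?t Xss] \<cdot>\<^bsub>C\<^esub> (ten_arr R (map ?x Xss) \<cdot>\<^bsub>C\<^esub> ten_arr R (map ?s Xss)) \<cdot>\<^bsub>C\<^esub> asc R ?as
      = Ta 2 [asc R ?as, asc R ?as] \<cdot>\<^bsub>C\<^esub> (xi ?K 2 [concat ?as, concat ?as] \<cdot>\<^bsub>C\<^esub> ten_arr R (map snd (concat Xss)))"
  proof (rule C.Comp_square[OF _ \<psi>(2) \<psi>(1) _ _ X X' L.ten2_hom[OF \<psi>(1) \<psi>(1)] N P])
    show "ten_arr R (map snd (concat Xss)) \<in> hom C (ten R (concat ?as)) (ten R (concat ?bs))"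
      using R.ten_hom_map[of "concat Xss" snd ?d fst] o(2) cc(1) by (auto simp: same_Cat map_concat)
    show "ten_arr R (map ?s Xss) \<in> hom C (ten R (map ?t Xss)) (ten R (map (\<lambda>Xs. ten R (map ?d Xs)) Xss))"
      using R.ten_hom_map[OF ne(1), of ?s "\<lambda>Xs. ten R (map ?d Xs)" ?t] sn by (simp add: same_Cat)
    show "ten_arr R (map ?x Xss) \<in> hom C (ten R (map (\<lambda>Xs. ten R (map ?d Xs)) Xss)) (ten R (map (\<lambda>Xs. T 2 [?t Xs, ?t Xs]) Xss))"
      using R.ten_hom_map[OF ne(1), of ?x "\<lambda>Xs. T 2 [?t Xs, ?t Xs]" "\<lambda>Xs. ten R (map ?d Xs)"] x by (simp add: same_Cat)
  qed
  also have "ten_arr R (map ?x Xss) \<cdot>\<^bsub>C\<^esub> ten_arr R (map ?s Xss) = ten_arr R (map (\<lambda>Xs. ?x Xs \<cdot>\<^bsub>C\<^esub> ?s Xs) Xss)"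
    using R.ten_Comp_map[OF ne(1), of ?x "\<lambda>Xs. T 2 [?t Xs, ?t Xs]" "\<lambda>Xs. ten R (map ?d Xs)" ?s ?t] x sn
    by (simp add: same_Cat)
  finally show ?thesis
    using c \<psi>(1) unfolding cosemigroup_hom_def
    by (simp add: cosemigroup_circ_def ten_def ten_arr_def o_def map_concat length_concat)
qed

lemma upsilon_cosemigroup_hom:
  assumes "cosemigroup L (fst X) (snd X)"
  shows "cosemigroup_hom L (circ [X]) X (Unit R (fst X))"
proof -
  let ?a = "fst X" and ?d = "snd X"
  have a: "?a \<in> Obj C" and d: "?d \<in> hom C ?a (T 2 [?a, ?a])" using assms by (auto simp: cosemigroup_def)
  have u: "Unit R ?a \<in> hom C (S 1 [?a]) ?a" using R.Unit_hom1[of ?a] a by (simp add: same_Cat)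
  have x: "xi 1 2 [[?a], [?a]] \<in> hom C (S 1 [T 2 [?a, ?a]]) (T 2 [S 1 [?a], S 1 [?a]])"
    using xi_hom_cols[of 1 2 "[[?a], [?a]]"] a by simp
  have s: "Sa 1 [?d] \<in> hom C (S 1 [?a]) (S 1 [T 2 [?a, ?a]])"
    using R.ten_hom[of "[?d]"] d by (simp add: same_Cat hom_def ten_def ten_arr_def)
  have e: "Unit R (T 2 [?a, ?a]) = Ta 2 [Unit R ?a, Unit R ?a] \<cdot>\<^bsub>C\<^esub> xi 1 2 [[?a], [?a]]"
    using upsilon_xi[of 2 "[?a, ?a]"] a by simp
  have n: "?d \<cdot>\<^bsub>C\<^esub> Unit R ?a = Unit R (T 2 [?a, ?a]) \<cdot>\<^bsub>C\<^esub> Sa 1 [?d]"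
    using R.Unit_nat[of ?d] d by (simp add: same_Cat hom_def ten_arr_def)
  have "?d \<cdot>\<^bsub>C\<^esub> Unit R ?a = Ta 2 [Unit R ?a, Unit R ?a] \<cdot>\<^bsub>C\<^esub> (xi 1 2 [[?a], [?a]] \<cdot>\<^bsub>C\<^esub> Sa 1 [?d])"
    by (simp only: n e C.Comp_assoc[OF s x L.ten2_hom[OF u u]])
  then show ?thesis
    using circ_cosemigroup[of "[X]"] assms u by (simp add: cosemigroup_hom_def cosemigroup_circ_def)
qed


text \<open>
  The dual argument, with the same names, now for multiplications and the squares \<open>a \<circ> a\<close>. The chase takes
  place in the opposite category, where the composites read as in the previous case.
\<close>

lemma Phi_cosemigroup_hom:
  assumes ne: "Xss \<noteq> []"
    "\<forall>Xs \<in> set Xss. Xs \<noteq> [] \<and> (\<forall>X \<in> set Xs. cosemigroup (op_moncat R) (fst X) (snd X))"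
  shows "cosemigroup_hom (op_moncat R) (bullet (concat Xss)) (bullet (map (\<lambda>Xs. bullet Xs) Xss))
    (asc L (map (map fst) Xss))"
proof -
  let ?R = "op_moncat R" and ?D = "op_cat C"
  interpret D: category ?D by (rule category_op_cat[OF L.Cat])
  let ?n = "length Xss" and ?as = "map (map fst) Xss" and ?K = "length (concat Xss)"
  let ?t = "\<lambda>Xs. ten L (map fst Xs)" and ?m = "\<lambda>X. S 2 [fst X, fst X]"
  let ?x = "\<lambda>Xs. xi 2 (length Xs) (map (\<lambda>X. [fst X, fst X]) Xs)" and ?s = "\<lambda>Xs. ten_arr L (map snd Xs)"
  let ?bs = "map (map ?m) Xss" and ?X = "xi 2 ?n (map (\<lambda>Xs. [?t Xs, ?t Xs]) Xss)"
  let ?X' = "xi 2 ?K (map (\<lambda>X. [fst X, fst X]) (concat Xss))"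
  have cc: "concat Xss \<noteq> []" "\<forall>X \<in> set (concat Xss). cosemigroup ?R (fst X) (snd X)"
    using assms by (cases Xss; auto)+
  have c: "cosemigroup ?R (fst (bullet (concat Xss))) (snd (bullet (concat Xss)))"
    "cosemigroup ?R (fst (bullet (map (\<lambda>Xs. bullet Xs) Xss))) (snd (bullet (map (\<lambda>Xs. bullet Xs) Xss)))"
    using bullet_cosemigroup[OF cc] bullet_cosemigroup[of "map (\<lambda>Xs. bullet Xs) Xss"] bullet_cosemigroup assms by auto
  have o: "fst X \<in> Obj C" "snd X \<in> hom C (?m X) (fst X)" if "Xs \<in> set Xss" "X \<in> set Xs" for Xs X
    using assms(2) that by (auto simp: cosemigroup_def same_Cat)
  have ks: "obj_lists C ?as" "obj_lists C ?bs"
    using ne o o(2)[THEN hom_Dom_Cod] C.Dom_Obj by (fastforce simp: obj_lists_def obj_list_def)+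
  have x: "?x Xs \<in> hom C (S 2 [?t Xs, ?t Xs]) (ten L (map ?m Xs))" if "Xs \<in> set Xss" for Xs
    using xi_hom_cols[of 2 "length Xs" "map (\<lambda>X. [fst X, fst X]) Xs"] ne that o(1)[OF that]
    by (simp add: ten_def Suc_le_eq upt_2 o_def)
  have sn: "?s Xs \<in> hom C (ten L (map ?m Xs)) (?t Xs)" if "Xs \<in> set Xss" for Xs
    using L.ten_hom_map[of Xs snd ?m fst] o(2)[OF that] ne that by simp
  have tO: "\<forall>Xs \<in> set Xss. ?t Xs \<in> Obj C" using ks(1) L.ten_Obj by (auto simp: obj_lists_def)
  have X: "?X \<in> hom C (S 2 [ten L (map ?t Xss), ten L (map ?t Xss)]) (ten L (map (\<lambda>Xs. S 2 [?t Xs, ?t Xs]) Xss))"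
    using xi_hom_cols[of 2 ?n "map (\<lambda>Xs. [?t Xs, ?t Xs]) Xss"] ne tO
    by (simp add: ten_def[of L "map _ Xss"] Suc_le_eq upt_2 o_def)
  have X': "?X' \<in> hom C (S 2 [ten L (concat ?as), ten L (concat ?as)]) (ten L (concat ?bs))"
  proof -
    have "\<forall>X \<in> set (concat Xss). fst X \<in> Obj C" using o(1) by auto
    then show ?thesis
      using xi_hom_cols[of 2 ?K "map (\<lambda>X. [fst X, fst X]) (concat Xss)"] cc(1)
      unfolding map_concat[symmetric] by (simp add: ten_def Suc_le_eq upt_2 o_def del: concat_eq_Nil_conv set_concat)
  qed
  have \<phi>: "asc L ?as \<in> hom C (ten L (map ?t Xss)) (ten L (concat ?as))"
    "asc L ?bs \<in> hom C (ten L (map (\<lambda>Xs. ten L (map ?m Xs)) Xss)) (ten L (concat ?bs))"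
    using L.asc_hom[OF ks(1)] L.asc_hom[OF ks(2)] by (simp_all add: o_def)
  have N: "asc L ?as \<cdot>\<^bsub>C\<^esub> ten_arr L (map ?s Xss) = ten_arr L (map snd (concat Xss)) \<cdot>\<^bsub>C\<^esub> asc L ?bs"
  proof -
    have m: "set (map snd Xs) \<subseteq> Arr C" "map (Dom C) (map snd Xs) = map ?m Xs" "map (Cod C) (map snd Xs) = map fst Xs"
      if "Xs \<in> set Xss" for Xs
      using o(2)[OF that] by (auto simp: hom_def)
    have e: "map (map (Dom C)) (map (map snd) Xss) = ?bs" "map (map (Cod C)) (map (map snd) Xss) = ?as"
      using m(2,3) by simp_all
    have "asc L (map (map (Cod C)) (map (map snd) Xss)) \<cdot>\<^bsub>C\<^esub> ten_arr L (map (ten_arr L) (map (map snd) Xss))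
        = ten_arr L (concat (map (map snd) Xss)) \<cdot>\<^bsub>C\<^esub> asc L (map (map (Dom C)) (map (map snd) Xss))"
      using m(1) ne by (intro L.asc_nat) force+
    then show ?thesis unfolding e by (simp add: map_concat o_def)
  qed
  have x_hom: "ten_arr L (map ?x Xss)
      \<in> hom C (ten L (map (\<lambda>Xs. S 2 [?t Xs, ?t Xs]) Xss)) (ten L (map (\<lambda>Xs. ten L (map ?m Xs)) Xss))"
    by (rule L.ten_hom_map[OF ne(1) x])
  have \<phi>2: "Sa 2 [asc L ?as, asc L ?as]
      \<in> hom ?D (S 2 [ten L (concat ?as), ten L (concat ?as)]) (S 2 [ten L (map ?t Xss), ten L (map ?t Xss)])"
    using R.ten2_hom[of "asc L ?as" "ten L (concat ?as)" "ten L (map ?t Xss)" "asc L ?as"] \<phi>(1) by (simp add: same_Cat)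
  have P: "asc L ?bs \<cdot>\<^bsub>C\<^esub> (ten_arr L (map ?x Xss) \<cdot>\<^bsub>C\<^esub> ?X) = ?X' \<cdot>\<^bsub>C\<^esub> Sa 2 [asc L ?as, asc L ?as]"
  proof -
    let ?cs = "map (map (\<lambda>X. [fst X, fst X])) Xss"
    have "\<forall>cols \<in> set ?cs. \<forall>col \<in> set cols. length col = 2 \<and> set col \<subseteq> Obj C" using o(1) by auto
    moreover have "[] \<notin> set ?cs" using ne by auto
    moreover have "concat ?cs = map (\<lambda>X. [fst X, fst X]) (concat Xss)" by (simp add: map_concat)
    ultimately have "?X' \<cdot>\<^bsub>C\<^esub> Sa 2 [asc L ?as, asc L ?as]
        = asc L ?bs \<cdot>\<^bsub>C\<^esub> ten_arr L (map ?x Xss) \<cdot>\<^bsub>C\<^esub> ?X"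
      using xi_asc[of 2 ?cs] ne(1) by (simp add: o_def upt_2 ten_def del: concat_eq_Nil_conv)
    then show ?thesis by (simp only: C.Comp_assoc[OF X x_hom \<phi>(2)])
  qed
  have s_hom: "ten_arr L (map snd (concat Xss)) \<in> hom C (ten L (concat ?bs)) (ten L (concat ?as))"
    using L.ten_hom_map[of "concat Xss" snd ?m fst] o(2) cc(1) by (auto simp: map_concat)
  have ss_hom: "ten_arr L (map ?s Xss) \<in> hom C (ten L (map (\<lambda>Xs. ten L (map ?m Xs)) Xss)) (ten L (map ?t Xss))"
    by (rule L.ten_hom_map[OF ne(1) sn])
  have "?X \<cdot>\<^bsub>?D\<^esub> (ten_arr L (map ?x Xss) \<cdot>\<^bsub>?D\<^esub> ten_arr L (map ?s Xss)) \<cdot>\<^bsub>?D\<^esub> asc L ?as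
      = Sa 2 [asc L ?as, asc L ?as] \<cdot>\<^bsub>?D\<^esub> (?X' \<cdot>\<^bsub>?D\<^esub> ten_arr L (map snd (concat Xss)))"
    by (rule D.Comp_square[OF _ _ _ _ _ _ _ \<phi>2]; unfold op_cat_simps)
       (rule s_hom \<phi>(2) \<phi>(1) ss_hom x_hom X X' N P)+
  moreover have "ten_arr L (map ?s Xss) \<cdot>\<^bsub>C\<^esub> ten_arr L (map ?x Xss) = ten_arr L (map (\<lambda>Xs. ?s Xs \<cdot>\<^bsub>C\<^esub> ?x Xs) Xss)"
    by (rule L.ten_Comp_map[OF ne(1) x sn, symmetric])
  ultimately show ?thesis
    using c \<phi>(1) unfolding cosemigroup_hom_def
    by (simp add: semigroup_bullet_def ten_def ten_arr_def o_def map_concat length_concat same_Cat)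
qed

lemma iota_cosemigroup_hom:
  assumes "cosemigroup (op_moncat R) (fst X) (snd X)"
  shows "cosemigroup_hom (op_moncat R) (bullet [X]) X (Unit L (fst X))"
proof -
  let ?a = "fst X" and ?m = "snd X"
  have a: "?a \<in> Obj C" and m: "?m \<in> hom C (S 2 [?a, ?a]) ?a" using assms by (auto simp: cosemigroup_def same_Cat)
  have u: "Unit L ?a \<in> hom C ?a (T 1 [?a])" by (rule L.Unit_hom1[OF a])
  have x: "xi 2 1 [[?a, ?a]] \<in> hom C (S 2 [T 1 [?a], T 1 [?a]]) (T 1 [S 2 [?a, ?a]])"
    using xi_hom_cols[of 2 1 "[[?a, ?a]]"] a by (simp add: upt_2)
  have s: "Ta 1 [?m] \<in> hom C (T 1 [S 2 [?a, ?a]]) (T 1 [?a])"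
    using L.ten_hom[of "[?m]"] m by (simp add: hom_def ten_def ten_arr_def)
  have u2: "Sa 2 [Unit L ?a, Unit L ?a] \<in> hom C (S 2 [?a, ?a]) (S 2 [T 1 [?a], T 1 [?a]])"
    using R.ten2_hom[of "Unit L ?a" "T 1 [?a]" ?a "Unit L ?a" "T 1 [?a]" ?a] u by (simp add: same_Cat)
  have e: "Unit L (S 2 [?a, ?a]) = xi 2 1 [[?a, ?a]] \<cdot>\<^bsub>C\<^esub> Sa 2 [Unit L ?a, Unit L ?a]"
    using xi_Unit[of 2 "\<lambda>i. ?a"] a by (simp add: upt_2)
  have n: "Unit L ?a \<cdot>\<^bsub>C\<^esub> ?m = Ta 1 [?m] \<cdot>\<^bsub>C\<^esub> Unit L (S 2 [?a, ?a])"
    using L.Unit_nat[of ?m] m by (simp add: hom_def ten_arr_def)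
  have "Unit L ?a \<cdot>\<^bsub>C\<^esub> ?m = Ta 1 [?m] \<cdot>\<^bsub>C\<^esub> xi 2 1 [[?a, ?a]] \<cdot>\<^bsub>C\<^esub> Sa 2 [Unit L ?a, Unit L ?a]"
    by (simp only: n e C.Comp_assoc[OF u2 x s])
  then show ?thesis
    using bullet_cosemigroup[of "[X]"] assms u by (simp add: cosemigroup_hom_def semigroup_bullet_def same_Cat)
qed

lemma cosemigroup_moncat_simps:
  "Cat (cosemigroup_moncat L R xi) = cosemigroup_cat L"
  "ten (cosemigroup_moncat L R xi) Xs = circ Xs"
  "ten_arr (cosemigroup_moncat L R xi) Fs
    = (circ (map sg_dom Fs), circ (map sg_cod Fs), ten_arr R (map sg_und Fs))"
  "asc (cosemigroup_moncat L R xi) Xss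
    = (circ (concat Xss), circ (map (\<lambda>Xs. circ Xs) Xss), asc R (map (map fst) Xss))"
  "Unit (cosemigroup_moncat L R xi) X = (circ [X], X, Unit R (fst X))"
proof -
  have e: "map (\<lambda>i. cosemigroup_circ L R xi (map length Xss ! i) (Xss ! i)) [0..<length Xss] = map (\<lambda>Xs. circ Xs) Xss"
    by (auto intro: nth_equalityI)
  show "asc (cosemigroup_moncat L R xi) Xss
    = (circ (concat Xss), circ (map (\<lambda>Xs. circ Xs) Xss), asc R (map (map fst) Xss))"
    using e by (simp add: cosemigroup_moncat_def Let_def asc_def length_concat o_def)
qed (simp_all add: cosemigroup_moncat_def Let_def ten_def ten_arr_def)

lemma semigroup_moncat_simps:
  "Cat (semigroup_moncat L R xi) = semigroup_cat R"
  "ten (semigroup_moncat L R xi) Xs = bullet Xs"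
  "ten_arr (semigroup_moncat L R xi) Fs
    = (bullet (map sg_dom Fs), bullet (map sg_cod Fs), ten_arr L (map sg_und Fs))"
  "asc (semigroup_moncat L R xi) Xss
    = (bullet (map (\<lambda>Xs. bullet Xs) Xss), bullet (concat Xss), asc L (map (map fst) Xss))"
  "Unit (semigroup_moncat L R xi) X = (X, bullet [X], Unit L (fst X))"
proof -
  have e: "map (\<lambda>i. semigroup_bullet L R xi (map length Xss ! i) (Xss ! i)) [0..<length Xss] = map (\<lambda>Xs. bullet Xs) Xss"
    by (auto intro: nth_equalityI)
  show "asc (semigroup_moncat L R xi) Xss
    = (bullet (map (\<lambda>Xs. bullet Xs) Xss), bullet (concat Xss), asc L (map (map fst) Xss))"
    using e by (simp add: semigroup_moncat_def Let_def asc_def length_concat o_def)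
qed (simp_all add: semigroup_moncat_def Let_def ten_def ten_arr_def)

text \<open>
  An arrow of the category of (co)semigroups is a triple of its domain, its codomain and the underlying
  arrow, so the forgetful functor \<open>(fst, sg_und)\<close> is faithful.
\<close>

lemma cosemigroup_faithful_strict:
  "faithful_strict (op_moncat R) (op_moncat (cosemigroup_moncat L R xi)) fst sg_und"
proof (rule faithful_strict.intro, unfold op_moncat_simps op_cat_simps obj_list_op_cat cosemigroup_moncat_simps)
  let ?K = "cosemigroup_cat L"
  have okD: "Xs \<noteq> [] \<and> (\<forall>X \<in> set Xs. cosemigroup L (fst X) (snd X))" if "obj_list ?K Xs" for Xs
    using that by (auto simp: obj_list_def subset_iff)
  have oksD: "Xss \<noteq> []" "\<forall>Xs \<in> set Xss. Xs \<noteq> [] \<and> (\<forall>X \<in> set Xs. cosemigroup L (fst X) (snd X))"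
    if "obj_lists ?K Xss" for Xss
    using that okD by (auto simp: obj_lists_def)
  show "lax_monoidal (op_moncat R)" using oplax by (simp add: oplax_monoidal_def)
  show "category (op_cat ?K)" by (rule category_op_cat[OF category_cosemigroup_cat[OF lax]])
  show "X \<in> Obj ?K \<Longrightarrow> fst X \<in> Obj (Cat R)" for X by (simp add: cosemigroup_def same_Cat)
  show "f \<in> hom ?K y x \<Longrightarrow> sg_und f \<in> hom (Cat R) (fst y) (fst x)" for f x y
    by (auto simp: hom_cosemigroup_cat cosemigroup_hom_def same_Cat)
  show "f \<in> hom ?K y x \<Longrightarrow> g \<in> hom ?K y x \<Longrightarrow> sg_und f = sg_und g \<Longrightarrow> f = g" for f g x y
    by (auto simp: hom_cosemigroup_cat)
  show "sg_und (Ident ?K x) = Ident (Cat R) (fst x)" for x by (simp add: same_Cat)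
  show "sg_und (f \<cdot>\<^bsub>?K\<^esub> g) = sg_und f \<cdot>\<^bsub>Cat R\<^esub> sg_und g" for f g by (simp add: same_Cat)
  show "obj_list ?K xs \<Longrightarrow> circ xs \<in> Obj ?K" for xs using circ_cosemigroup[of xs] okD[of xs] by simp
  show "fst (circ xs) = ten R (map fst xs)" for xs by (simp add: cosemigroup_circ_def ten_def)
  show "fs \<noteq> [] \<Longrightarrow> set fs \<subseteq> Arr ?K \<Longrightarrow>
      (circ (map sg_dom fs), circ (map sg_cod fs), ten_arr R (map sg_und fs))
      \<in> hom ?K (circ (map (Dom ?K) fs)) (circ (map (Cod ?K) fs))" for fs
    using circ_cosemigroup_hom[of fs] by (simp add: hom_cosemigroup_cat Arr_cosemigroup_cat subset_eq)
  show "sg_und (circ (map sg_dom fs), circ (map sg_cod fs), ten_arr R (map sg_und fs)) = ten_arr R (map sg_und fs)" for fs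
    by simp
  show "obj_lists ?K xss \<Longrightarrow> (circ (concat xss), circ (map (\<lambda>Xs. circ Xs) xss), asc R (map (map fst) xss))
      \<in> hom ?K (circ (concat xss)) (circ (map (\<lambda>Xs. circ Xs) xss))" for xss
    using Psi_cosemigroup_hom[OF oksD] by (simp add: hom_cosemigroup_cat)
  show "sg_und (circ (concat xss), circ (map (\<lambda>Xs. circ Xs) xss), asc R (map (map fst) xss)) = asc R (map (map fst) xss)" for xss
    by simp
  show "x \<in> Obj ?K \<Longrightarrow> (circ [x], x, Unit R (fst x)) \<in> hom ?K (circ [x]) x" for x
    using upsilon_cosemigroup_hom[of x] by (simp add: hom_cosemigroup_cat)
  show "sg_und (circ [x], x, Unit R (fst x)) = Unit R (fst x)" for x by simp
qed

lemma semigroup_faithful_strict: "faithful_strict L (semigroup_moncat L R xi) fst sg_und"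
proof (rule faithful_strict.intro, unfold semigroup_moncat_simps)
  let ?K = "semigroup_cat R"
  note h = hom_semigroup_cat[OF oplax]
  have okD: "Xs \<noteq> [] \<and> (\<forall>X \<in> set Xs. cosemigroup (op_moncat R) (fst X) (snd X))" if "obj_list ?K Xs" for Xs
    using that by (auto simp: obj_list_def subset_iff Obj_semigroup_cat[OF oplax])
  have oksD: "Xss \<noteq> []" "\<forall>Xs \<in> set Xss. Xs \<noteq> [] \<and> (\<forall>X \<in> set Xs. cosemigroup (op_moncat R) (fst X) (snd X))"
    if "obj_lists ?K Xss" for Xss
    using that okD by (auto simp: obj_lists_def)
  show "lax_monoidal L" by (rule lax)
  show "category ?K" by (rule category_semigroup_cat[OF oplax])
  show "X \<in> Obj ?K \<Longrightarrow> fst X \<in> Obj C" for X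
    by (simp add: Obj_semigroup_cat[OF oplax] cosemigroup_def same_Cat)
  show "f \<in> hom ?K x y \<Longrightarrow> sg_und f \<in> hom C (fst x) (fst y)" for f x y
    by (auto simp: h cosemigroup_hom_def same_Cat)
  show "f \<in> hom ?K x y \<Longrightarrow> g \<in> hom ?K x y \<Longrightarrow> sg_und f = sg_und g \<Longrightarrow> f = g" for f g x y
    by (auto simp: h)
  show "sg_und (Ident ?K x) = Ident C (fst x)" for x by (simp add: same_Cat)
  show "sg_und (g \<cdot>\<^bsub>?K\<^esub> f) = sg_und g \<cdot>\<^bsub>C\<^esub> sg_und f" for f g by (simp add: same_Cat)
  show "obj_list ?K xs \<Longrightarrow> bullet xs \<in> Obj ?K" for xs
    using bullet_cosemigroup[of xs] okD[of xs] by (simp add: Obj_semigroup_cat[OF oplax])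
  show "fst (bullet xs) = ten L (map fst xs)" for xs by (simp add: semigroup_bullet_def ten_def)
  show "fs \<noteq> [] \<Longrightarrow> set fs \<subseteq> Arr ?K \<Longrightarrow>
      (bullet (map sg_dom fs), bullet (map sg_cod fs), ten_arr L (map sg_und fs))
      \<in> hom ?K (bullet (map (Dom ?K) fs)) (bullet (map (Cod ?K) fs))" for fs
    using bullet_cosemigroup_hom[of fs] by (simp add: h Arr_semigroup_cat[OF oplax] subset_eq)
  show "sg_und (bullet (map sg_dom fs), bullet (map sg_cod fs), ten_arr L (map sg_und fs)) = ten_arr L (map sg_und fs)" for fs
    by simp
  show "obj_lists ?K xss \<Longrightarrow> (bullet (map (\<lambda>Xs. bullet Xs) xss), bullet (concat xss), asc L (map (map fst) xss))
      \<in> hom ?K (bullet (map (\<lambda>Xs. bullet Xs) xss)) (bullet (concat xss))" for xss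
    using Phi_cosemigroup_hom[OF oksD] by (simp add: h)
  show "sg_und (bullet (map (\<lambda>Xs. bullet Xs) xss), bullet (concat xss), asc L (map (map fst) xss)) = asc L (map (map fst) xss)" for xss
    by simp
  show "x \<in> Obj ?K \<Longrightarrow> (x, bullet [x], Unit L (fst x)) \<in> hom ?K x (bullet [x])" for x
    using iota_cosemigroup_hom[of x] by (simp add: h Obj_semigroup_cat[OF oplax])
  show "sg_und (x, bullet [x], Unit L (fst x)) = Unit L (fst x)" for x by simp
qed

end

theorem theorem4p4:
  fixes L R :: "('o, 'a) moncat"
    and xi :: "nat \<Rightarrow> nat \<Rightarrow> 'o list list \<Rightarrow> 'a"
  assumes "duoidal L R xi"
  shows "oplax_monoidal (cosemigroup_moncat L R xi) \<and> lax_monoidal (semigroup_moncat L R xi)"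
  unfolding oplax_monoidal_def
  using faithful_strict.lax_N[OF duoidal.cosemigroup_faithful_strict[OF assms]]
    faithful_strict.lax_N[OF duoidal.semigroup_faithful_strict[OF assms]] by simp

end
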